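(* Let $p$ be a prime number, let $n\in\mathbb{Z}$, let $E_p=p^n\mathbb{Z}_p\subset\mathbb{Q}_p\subset\mathbb{P}^1(\mathbb{Q}_p)$, and let $\mu_p$ be the $\delta$-equilibrium measure of $E_p$. If $n\ge0$, then $\mu_p$ is the normalized Haar measure of $E_p$ as an additive group. If $n<0$, then $\mu_p$ can be written as a linear combination of the normalized Haar measure of $\mathbb{Z}_p$ and the normalized Haar measures of $p^k\mathbb{Z}_p^\times$ for $-1\ge k\ge n$. Moreover, \[ V_\delta(E_p)=\begin{cases}\displaystyle n\log p+\frac{\log p}{p-1} & \text{if } n\ge0,\\[2ex] \displaystyle\frac{p+p^{2n}}{p^2-1}\log p & \text{if } n<0.\end{cases} \]
   Context: Let $|\cdot|$ be the $p$-adic absolute value on $\mathbb{Q}_p$, normalized so that $|p|=1/p$. On $\mathbb{P}^1(\mathbb{Q}_p)$ the spherical metric is $\delta(x,y)=\frac{|x_0y_1-y_0x_1|}{\max\{|x_0|,|x_1|\}\max\{|y_0|,|y_1|\}}$ for $x=(x_0:x_1)$, $y=(y_0:y_1)$. Regarding $\mathbb{Q}_p$ as a subset of $\mathbb{P}^1(\mathbb{Q}_p)$ via $x\mapsto(x:1)$, this means $\delta(x,y)=\frac{|x-y|}{\max\{1,|x|\}\max\{1,|y|\}}$ for $x,y\in\mathbb{Q}_p$. For a Borel probability measure $\nu$ on $\mathbb{P}^1(\mathbb{Q}_p)$, the $\delta$-energy is $I_\delta(\nu)=\iint-\log\delta(x,y)\,d\nu(x)\,d\nu(y)$. For a compact set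 $E$, the $\delta$-Robin constant is $V_\delta(E)=\inf_\nu I_\delta(\nu)$, the infimum being over Borel probability measures $\nu$ supported on $E$. The $\delta$-equilibrium measure of $E$ is the unique Borel probability measure $\mu$ supported on $E$ with $I_\delta(\mu)=V_\delta(E)$. The normalized Haar measure of $\mathbb{Z}_p$ is its additive Haar probability measure. The normalized Haar measure of $p^k\mathbb{Z}_p^\times$ is the unique Borel probability measure on $p^k\mathbb{Z}_p^\times$ invariant under multiplication by elements of $\mathbb{Z}_p^\times$. *)

theory Defs
  imports "HOL-Probability.Probability" "Berlekamp_Zassenhaus.Finite_Field"
begin

section \<open>The \<open>p\<close>-adic absolute value on the rationals\<close>

definition padic_abs_rat :: "nat \<Rightarrow> rat \<Rightarrow> real" where
  "padic_abs_rat p x =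
    (if x = 0 then 0
     else case quotient_of x of (a, b) \<Rightarrow>
       real p powi (int (multiplicity (int p) b) - int (multiplicity (int p) a)))"

lemma padic_abs_rat_divide:
  assumes "prime p" "a \<noteq> 0" "b \<noteq> 0"
  shows "padic_abs_rat p (of_int a / of_int b)
           = real p powi (int (multiplicity (int p) b) - int (multiplicity (int p) a))"
proof -
  obtain c d where q: "quotient_of (of_int a / of_int b) = (c, d)"
    by (cases "quotient_of (of_int a / of_int b)")
  have d: "d > 0" using quotient_of_denom_pos[OF q] .
  have eq: "(of_int a / of_int b :: rat) = of_int c / of_int d"
    using quotient_of_div[OF q] .
  with assms d have c: "c \<noteq> 0" by auto
  from eq assms d have "(of_int (a * d) :: rat) = of_int (c * b)"
    by (simp add: field_simps)
  hence "a * d = c * b" by (simp only: of_int_eq_iff)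
  hence "multiplicity (int p) (a * d) = multiplicity (int p) (c * b)" by simp
  moreover have "prime_elem (int p)" using assms by simp
  ultimately have "multiplicity (int p) a + multiplicity (int p) d
                 = multiplicity (int p) c + multiplicity (int p) b"
    using assms c d by (simp add: prime_elem_multiplicity_mult_distrib)
  hence "int (multiplicity (int p) b) - int (multiplicity (int p) a)
       = int (multiplicity (int p) d) - int (multiplicity (int p) c)" by linarith
  thus ?thesis using assms q by (simp add: padic_abs_rat_def)
qed

lemma rat_common_denom:
  fixes x y :: rat
  obtains a b c :: int where "x = of_int a / of_int c" "y = of_int b / of_int c" "c > 0"
proof -
  obtain a1 b1 where 1: "quotient_of x = (a1, b1)" by (cases "quotient_of x")
  obtain a2 b2 where 2: "quotient_of y = (a2, b2)" by (cases "quotient_of y")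
  have pos: "b1 > 0" "b2 > 0"
    using quotient_of_denom_pos[OF 1] quotient_of_denom_pos[OF 2] by auto
  show ?thesis
    by (rule that[of "a1 * b2" "b1 * b2" "a2 * b1"])
       (use pos quotient_of_div[OF 1] quotient_of_div[OF 2] in auto)
qed

lemma padic_abs_rat_0 [simp]: "padic_abs_rat p 0 = 0"
  by (simp add: padic_abs_rat_def)

lemma padic_abs_rat_pos: "prime p \<Longrightarrow> x \<noteq> 0 \<Longrightarrow> padic_abs_rat p x > 0"
  by (auto simp: padic_abs_rat_def prime_gt_0_nat split: prod.splits intro!: zero_less_power_int)

lemma padic_abs_rat_nonneg: "padic_abs_rat p x \<ge> 0"
  by (auto simp: padic_abs_rat_def split: prod.splits intro!: zero_le_power_int)

lemma padic_abs_rat_eq_0: "prime p \<Longrightarrow> padic_abs_rat p x = 0 \<longleftrightarrow> x = 0"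
  using padic_abs_rat_pos[of p x] by (cases "x = 0") auto

lemma padic_abs_rat_1 [simp]: "padic_abs_rat p 1 = 1"
  by (simp add: padic_abs_rat_def)

lemma padic_abs_rat_mult:
  assumes "prime p"
  shows "padic_abs_rat p (x * y) = padic_abs_rat p x * padic_abs_rat p y"
proof (cases "x = 0 \<or> y = 0")
  case False
  obtain a b c where abc: "x = of_int a / of_int c" "y = of_int b / of_int c" "c > 0"
    by (rule rat_common_denom)
  with False have nz: "a \<noteq> 0" "b \<noteq> 0" "c \<noteq> 0" by auto
  have pe: "prime_elem (int p)" using assms by simp
  have "x * y = of_int (a * b) / of_int (c * c)" using abc by simp
  hence "padic_abs_rat p (x * y)
      = real p powi (int (multiplicity (int p) (c * c)) - int (multiplicity (int p) (a * b)))"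
    using padic_abs_rat_divide[OF assms, of "a * b" "c * c"] nz by simp
  also have "\<dots> = real p powi ((int (multiplicity (int p) c) - int (multiplicity (int p) a))
                 + (int (multiplicity (int p) c) - int (multiplicity (int p) b)))"
    using nz pe by (simp add: prime_elem_multiplicity_mult_distrib algebra_simps)
  also have "\<dots> = padic_abs_rat p x * padic_abs_rat p y"
    using nz abc assms padic_abs_rat_divide[OF assms, of a c] padic_abs_rat_divide[OF assms, of b c]
    by (subst power_int_add) (auto simp: prime_gt_0_nat)
  finally show ?thesis .
qed auto

lemma padic_abs_rat_minus: "prime p \<Longrightarrow> padic_abs_rat p (- x) = padic_abs_rat p x"
proof -
  assume p: "prime p"
  have "padic_abs_rat p (-1) ^ 2 = 1"
    using padic_abs_rat_mult[OF p, of "-1" "-1"] by (simp add: power2_eq_square)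
  hence "padic_abs_rat p (-1) = 1"
    using padic_abs_rat_nonneg[of p "-1"] by (simp add: power2_eq_1_iff)
  thus ?thesis using padic_abs_rat_mult[OF p, of "-1" x] by simp
qed

lemma padic_abs_rat_diff_commute:
  "prime p \<Longrightarrow> padic_abs_rat p (x - y) = padic_abs_rat p (y - x)"
  using padic_abs_rat_minus[of p "x - y"] by simp

lemma padic_abs_rat_inverse:
  assumes "prime p"
  shows "padic_abs_rat p (inverse x) = inverse (padic_abs_rat p x)"
proof (cases "x = 0")
  case False
  thus ?thesis
    using padic_abs_rat_mult[OF assms, of x "inverse x"] padic_abs_rat_pos[OF assms, of x]
    by (simp add: field_simps)
qed auto

lemma padic_abs_rat_add:
  assumes "prime p"
  shows "padic_abs_rat p (x + y) \<le> max (padic_abs_rat p x) (padic_abs_rat p y)"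
proof (cases "x = 0 \<or> y = 0 \<or> x + y = 0")
  case True
  thus ?thesis using padic_abs_rat_nonneg[of p x] padic_abs_rat_nonneg[of p y]
    by (auto simp: max_def)
next
  case False
  obtain a b c where abc: "x = of_int a / of_int c" "y = of_int b / of_int c" "c > 0"
    by (rule rat_common_denom)
  have xy: "x + y = of_int (a + b) / of_int c" using abc by (simp add: add_divide_distrib)
  with False abc have nz: "a \<noteq> 0" "b \<noteq> 0" "c \<noteq> 0" "a + b \<noteq> 0" by auto
  define v where "v = multiplicity (int p)"
  have nu: "\<not> is_unit (int p)" using assms by (metis not_prime_unit prime_nat_int_transfer)
  define m where "m = min (v a) (v b)"
  have "int p ^ m dvd a + b"
    unfolding m_def v_def by (intro dvd_add multiplicity_dvd') auto
  hence "m \<le> v (a + b)"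
    unfolding v_def using nz nu by (intro multiplicity_geI) auto
  hence "real p powi (int (v c) - int (v (a + b))) \<le> real p powi (int (v c) - int m)"
    using prime_ge_1_nat[OF assms] by (intro power_int_increasing) auto
  also have "\<dots> \<le> max (real p powi (int (v c) - int (v a))) (real p powi (int (v c) - int (v b)))"
    by (auto simp: m_def min_def)
  finally show ?thesis
    using padic_abs_rat_divide[OF assms, of "a + b" c] padic_abs_rat_divide[OF assms, of a c]
      padic_abs_rat_divide[OF assms, of b c] nz abc xy by (simp add: v_def)
qed

lemma padic_abs_rat_diff:
  assumes "prime p"
  shows "padic_abs_rat p (x - y) \<le> max (padic_abs_rat p x) (padic_abs_rat p y)"
  using padic_abs_rat_add[OF assms, of x "- y"] padic_abs_rat_minus[OF assms, of y] by simp

lemma padic_abs_rat_diff_abs: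
  assumes "prime p"
  shows "\<bar>padic_abs_rat p x - padic_abs_rat p y\<bar> \<le> padic_abs_rat p (x - y)"
  using padic_abs_rat_add[OF assms, of y "x - y"] padic_abs_rat_add[OF assms, of x "y - x"]
    padic_abs_rat_diff_commute[OF assms, of x y]
    padic_abs_rat_nonneg[of p x] padic_abs_rat_nonneg[of p y] padic_abs_rat_nonneg[of p "x - y"]
  by auto


section \<open>Cauchy and null sequences\<close>

definition padic_cauchy :: "nat \<Rightarrow> (nat \<Rightarrow> rat) \<Rightarrow> bool" where
  "padic_cauchy p X \<longleftrightarrow> (\<forall>e>0. \<exists>N. \<forall>m\<ge>N. \<forall>n\<ge>N. padic_abs_rat p (X m - X n) < e)"

definition padic_null :: "nat \<Rightarrow> (nat \<Rightarrow> rat) \<Rightarrow> bool" where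
  "padic_null p X \<longleftrightarrow> (\<lambda>n. padic_abs_rat p (X n)) \<longlonglongrightarrow> 0"

lemma padic_cauchy_const: "padic_cauchy p (\<lambda>_. c)"
  by (simp add: padic_cauchy_def)

lemma padic_cauchy_abs_convergent:
  assumes "prime p" "padic_cauchy p X"
  shows "convergent (\<lambda>n. padic_abs_rat p (X n))"
proof -
  have "Cauchy (\<lambda>n. padic_abs_rat p (X n))"
  proof (rule metric_CauchyI)
    fix e :: real assume "e > 0"
    then obtain N where N: "\<forall>m\<ge>N. \<forall>n\<ge>N. padic_abs_rat p (X m - X n) < e"
      using assms unfolding padic_cauchy_def by blast
    have "dist (padic_abs_rat p (X m)) (padic_abs_rat p (X n)) < e" if "m \<ge> N" "n \<ge> N" for m n
      using N that padic_abs_rat_diff_abs[OF assms(1), of "X m" "X n"]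
      unfolding dist_real_def by (meson le_less_trans)
    thus "\<exists>N. \<forall>m\<ge>N. \<forall>n\<ge>N. dist (padic_abs_rat p (X m)) (padic_abs_rat p (X n)) < e"
      by blast
  qed
  thus ?thesis by (simp add: Cauchy_convergent_iff)
qed

lemma padic_cauchy_bounded:
  assumes "prime p" "padic_cauchy p X"
  obtains B where "B > 0" "\<And>n. padic_abs_rat p (X n) \<le> B"
proof -
  have "Bseq (\<lambda>n. padic_abs_rat p (X n))"
    using convergent_imp_Bseq padic_cauchy_abs_convergent[OF assms] by blast
  then obtain B where "B > 0" "\<And>n. norm (padic_abs_rat p (X n)) \<le> B"
    by (auto simp: Bseq_def)
  thus ?thesis by (intro that[of B]) (auto simp: abs_le_iff)
qed

lemma padic_cauchy_add:
  assumes "prime p" "padic_cauchy p X" "padic_cauchy p Y"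
  shows "padic_cauchy p (\<lambda>n. X n + Y n)"
  unfolding padic_cauchy_def
proof (intro allI impI)
  fix e :: real assume e: "e > 0"
  obtain N where N: "\<forall>m\<ge>N. \<forall>n\<ge>N. padic_abs_rat p (X m - X n) < e"
    using assms e unfolding padic_cauchy_def by blast
  obtain M where M: "\<forall>m\<ge>M. \<forall>n\<ge>M. padic_abs_rat p (Y m - Y n) < e"
    using assms e unfolding padic_cauchy_def by blast
  have "padic_abs_rat p ((X m + Y m) - (X n + Y n)) < e" if "m \<ge> max N M" "n \<ge> max N M" for m n
  proof -
    have "(X m + Y m) - (X n + Y n) = (X m - X n) + (Y m - Y n)" by simp
    hence "padic_abs_rat p ((X m + Y m) - (X n + Y n))
            \<le> max (padic_abs_rat p (X m - X n)) (padic_abs_rat p (Y m - Y n))"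
      by (metis padic_abs_rat_add[OF assms(1)])
    also have "\<dots> < e" using N M that by auto
    finally show ?thesis .
  qed
  thus "\<exists>N. \<forall>m\<ge>N. \<forall>n\<ge>N. padic_abs_rat p ((X m + Y m) - (X n + Y n)) < e" by blast
qed

lemma padic_cauchy_minus:
  assumes "prime p" "padic_cauchy p X"
  shows "padic_cauchy p (\<lambda>n. - X n)"
  using assms padic_abs_rat_diff_commute[OF assms(1)] unfolding padic_cauchy_def by simp

lemma padic_cauchy_diff:
  assumes "prime p" "padic_cauchy p X" "padic_cauchy p Y"
  shows "padic_cauchy p (\<lambda>n. X n - Y n)"
  using padic_cauchy_add[OF assms(1,2) padic_cauchy_minus[OF assms(1,3)]] by simp

lemma padic_cauchy_mult:
  assumes "prime p" "padic_cauchy p X" "padic_cauchy p Y"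
  shows "padic_cauchy p (\<lambda>n. X n * Y n)"
  unfolding padic_cauchy_def
proof (intro allI impI)
  fix e :: real assume e: "e > 0"
  obtain A where A: "A > 0" "\<And>n. padic_abs_rat p (X n) \<le> A"
    using padic_cauchy_bounded[OF assms(1,2)] by blast
  obtain B where B: "B > 0" "\<And>n. padic_abs_rat p (Y n) \<le> B"
    using padic_cauchy_bounded[OF assms(1,3)] by blast
  obtain N where N: "\<forall>m\<ge>N. \<forall>n\<ge>N. padic_abs_rat p (X m - X n) < e / B"
    using assms e B(1) unfolding padic_cauchy_def by (meson divide_pos_pos)
  obtain M where M: "\<forall>m\<ge>M. \<forall>n\<ge>M. padic_abs_rat p (Y m - Y n) < e / A"
    using assms e A(1) unfolding padic_cauchy_def by (meson divide_pos_pos)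
  have "padic_abs_rat p (X m * Y m - X n * Y n) < e" if mn: "m \<ge> max N M" "n \<ge> max N M" for m n
  proof -
    have "X m * Y m - X n * Y n = X m * (Y m - Y n) + (X m - X n) * Y n"
      by (simp add: algebra_simps)
    hence "padic_abs_rat p (X m * Y m - X n * Y n)
        \<le> max (padic_abs_rat p (X m) * padic_abs_rat p (Y m - Y n))
               (padic_abs_rat p (X m - X n) * padic_abs_rat p (Y n))"
      using padic_abs_rat_add[OF assms(1), of "X m * (Y m - Y n)" "(X m - X n) * Y n"]
      by (simp add: padic_abs_rat_mult[OF assms(1)])
    also have "\<dots> \<le> max (A * padic_abs_rat p (Y m - Y n)) (padic_abs_rat p (X m - X n) * B)"
      using A B by (intro max.mono mult_mono padic_abs_rat_nonneg) (auto intro: less_imp_le)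
    also have "\<dots> < e"
      using N M mn A(1) B(1) by (auto simp: field_simps)
    finally show ?thesis .
  qed
  thus "\<exists>N. \<forall>m\<ge>N. \<forall>n\<ge>N. padic_abs_rat p (X m * Y m - X n * Y n) < e" by blast
qed

lemma padic_not_null:
  assumes "prime p" "padic_cauchy p X" "\<not> padic_null p X"
  obtains b where "b > 0" "\<forall>\<^sub>F n in sequentially. padic_abs_rat p (X n) > b"
proof -
  obtain l where l: "(\<lambda>n. padic_abs_rat p (X n)) \<longlonglongrightarrow> l"
    using padic_cauchy_abs_convergent[OF assms(1,2)] by (auto simp: convergent_def)
  have "l \<ge> 0" using l by (rule LIMSEQ_le_const) (auto intro: padic_abs_rat_nonneg)
  moreover have "l \<noteq> 0" using l assms(3) by (auto simp: padic_null_def)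
  ultimately have "l / 2 > 0" "l / 2 < l" by auto
  with order_tendstoD(1)[OF l, of "l / 2"] show ?thesis using that[of "l / 2"] by blast
qed

lemma padic_cauchy_inverse:
  assumes "prime p" "padic_cauchy p X" "\<not> padic_null p X"
  shows "padic_cauchy p (\<lambda>n. inverse (X n))"
  unfolding padic_cauchy_def
proof (intro allI impI)
  fix e :: real assume e: "e > 0"
  obtain b where b: "b > 0" "\<forall>\<^sub>F n in sequentially. padic_abs_rat p (X n) > b"
    using padic_not_null[OF assms] by blast
  then obtain M where M: "\<And>n. n \<ge> M \<Longrightarrow> padic_abs_rat p (X n) > b"
    by (auto simp: eventually_sequentially)
  have "e * b * b > 0" using e b by simp
  then obtain N where N: "\<And>m n. m \<ge> N \<Longrightarrow> n \<ge> N \<Longrightarrow> padic_abs_rat p (X m - X n) < e * b * b"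
    using assms unfolding padic_cauchy_def by blast
  have "padic_abs_rat p (inverse (X m) - inverse (X n)) < e" if mn: "m \<ge> max N M" "n \<ge> max N M" for m n
  proof -
    have gt: "padic_abs_rat p (X m) > b" "padic_abs_rat p (X n) > b" using M mn by auto
    hence nz: "X m \<noteq> 0" "X n \<noteq> 0" using b(1) by auto
    have "inverse (X m) - inverse (X n) = inverse (X m) * (X n - X m) * inverse (X n)"
      using nz by (simp add: field_simps)
    hence "padic_abs_rat p (inverse (X m) - inverse (X n))
        = padic_abs_rat p (X n - X m) / (padic_abs_rat p (X m) * padic_abs_rat p (X n))"
      by (simp only: padic_abs_rat_mult[OF assms(1)] padic_abs_rat_inverse[OF assms(1)])
         (simp add: divide_simps)
    also have "\<dots> \<le> padic_abs_rat p (X n - X m) / (b * b)"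
      using gt b(1) by (intro divide_left_mono mult_mono mult_pos_pos padic_abs_rat_nonneg) auto
    also have "\<dots> < e" using N[of n m] mn b(1) by (simp add: field_simps)
    finally show ?thesis .
  qed
  thus "\<exists>N. \<forall>m\<ge>N. \<forall>n\<ge>N. padic_abs_rat p (inverse (X m) - inverse (X n)) < e" by blast
qed

lemma padic_null_le:
  assumes "\<And>n. padic_abs_rat p (X n) \<le> f n" "f \<longlonglongrightarrow> 0"
  shows "padic_null p X"
  unfolding padic_null_def
  by (rule tendsto_sandwich[of "\<lambda>_. 0" _ _ f]) (auto simp: assms padic_abs_rat_nonneg)

lemma padic_null_0: "padic_null p (\<lambda>_. 0)"
  by (simp add: padic_null_def)

lemma padic_null_add:
  assumes "prime p" "padic_null p X" "padic_null p Y"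
  shows "padic_null p (\<lambda>n. X n + Y n)"
proof (rule padic_null_le)
  show "(\<lambda>n. max (padic_abs_rat p (X n)) (padic_abs_rat p (Y n))) \<longlonglongrightarrow> 0"
    using tendsto_max[OF assms(2,3)[unfolded padic_null_def]] by simp
qed (rule padic_abs_rat_add[OF assms(1)])

lemma padic_null_minus: "prime p \<Longrightarrow> padic_null p X \<Longrightarrow> padic_null p (\<lambda>n. - X n)"
  by (simp add: padic_null_def padic_abs_rat_minus)

lemma padic_null_mult:
  assumes "prime p" "padic_cauchy p X" "padic_null p Y"
  shows "padic_null p (\<lambda>n. X n * Y n)"
proof -
  obtain B where B: "B > 0" "\<And>n. padic_abs_rat p (X n) \<le> B"
    using padic_cauchy_bounded[OF assms(1,2)] by blast
  show ?thesis
  proof (rule padic_null_le)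
    show "padic_abs_rat p (X n * Y n) \<le> B * padic_abs_rat p (Y n)" for n
      using B by (simp add: padic_abs_rat_mult[OF assms(1)] padic_abs_rat_nonneg mult_right_mono)
    show "(\<lambda>n. B * padic_abs_rat p (Y n)) \<longlonglongrightarrow> 0"
      using assms(3) unfolding padic_null_def by (rule tendsto_mult_right_zero)
  qed
qed


section \<open>The field of \<open>p\<close>-adic numbers\<close>

text \<open>
  The prime is the cardinality of the type argument, which ranges over all types of prime
  cardinality. The field is the quotient of the ring of \<open>p\<close>-adic Cauchy sequences of
  rationals by the ideal of null sequences, that is, the completion of the rationals.
\<close>

typedef ('p :: prime_card) padic_seq = "{X. padic_cauchy CARD('p) X}"
  morphisms seq_of Abs_padic_seq
  by (auto intro: exI[of _ "\<lambda>_. 0"] padic_cauchy_const)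

setup_lifting type_definition_padic_seq

instantiation padic_seq :: (prime_card) comm_ring_1
begin

lift_definition zero_padic_seq :: "'a padic_seq" is "\<lambda>_. 0" by (rule padic_cauchy_const)
lift_definition one_padic_seq :: "'a padic_seq" is "\<lambda>_. 1" by (rule padic_cauchy_const)
lift_definition plus_padic_seq :: "'a padic_seq \<Rightarrow> 'a padic_seq \<Rightarrow> 'a padic_seq"
  is "\<lambda>X Y n. X n + Y n" by (rule padic_cauchy_add[OF prime_card])
lift_definition uminus_padic_seq :: "'a padic_seq \<Rightarrow> 'a padic_seq"
  is "\<lambda>X n. - X n" by (rule padic_cauchy_minus[OF prime_card])
lift_definition minus_padic_seq :: "'a padic_seq \<Rightarrow> 'a padic_seq \<Rightarrow> 'a padic_seq"
  is "\<lambda>X Y n. X n - Y n" by (rule padic_cauchy_diff[OF prime_card])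
lift_definition times_padic_seq :: "'a padic_seq \<Rightarrow> 'a padic_seq \<Rightarrow> 'a padic_seq"
  is "\<lambda>X Y n. X n * Y n" by (rule padic_cauchy_mult[OF prime_card])

instance
  by standard (transfer; simp add: algebra_simps fun_eq_iff)+

end

lift_definition null_seq :: "('p :: prime_card) padic_seq \<Rightarrow> bool" is "padic_null CARD('p)" .

lift_definition inverse_seq :: "('p :: prime_card) padic_seq \<Rightarrow> 'p padic_seq"
  is "\<lambda>X. if padic_null CARD('p) X then (\<lambda>_. 0) else (\<lambda>n. inverse (X n))"
  using padic_cauchy_inverse[OF prime_card] padic_cauchy_const by auto

lemma null_seq_0: "null_seq 0"
  by transfer (rule padic_null_0)

lemma null_seq_add: "null_seq X \<Longrightarrow> null_seq Y \<Longrightarrow> null_seq (X + Y)"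
  by transfer (rule padic_null_add[OF prime_card])

lemma null_seq_minus: "null_seq X \<Longrightarrow> null_seq (- X)"
  by transfer (rule padic_null_minus[OF prime_card])

lemma null_seq_mult: "null_seq Y \<Longrightarrow> null_seq (X * Y)"
  by transfer (rule padic_null_mult[OF prime_card])

lemma null_seq_1: "\<not> null_seq (1 :: 'p :: prime_card padic_seq)"
  by transfer (simp add: padic_null_def LIMSEQ_const_iff)

lemma null_seq_inverse:
  assumes "\<not> null_seq X"
  shows "null_seq (inverse_seq X * X - 1)"
  using assms
proof transfer
  fix X assume X: "padic_cauchy CARD('a) X" "\<not> padic_null CARD('a) X"
  obtain b where b: "b > 0" "\<forall>\<^sub>F n in sequentially. padic_abs_rat CARD('a) (X n) > b"
    using padic_not_null[OF prime_card X] by blast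
  have "\<forall>\<^sub>F n in sequentially. padic_abs_rat CARD('a) (inverse (X n) * X n - 1) = 0"
    using b(2)
  proof eventually_elim
    case (elim n)
    with b(1) have "X n \<noteq> 0" by auto
    thus ?case by simp
  qed
  hence "(\<lambda>n. padic_abs_rat CARD('a) (inverse (X n) * X n - 1)) \<longlonglongrightarrow> 0"
    by (rule tendsto_eventually)
  thus "padic_null CARD('a) (\<lambda>n. (if padic_null CARD('a) X then (\<lambda>_. 0) else (\<lambda>n. inverse (X n))) n * X n - 1)"
    using X by (simp add: padic_null_def)
qed

quotient_type 'p padic = "('p :: prime_card) padic_seq" / "\<lambda>X Y. null_seq (X - Y)"
proof (rule equivpI)
  show "reflp (\<lambda>X Y :: 'p padic_seq. null_seq (X - Y))"
    by (auto intro!: reflpI simp: null_seq_0)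
  show "symp (\<lambda>X Y :: 'p padic_seq. null_seq (X - Y))"
    by (rule sympI) (metis null_seq_minus minus_diff_eq)
  show "transp (\<lambda>X Y :: 'p padic_seq. null_seq (X - Y))"
    by (rule transpI) (metis null_seq_add diff_add_cancel add_diff_eq)
qed

instantiation padic :: (prime_card) field
begin

lift_definition zero_padic :: "'a padic" is 0 .
lift_definition one_padic :: "'a padic" is 1 .
lift_definition plus_padic :: "'a padic \<Rightarrow> 'a padic \<Rightarrow> 'a padic" is "(+)"
  by (metis null_seq_add add_diff_add)
lift_definition uminus_padic :: "'a padic \<Rightarrow> 'a padic" is uminus
  by (metis null_seq_minus minus_diff_minus)
lift_definition minus_padic :: "'a padic \<Rightarrow> 'a padic \<Rightarrow> 'a padic" is "(-)"
proof -
  fix X X' Y Y' :: "'a padic_seq"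
  assume "null_seq (X - X')" "null_seq (Y - Y')"
  hence "null_seq ((X - X') + - (Y - Y'))" by (intro null_seq_add null_seq_minus)
  thus "null_seq ((X - Y) - (X' - Y'))" by (simp add: algebra_simps)
qed
lift_definition times_padic :: "'a padic \<Rightarrow> 'a padic \<Rightarrow> 'a padic" is "(*)"
proof -
  fix X X' Y Y' :: "'a padic_seq"
  assume "null_seq (X - X')" "null_seq (Y - Y')"
  hence "null_seq (X * (Y - Y') + Y' * (X - X'))" by (intro null_seq_add null_seq_mult)
  thus "null_seq (X * Y - X' * Y')" by (simp add: algebra_simps)
qed
lift_definition inverse_padic :: "'a padic \<Rightarrow> 'a padic" is inverse_seq
proof -
  fix X Y :: "'a padic_seq"
  assume XY: "null_seq (X - Y)"
  show "null_seq (inverse_seq X - inverse_seq Y)"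
  proof (cases "null_seq X")
    case True
    have "null_seq Y" using null_seq_add[OF True null_seq_minus[OF XY]] by simp
    with True have "inverse_seq X = 0" "inverse_seq Y = 0" by (transfer; simp)+
    thus ?thesis by (simp add: null_seq_0)
  next
    case False
    hence Y: "\<not> null_seq Y" using null_seq_add[OF XY, of Y] by auto
    let ?I = "inverse_seq X" and ?J = "inverse_seq Y"
    have "null_seq (- (?J * (?I * X - 1)) + ?I * (?J * Y - 1) + (?I * ?J) * (X - Y))"
      by (intro null_seq_add null_seq_minus null_seq_mult null_seq_inverse False Y XY)
    also have "- (?J * (?I * X - 1)) + ?I * (?J * Y - 1) + (?I * ?J) * (X - Y) = - (?I - ?J)"
      by (simp add: algebra_simps)
    finally show ?thesis using null_seq_minus by fastforce
  qed
qed
definition divide_padic :: "'a padic \<Rightarrow> 'a padic \<Rightarrow> 'a padic"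
  where "divide_padic x y = x * inverse y"

instance
proof
  fix a b c :: "'a padic"
  show "(a + b) + c = a + (b + c)" by transfer (simp add: null_seq_0 algebra_simps)
  show "a + b = b + a" by transfer (simp add: null_seq_0 algebra_simps)
  show "0 + a = a" by transfer (simp add: null_seq_0)
  show "- a + a = 0" by transfer (simp add: null_seq_0)
  show "a - b = a + - b" by transfer (simp add: null_seq_0)
  show "(a * b) * c = a * (b * c)" by transfer (simp add: null_seq_0 algebra_simps)
  show "a * b = b * a" by transfer (simp add: null_seq_0 algebra_simps)
  show "1 * a = a" by transfer (simp add: null_seq_0)
  show "(a + b) * c = a * c + b * c" by transfer (simp add: null_seq_0 algebra_simps)
  show "(0 :: 'a padic) \<noteq> 1"
  proof transfer
    show "\<not> null_seq (0 - 1 :: 'a padic_seq)"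
      using null_seq_minus[of "- 1 :: 'a padic_seq"] null_seq_1 by auto
  qed
  show "a \<noteq> 0 \<Longrightarrow> inverse a * a = 1" by transfer (simp add: null_seq_inverse)
  show "a div b = a * inverse b" by (rule divide_padic_def)
  show "inverse (0 :: 'a padic) = 0"
  proof transfer
    have "inverse_seq (0 :: 'a padic_seq) = 0" by transfer (simp add: padic_null_0)
    thus "null_seq (inverse_seq 0 - 0 :: 'a padic_seq)" by (simp add: null_seq_0)
  qed
qed

end

lift_definition seq_abs :: "('p :: prime_card) padic_seq \<Rightarrow> real"
  is "\<lambda>X. lim (\<lambda>n. padic_abs_rat CARD('p) (X n))" .

lemma seq_abs_LIMSEQ:
  "(\<lambda>n. padic_abs_rat CARD('p) (seq_of X n)) \<longlonglongrightarrow> seq_abs (X :: 'p :: prime_card padic_seq)"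
  using seq_of[of X] padic_cauchy_abs_convergent[OF prime_card]
  by (auto simp: seq_abs.rep_eq convergent_LIMSEQ_iff)

lemma seq_abs_unique:
  "(\<lambda>n. padic_abs_rat CARD('p) (seq_of X n)) \<longlonglongrightarrow> l \<Longrightarrow> seq_abs (X :: 'p :: prime_card padic_seq) = l"
  using seq_abs_LIMSEQ LIMSEQ_unique by blast

lemma seq_abs_eq_0: "seq_abs X = 0 \<longleftrightarrow> null_seq X"
  using seq_abs_LIMSEQ[of X] seq_abs_unique[of X 0]
  by (auto simp: null_seq.rep_eq padic_null_def)

lemma seq_abs_add: "seq_abs (X + Y) \<le> max (seq_abs X) (seq_abs Y)"
  by (rule LIMSEQ_le[OF seq_abs_LIMSEQ tendsto_max[OF seq_abs_LIMSEQ seq_abs_LIMSEQ]])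
     (auto simp: plus_padic_seq.rep_eq padic_abs_rat_add[OF prime_card])

lemma seq_abs_minus: "seq_abs (- X) = seq_abs X"
  by (rule seq_abs_unique)
     (simp add: uminus_padic_seq.rep_eq padic_abs_rat_minus[OF prime_card] seq_abs_LIMSEQ)

lemma seq_abs_mult: "seq_abs (X * Y) = seq_abs X * seq_abs Y"
  by (rule seq_abs_unique)
     (simp add: times_padic_seq.rep_eq padic_abs_rat_mult[OF prime_card] tendsto_mult seq_abs_LIMSEQ)

lemma seq_abs_nonneg: "seq_abs X \<ge> 0"
  by (rule LIMSEQ_le_const[OF seq_abs_LIMSEQ]) (auto intro: padic_abs_rat_nonneg)

lift_definition padic_abs :: "('p :: prime_card) padic \<Rightarrow> real" is seq_abs
proof -
  fix X Y :: "'p padic_seq"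
  assume XY: "null_seq (X - Y)"
  hence "seq_abs (X - Y) = 0" "seq_abs (Y - X) = 0"
    using seq_abs_eq_0 null_seq_minus[OF XY] by auto
  thus "seq_abs X = seq_abs Y"
    using seq_abs_add[of "X - Y" Y] seq_abs_add[of "Y - X" X] seq_abs_nonneg[of X] seq_abs_nonneg[of Y]
    by simp
qed

lemma padic_abs_eq_0 [simp]: "padic_abs x = 0 \<longleftrightarrow> x = 0"
  by transfer (simp add: seq_abs_eq_0)

lemma padic_abs_nonneg [simp]: "padic_abs x \<ge> 0"
  by transfer (rule seq_abs_nonneg)

lemma padic_abs_pos [simp]: "padic_abs x > 0 \<longleftrightarrow> x \<noteq> 0"
  by (simp add: less_le)

lemma padic_abs_minus [simp]: "padic_abs (- x) = padic_abs x"
  by transfer (rule seq_abs_minus)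

lemma padic_abs_mult: "padic_abs (x * y) = padic_abs x * padic_abs y"
  by transfer (rule seq_abs_mult)

lemma padic_abs_add: "padic_abs (x + y) \<le> max (padic_abs x) (padic_abs y)"
  by transfer (rule seq_abs_add)

lemma padic_abs_diff_commute: "padic_abs (x - y) = padic_abs (y - x)"
  using padic_abs_minus[of "x - y"] by simp

instantiation padic :: (prime_card) metric_space
begin

definition dist_padic :: "'a padic \<Rightarrow> 'a padic \<Rightarrow> real"
  where "dist_padic x y = padic_abs (x - y)"
definition uniformity_padic :: "('a padic \<times> 'a padic) filter"
  where "uniformity_padic = (INF e\<in>{0<..}. principal {(x, y). dist x y < e})"
definition open_padic :: "'a padic set \<Rightarrow> bool"
  where "open_padic U \<longleftrightarrow> (\<forall>x\<in>U. eventually (\<lambda>(x', y). x' = x \<longrightarrow> y \<in> U) uniformity)"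

instance
proof
  fix x y z :: "'a padic"
  show "dist x y = 0 \<longleftrightarrow> x = y" by (simp add: dist_padic_def)
  have "dist x y = padic_abs ((x - z) + (z - y))" by (simp add: dist_padic_def)
  also have "\<dots> \<le> padic_abs (x - z) + padic_abs (z - y)"
    using padic_abs_add[of "x - z" "z - y"] padic_abs_nonneg[of "x - z"] padic_abs_nonneg[of "z - y"]
    by linarith
  finally show "dist x y \<le> dist x z + dist y z"
    using padic_abs_diff_commute[of z y] by (simp add: dist_padic_def)
qed (simp_all add: uniformity_padic_def open_padic_def)

end


lifting_forget padic.lifting


section \<open>The projective line with the spherical metric\<close>

definition proj_rel :: "'a :: field \<times> 'a \<Rightarrow> 'a \<times> 'a \<Rightarrow> bool" where
  "proj_rel x y \<longleftrightarrow> x \<noteq> (0, 0) \<and> y \<noteq> (0, 0) \<and>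
    (\<exists>c. c \<noteq> 0 \<and> fst y = c * fst x \<and> snd y = c * snd x)"

quotient_type 'p padic_P1 = "'p :: prime_card padic \<times> 'p padic" / partial: proj_rel
proof (rule part_equivpI)
  show "\<exists>x :: 'p padic \<times> 'p padic. proj_rel x x"
    by (rule exI[of _ "(1, 0)"]) (auto simp: proj_rel_def intro: exI[of _ 1])
  show "symp (proj_rel :: 'p padic \<times> 'p padic \<Rightarrow> _)"
  proof (rule sympI)
    fix x y :: "'p padic \<times> 'p padic"
    assume "proj_rel x y"
    then obtain c where "c \<noteq> 0" "fst y = c * fst x" "snd y = c * snd x" "x \<noteq> (0,0)" "y \<noteq> (0,0)"
      by (auto simp: proj_rel_def)
    thus "proj_rel y x"
      unfolding proj_rel_def by (auto intro!: exI[of _ "inverse c"])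
  qed
  show "transp (proj_rel :: 'p padic \<times> 'p padic \<Rightarrow> _)"
  proof (rule transpI)
    fix x y z :: "'p padic \<times> 'p padic"
    assume "proj_rel x y" "proj_rel y z"
    then obtain c d where "c \<noteq> 0" "fst y = c * fst x" "snd y = c * snd x" "x \<noteq> (0,0)"
      "d \<noteq> 0" "fst z = d * fst y" "snd z = d * snd y" "z \<noteq> (0,0)"
      by (auto simp: proj_rel_def)
    thus "proj_rel x z"
      unfolding proj_rel_def by (auto intro!: exI[of _ "d * c"])
  qed
qed

definition homog_dist :: "('p :: prime_card) padic \<times> 'p padic \<Rightarrow> 'p padic \<times> 'p padic \<Rightarrow> real" where
  "homog_dist x y = padic_abs (fst x * snd y - fst y * snd x) /
     (max (padic_abs (fst x)) (padic_abs (snd x)) * max (padic_abs (fst y)) (padic_abs (snd y)))"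

lemma homog_dist_scale:
  assumes "c \<noteq> 0" "d \<noteq> 0"
  shows "homog_dist (c * x0, c * x1) (d * y0, d * y1) = homog_dist (x0, x1) (y0, y1)"
proof -
  have max: "max (padic_abs (c * u)) (padic_abs (c * v)) = padic_abs c * max (padic_abs u) (padic_abs v)"
    for c u v :: "'a padic"
    by (simp add: padic_abs_mult max_mult_distrib_left)
  have "c * x0 * (d * y1) - d * y0 * (c * x1) = (c * d) * (x0 * y1 - y0 * x1)"
    by (simp add: algebra_simps)
  hence num: "padic_abs (c * x0 * (d * y1) - d * y0 * (c * x1))
      = padic_abs c * padic_abs d * padic_abs (x0 * y1 - y0 * x1)"
    by (simp only: padic_abs_mult)
  show ?thesis
    using assms unfolding homog_dist_def fst_conv snd_conv max num by simp
qed

lift_definition spherical_dist :: "('p :: prime_card) padic_P1 \<Rightarrow> 'p padic_P1 \<Rightarrow> real"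
  is homog_dist
proof -
  fix x x' y y' :: "'p padic \<times> 'p padic"
  assume "proj_rel x x'" "proj_rel y y'"
  then obtain c d where "c \<noteq> 0" "x' = (c * fst x, c * snd x)" "d \<noteq> 0" "y' = (d * fst y, d * snd y)"
    by (auto simp: proj_rel_def prod_eq_iff)
  thus "homog_dist x y = homog_dist x' y'"
    using homog_dist_scale[of c d "fst x" "snd x" "fst y" "snd y"] by simp
qed

lemma padic_max_pos: "(x0, x1) \<noteq> (0, 0) \<Longrightarrow> max (padic_abs x0) (padic_abs x1) > 0"
  by (auto simp: less_max_iff_disj)

lemma proj_rel_self_iff: "proj_rel x x \<longleftrightarrow> x \<noteq> (0, 0)"
  by (auto simp: proj_rel_def intro: exI[of _ 1])

lemma proj_rel_iff_cross:
  fixes x0 :: "'a :: field"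
  assumes "(x0, x1) \<noteq> (0, 0)" "(y0, y1) \<noteq> (0, 0)"
  shows "proj_rel (x0, x1) (y0, y1) \<longleftrightarrow> x0 * y1 - y0 * x1 = 0"
proof
  assume eq: "x0 * y1 - y0 * x1 = 0"
  show "proj_rel (x0, x1) (y0, y1)"
  proof (cases "x0 = 0")
    case True
    with eq assms have "x1 \<noteq> 0" "y0 = 0" "y1 \<noteq> 0" by auto
    with True assms show ?thesis unfolding proj_rel_def by (auto intro!: exI[of _ "y1 / x1"])
  next
    case False
    have "y0 \<noteq> 0" using eq False assms by auto
    with False eq assms show ?thesis
      unfolding proj_rel_def by (auto intro!: exI[of _ "y0 / x0"] simp: field_simps)
  qed
qed (auto simp: proj_rel_def)

lemma homog_dist_eq_0:
  assumes "x \<noteq> (0, 0)" "y \<noteq> (0, 0)"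
  shows "homog_dist x y = 0 \<longleftrightarrow> proj_rel x y"
proof -
  obtain x0 x1 where x: "x = (x0, x1)" by (cases x)
  obtain y0 y1 where y: "y = (y0, y1)" by (cases y)
  have "max (padic_abs x0) (padic_abs x1) \<noteq> 0" "max (padic_abs y0) (padic_abs y1) \<noteq> 0"
    using padic_max_pos[of x0 x1] padic_max_pos[of y0 y1] assms unfolding x y by linarith+
  thus ?thesis
    using proj_rel_iff_cross[of x0 x1 y0 y1] assms unfolding x y homog_dist_def by simp
qed

lemma homog_dist_triangle:
  assumes "x \<noteq> (0, 0)" "y \<noteq> (0, 0)" "z \<noteq> (0, 0)"
  shows "homog_dist x y \<le> homog_dist x z + homog_dist y z"
proof -
  obtain x0 x1 where x: "x = (x0, x1)" by (cases x)
  obtain y0 y1 where y: "y = (y0, y1)" by (cases y)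
  obtain z0 z1 where z: "z = (z0, z1)" by (cases z)
  define a where "a = max (padic_abs x0) (padic_abs x1)"
  define b where "b = max (padic_abs y0) (padic_abs y1)"
  define c where "c = max (padic_abs z0) (padic_abs z1)"
  have pos: "a > 0" "b > 0" "c > 0"
    unfolding a_def b_def c_def by (rule padic_max_pos, use assms x y z in simp)+
  define P where "P = padic_abs (x0 * y1 - y0 * x1)"
  define Q where "Q = padic_abs (x0 * z1 - z0 * x1)"
  define R where "R = padic_abs (y0 * z1 - z0 * y1)"
  have ge: "P \<ge> 0" "Q \<ge> 0" "R \<ge> 0" by (simp_all add: P_def Q_def R_def)
  have tri: "padic_abs w * P \<le> Q * b + R * a"
    if "w * (x0 * y1 - y0 * x1) = (x0 * z1 - z0 * x1) * v + - ((y0 * z1 - z0 * y1) * u)"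
      "padic_abs v \<le> b" "padic_abs u \<le> a" for u v w
  proof -
    have "padic_abs w * P = padic_abs (w * (x0 * y1 - y0 * x1))"
      by (simp only: P_def padic_abs_mult)
    also have "\<dots> \<le> max (padic_abs ((x0 * z1 - z0 * x1) * v)) (padic_abs (- ((y0 * z1 - z0 * y1) * u)))"
      unfolding that(1) by (rule padic_abs_add)
    also have "\<dots> = max (Q * padic_abs v) (R * padic_abs u)"
      by (simp only: padic_abs_mult padic_abs_minus Q_def R_def)
    also have "\<dots> \<le> max (Q * b) (R * a)"
      using that(2,3) ge by (intro max.mono mult_left_mono)
    also have "\<dots> \<le> Q * b + R * a" using ge pos by simp
    finally show ?thesis .
  qed
  have "padic_abs z1 * P \<le> Q * b + R * a"
    by (rule tri[of _ y1 x1]) (simp_all add: algebra_simps a_def b_def)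
  moreover have "padic_abs z0 * P \<le> Q * b + R * a"
    by (rule tri[of _ y0 x0]) (simp_all add: algebra_simps a_def b_def)
  moreover have "c = padic_abs z0 \<or> c = padic_abs z1" unfolding c_def by linarith
  ultimately have "c * P \<le> Q * b + R * a" by (elim disjE) simp_all
  hence "c * P / (a * b * c) \<le> (Q * b + R * a) / (a * b * c)"
    using pos by (intro divide_right_mono) auto
  moreover have "c * P / (a * b * c) = P / (a * b)" using pos by simp
  moreover have "(Q * b + R * a) / (a * b * c) = Q / (a * c) + R / (b * c)"
    using pos by (simp add: add_divide_distrib)
  ultimately have "P / (a * b) \<le> Q / (a * c) + R / (b * c)" by (simp only:)
  thus ?thesis
    unfolding homog_dist_def x y z fst_conv snd_conv P_def Q_def R_def a_def b_def c_def .
qed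

lemma homog_dist_le_1:
  assumes "x \<noteq> (0, 0)" "y \<noteq> (0, 0)"
  shows "homog_dist x y \<le> 1"
proof -
  obtain x0 x1 where x: "x = (x0, x1)" by (cases x)
  obtain y0 y1 where y: "y = (y0, y1)" by (cases y)
  define a where "a = max (padic_abs x0) (padic_abs x1)"
  define b where "b = max (padic_abs y0) (padic_abs y1)"
  have pos: "a > 0" "b > 0"
    unfolding a_def b_def by (rule padic_max_pos, use assms x y in simp)+
  have "padic_abs (x0 * y1 + - (y0 * x1)) \<le> max (padic_abs (x0 * y1)) (padic_abs (- (y0 * x1)))"
    by (rule padic_abs_add)
  also have "\<dots> = max (padic_abs x0 * padic_abs y1) (padic_abs x1 * padic_abs y0)"
    by (simp add: padic_abs_mult mult.commute)
  also have "\<dots> \<le> a * b"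
  proof (rule max.boundedI)
    show "padic_abs x0 * padic_abs y1 \<le> a * b"
      using pos by (intro mult_mono) (simp_all add: a_def b_def)
    show "padic_abs x1 * padic_abs y0 \<le> a * b"
      using pos by (intro mult_mono) (simp_all add: a_def b_def)
  qed
  finally have "padic_abs (x0 * y1 - y0 * x1) / (a * b) \<le> 1"
    using pos by simp
  thus ?thesis unfolding homog_dist_def x y fst_conv snd_conv a_def b_def .
qed

instantiation padic_P1 :: (prime_card) metric_space
begin

definition dist_padic_P1 :: "'a padic_P1 \<Rightarrow> 'a padic_P1 \<Rightarrow> real"
  where "dist_padic_P1 = spherical_dist"
definition uniformity_padic_P1 :: "('a padic_P1 \<times> 'a padic_P1) filter"
  where "uniformity_padic_P1 = (INF e\<in>{0<..}. principal {(x, y). dist x y < e})"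
definition open_padic_P1 :: "'a padic_P1 set \<Rightarrow> bool"
  where "open_padic_P1 U \<longleftrightarrow> (\<forall>x\<in>U. eventually (\<lambda>(x', y). x' = x \<longrightarrow> y \<in> U) uniformity)"

instance
proof
  fix x y z :: "'a padic_P1"
  show "dist x y = 0 \<longleftrightarrow> x = y"
    unfolding dist_padic_P1_def by transfer (simp add: proj_rel_self_iff homog_dist_eq_0)
  show "dist x y \<le> dist x z + dist y z"
    unfolding dist_padic_P1_def by transfer (simp add: proj_rel_self_iff homog_dist_triangle)
qed (simp_all add: uniformity_padic_P1_def open_padic_P1_def)

end

lemma spherical_dist_le_1: "spherical_dist x y \<le> 1"
  by transfer (simp add: proj_rel_self_iff homog_dist_le_1)

lift_definition of_padic :: "('p :: prime_card) padic \<Rightarrow> 'p padic_P1" is "\<lambda>x. (x, 1)"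
  by (simp add: proj_rel_self_iff)

lemma spherical_dist_of_padic:
  "spherical_dist (of_padic x) (of_padic y)
     = padic_abs (x - y) / (max 1 (padic_abs x) * max 1 (padic_abs y))"
proof -
  have "padic_abs (1 :: 'a padic) * padic_abs (1 :: 'a padic) = padic_abs (1 :: 'a padic)"
    by (simp flip: padic_abs_mult)
  hence "padic_abs (1 :: 'a padic) = 1" by simp
  thus ?thesis
    by (simp add: spherical_dist.abs_eq of_padic.abs_eq proj_rel_self_iff homog_dist_def max.commute)
qed


section \<open>Energy, Robin constant and equilibrium measure\<close>

text \<open>
  For closed \<open>E\<close> (the only case used), being carried by \<open>E\<close> up to a null set is the same as
  having support contained in \<open>E\<close>.
\<close>

definition borel_probs_on :: "'a :: topological_space set \<Rightarrow> 'a measure set" where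
  "borel_probs_on E = {\<nu>. sets \<nu> = sets borel \<and> prob_space \<nu> \<and> (AE x in \<nu>. x \<in> E)}"

text \<open>
  Since \<open>ln 0 = 0\<close> in the library, the value of the kernel on the diagonal is set explicitly.
  The spherical metric is at most 1, so \<open>- ln\<close> of it is nonnegative and nothing is truncated.
\<close>

definition neg_log_dist :: "('p :: prime_card) padic_P1 \<Rightarrow> 'p padic_P1 \<Rightarrow> ennreal" where
  "neg_log_dist x y = (if spherical_dist x y = 0 then \<infinity> else ennreal (- ln (spherical_dist x y)))"

definition energy :: "('p :: prime_card) padic_P1 measure \<Rightarrow> ennreal" where
  "energy \<nu> = (\<integral>\<^sup>+ x. \<integral>\<^sup>+ y. neg_log_dist x y \<partial>\<nu> \<partial>\<nu>)"

definition robin_constant :: "('p :: prime_card) padic_P1 set \<Rightarrow> ennreal" where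
  "robin_constant E = (INF \<nu>\<in>borel_probs_on E. energy \<nu>)"

definition equilibrium_measure :: "('p :: prime_card) padic_P1 set \<Rightarrow> 'p padic_P1 measure" where
  "equilibrium_measure E = (THE \<mu>. \<mu> \<in> borel_probs_on E \<and> energy \<mu> = robin_constant E)"


section \<open>Haar measures\<close>

definition padic_ints :: "('p :: prime_card) padic set" where
  "padic_ints = {x. padic_abs x \<le> 1}"

definition padic_units :: "('p :: prime_card) padic set" where
  "padic_units = {u \<in> padic_ints. \<exists>v\<in>padic_ints. u * v = 1}"

definition padic_prime_scale :: "int \<Rightarrow> ('p :: prime_card) padic set \<Rightarrow> 'p padic set" where
  "padic_prime_scale k S = (\<lambda>x. (of_nat CARD('p) powi k) * x) ` S"

definition haar_additive :: "('p :: prime_card) padic set \<Rightarrow> 'p padic measure" where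
  "haar_additive G = (THE \<nu>. \<nu> \<in> borel_probs_on G \<and> (\<forall>a\<in>G. distr \<nu> borel (\<lambda>x. a + x) = \<nu>))"

text \<open>
  Here \<open>S\<close> need not be a group: it is a coset of the unit group, on which the unit group acts
  by multiplication.
\<close>

definition haar_multiplicative :: "('p :: prime_card) padic set \<Rightarrow> 'p padic measure" where
  "haar_multiplicative S =
    (THE \<nu>. \<nu> \<in> borel_probs_on S \<and> (\<forall>u\<in>padic_units. distr \<nu> borel (\<lambda>x. u * x) = \<nu>))"

text \<open>A measure on the field, regarded as a measure on the projective line.\<close>

definition on_P1 :: "('p :: prime_card) padic measure \<Rightarrow> 'p padic_P1 measure" where
  "on_P1 \<nu> = distr \<nu> borel of_padic"

end

theory Submission
  imports Defs
begin

text \<open>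
  On the image of \<open>\<rat>\<^sub>p\<close> the kernel \<open>- ln \<delta>(x, y)\<close> equals \<open>ln p\<close> times the number of levels \<open>k \<ge> 1\<close>
  at which \<open>x\<close> and \<open>y\<close> lie in a common ball of radius \<open>p\<^sup>-\<^sup>k\<close>. Hence the energy of \<open>\<nu>\<close> is \<open>ln p\<close> times
  the sum of \<open>\<nu>(B)\<^sup>2\<close> over all balls \<open>B\<close> of all levels. If the potential of \<open>\<mu>\<close> has the constant value \<open>W\<close>
  on \<open>E\<close>, expanding the squares around \<open>\<mu>(B)\<close> shows that the energy of \<open>\<nu>\<close> exceeds \<open>W\<close> by the sum of
  \<open>(\<nu>(B) - \<mu>(B))\<^sup>2\<close>, which vanishes only for \<open>\<nu> = \<mu>\<close>. It remains to exhibit a measure with constant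
  potential. For \<open>n \<ge> 0\<close> this is Haar measure. For \<open>n < 0\<close>, mixing Haar measure on \<open>\<int>\<^sub>p\<close> and the Haar
  measures on the spheres of radius \<open>p\<^sup>j\<close>, \<open>1 \<le> j \<le> - n\<close>, with weights \<open>c\<^sub>j\<close>, constancy of the potential
  becomes the recurrence \<open>c\<^sub>j\<^sub>+\<^sub>1 + c\<^sub>j\<^sub>-\<^sub>1 = (p + 1/p) c\<^sub>j\<close> together with a boundary condition at
  \<open>j = - n\<close>, and is solved by a combination of \<open>p\<^sup>j\<close> and \<open>p\<^sup>-\<^sup>j\<close>.
\<close>

section \<open>Energy on totally bounded ultrametric sets\<close>

text \<open>No compactness or convexity argument produces the minimiser: the expansion around \<mu>
  gives the infimum, its attainment and its uniqueness at once. Energies may be infinite, so the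
  expansion is stated additively in \<open>ennreal\<close> and only the finite \<open>W\<close> is
  cancelled. Equilibrium and Haar measures are definite descriptions and need uniqueness;
  probability measures are compared through their masses on balls, finitely many of each radius. The
  locale serves the metrics of the field and of the projective line alike.

  Origin of the recurrence: let N = -n and let S_j be the mass of the spheres of radius at least
  p^j. The potential on the sphere of radius p^j is S_1 + ... + S_j + c_j p/(p-1)^2. Equality for
  j-1 and j, where j \<ge> 2, reads S_j + (c_j - c_(j-1)) p/(p-1)^2 = 0, and one more difference
  gives the recurrence, with characteristic roots p and 1/p. At the outer end S_(N+1) = 0 amounts to
  c_(N+1) = c_N, so the solution is symmetric under j -> 2N+1-j: a multiple of p^(1-j) +
  p^(j-2N).\<close>

locale ultrametric_blocks =
  fixes E :: "'a :: metric_space set" and r :: "nat \<Rightarrow> real"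
  assumes ultra: "\<And>x y z :: 'a. dist x z \<le> max (dist x y) (dist y z)"
    and r_nonneg: "\<And>k. 0 \<le> r k"
    and r_LIMSEQ: "r \<longlonglongrightarrow> 0"
    and r_decseq: "decseq r"
    and finite_blocks': "\<And>k. finite ((\<lambda>x. cball x (r k)) ` E)"
begin

definition blocks :: "nat \<Rightarrow> 'a set set" where
  "blocks k = (\<lambda>x. cball x (r k)) ` E"

lemma finite_blocks: "finite (blocks k)"
  using finite_blocks' by (simp add: blocks_def)

lemma cball_eqI: "y \<in> cball (x :: 'a) s \<Longrightarrow> cball y s = cball x s"
proof -
  assume y: "y \<in> cball x s"
  have "z \<in> cball y s \<longleftrightarrow> z \<in> cball x s" for z
    using y ultra[of x z y] ultra[of y z x] by (auto simp: dist_commute)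
  thus ?thesis by blast
qed

lemma block_eqI: "B \<in> blocks k \<Longrightarrow> x \<in> B \<Longrightarrow> B = cball x (r k)"
  unfolding blocks_def using cball_eqI by blast

lemma cball_in_blocks: "x \<in> E \<Longrightarrow> cball x (r k) \<in> blocks k"
  by (auto simp: blocks_def)

lemma centre_in_block: "x \<in> cball x (r k)"
  using r_nonneg by simp

lemma disjoint_blocks: "B \<in> blocks k \<Longrightarrow> C \<in> blocks k \<Longrightarrow> B \<noteq> C \<Longrightarrow> B \<inter> C = {}"
  using block_eqI by blast

lemma block_borel: "B \<in> blocks k \<Longrightarrow> B \<in> sets borel"
  by (auto simp: blocks_def)

text \<open>Blocks of one level are disjoint, so at a point of \<open>E\<close> exactly one
  indicator survives. This writes a function of the ball around \<open>x\<close> as a simple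
  function.\<close>

lemma sum_blocks_indicator:
  fixes f :: "'a set \<Rightarrow> ennreal"
  assumes "x \<in> E"
  shows "(\<Sum>B\<in>blocks k. f B * indicator B x) = f (cball x (r k))"
proof -
  have "(\<Sum>B\<in>blocks k. f B * indicator B x)
      = (\<Sum>B\<in>blocks k. if B = cball x (r k) then f B else 0)"
  proof (intro sum.cong refl)
    fix B assume "B \<in> blocks k"
    thus "f B * indicator B x = (if B = cball x (r k) then f B else 0)"
      using block_eqI[of B k x] centre_in_block[of x k]
      by (metis indicator_simps mult_1_right mult_zero_right)
  qed
  thus ?thesis using assms by (simp add: finite_blocks cball_in_blocks)
qed

lemma emeasure_UN_blocks:
  assumes "sets \<nu> = sets borel" "\<F> \<subseteq> blocks k"
  shows "emeasure \<nu> (\<Union>\<F>) = (\<Sum>B\<in>\<F>. emeasure \<nu> B)"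
proof -
  have "disjoint_family_on (\<lambda>B. B) \<F>"
    unfolding disjoint_family_on_def using disjoint_blocks assms(2) by blast
  moreover have "(\<lambda>B. B) ` \<F> \<subseteq> sets \<nu>" using assms block_borel by auto
  moreover have "finite \<F>" using assms(2) finite_blocks finite_subset by blast
  ultimately show ?thesis using sum_emeasure[of "\<lambda>B. B" \<F> \<nu>] by simp
qed

text \<open>Since the radii tend to 0, each point of \<open>E\<close> in \<open>U\<close> eventually
  has its whole ball inside \<open>U\<close>, so the blocks contained in \<open>U\<close> exhaust
  \<open>U\<close> up to a null set. Masses of open sets thus depend on the masses of blocks
  alone.\<close>

lemma emeasure_open_eq_SUP:
  assumes \<nu>: "\<nu> \<in> borel_probs_on E" and U: "open U"
  shows "emeasure \<nu> U = (SUP k. \<Sum>B | B \<in> blocks k \<and> B \<subseteq> U. emeasure \<nu> B)"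
proof -
  have s: "sets \<nu> = sets borel" and AE: "AE x in \<nu>. x \<in> E"
    using \<nu> by (auto simp: borel_probs_on_def)
  \<comment> \<open>A point of a block outside \<open>E\<close> may lie in no block of the next
    level, so the unions \<open>V k\<close> alone need not increase. Cutting down to
    \<open>F\<close>, the points covered at every level, repairs this; \<open>F\<close> is Borel,
    which is not assumed of \<open>E\<close>.\<close>
  define F where "F = (\<Inter>k. \<Union>(blocks k))"
  define V where "V k = \<Union>{B. B \<in> blocks k \<and> B \<subseteq> U}" for k
  have EF: "E \<subseteq> F" using centre_in_block cball_in_blocks unfolding F_def by blast
  have Vs: "V k \<in> sets \<nu>" for k
    unfolding V_def s using finite_blocks block_borel by (intro sets.finite_Union) auto
  have Fs: "F \<in> sets \<nu>"
    unfolding F_def s using finite_blocks block_borel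
    by (intro sets.countable_INT' sets.finite_Union) auto
  have "incseq (\<lambda>k. V k \<inter> F)"
  proof (intro incseq_SucI subsetI)
    fix k x assume x: "x \<in> V k \<inter> F"
    then obtain B where B: "B \<in> blocks k" "B \<subseteq> U" "x \<in> B" by (auto simp: V_def)
    obtain C where C: "C \<in> blocks (Suc k)" "x \<in> C" using x by (auto simp: F_def)
    have "C = cball x (r (Suc k))" "B = cball x (r k)" using B C block_eqI by blast+
    moreover have "r (Suc k) \<le> r k" using r_decseq by (auto simp: decseq_Suc_iff)
    ultimately have "C \<subseteq> B" by auto
    thus "x \<in> V (Suc k) \<inter> F" using B C x by (auto simp: V_def)
  qed
  hence "(SUP k. emeasure \<nu> (V k \<inter> F)) = emeasure \<nu> (\<Union>k. V k \<inter> F)"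
    using Vs Fs by (intro SUP_emeasure_incseq) auto
  also have "\<dots> = emeasure \<nu> U"
  proof (rule emeasure_eq_AE)
    show "AE x in \<nu>. x \<in> (\<Union>k. V k \<inter> F) \<longleftrightarrow> x \<in> U"
      using AE
    proof eventually_elim
      case (elim x)
      show ?case
      proof
        assume "x \<in> U"
        then obtain e where e: "e > 0" "cball x e \<subseteq> U" using U open_contains_cball by blast
        obtain k where "r k < e"
          using order_tendstoD(2)[OF r_LIMSEQ e(1)] by (auto simp: eventually_sequentially)
        hence "cball x (r k) \<subseteq> U" using e by force
        hence "x \<in> V k" unfolding V_def using cball_in_blocks[OF elim] centre_in_block by blast
        thus "x \<in> (\<Union>k. V k \<inter> F)" using elim EF by auto
      qed (auto simp: V_def)
    qed
  qed (use Vs Fs U s in auto)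
  finally have "emeasure \<nu> U = (SUP k. emeasure \<nu> (V k \<inter> F))" by simp
  moreover have "emeasure \<nu> (V k \<inter> F) = emeasure \<nu> (V k)" for k
    by (rule emeasure_eq_AE) (use AE EF Vs Fs in \<open>auto elim!: eventually_mono\<close>)
  moreover have "emeasure \<nu> (V k) = (\<Sum>B | B \<in> blocks k \<and> B \<subseteq> U. emeasure \<nu> B)" for k
    unfolding V_def by (rule emeasure_UN_blocks[OF s]) auto
  ultimately show ?thesis by simp
qed

lemma measure_eqI_blocks:
  assumes \<mu>: "\<mu> \<in> borel_probs_on E" and \<nu>: "\<nu> \<in> borel_probs_on E"
    and eq: "\<And>k x. x \<in> E \<Longrightarrow> emeasure \<mu> (cball x (r k)) = emeasure \<nu> (cball x (r k))"
  shows "\<mu> = \<nu>"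
proof (rule measure_eqI_generator_eq[where E = "Collect open" and \<Omega> = UNIV and A = "\<lambda>_. UNIV"])
  show "emeasure \<mu> U = emeasure \<nu> U" if "U \<in> Collect open" for U
  proof -
    have "(\<Sum>B | B \<in> blocks k \<and> B \<subseteq> U. emeasure \<mu> B) = (\<Sum>B | B \<in> blocks k \<and> B \<subseteq> U. emeasure \<nu> B)" for k
      using eq by (intro sum.cong) (auto simp: blocks_def)
    thus ?thesis using emeasure_open_eq_SUP[OF \<mu>] emeasure_open_eq_SUP[OF \<nu>] that by simp
  qed
  interpret \<mu>: prob_space \<mu> using \<mu> by (simp add: borel_probs_on_def)
  show "emeasure \<mu> UNIV \<noteq> \<infinity>" by simp
  show "Int_stable (Collect open :: 'a set set)" by (auto simp: Int_stable_def)
  have "sets borel = sigma_sets UNIV (Collect open :: 'a set set)"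
    by (simp add: borel_def)
  thus "sets \<mu> = sigma_sets UNIV (Collect open)" "sets \<nu> = sigma_sets UNIV (Collect open)"
    using \<mu> \<nu> by (simp_all add: borel_probs_on_def)
qed auto

lemma sum_blocks_emeasure:
  assumes \<nu>: "\<nu> \<in> borel_probs_on E"
  shows "(\<Sum>B\<in>blocks k. emeasure \<nu> B) = 1"
proof -
  have s: "sets \<nu> = sets borel" and AE: "AE x in \<nu>. x \<in> E"
    using \<nu> by (auto simp: borel_probs_on_def)
  interpret prob_space \<nu> using \<nu> by (simp add: borel_probs_on_def)
  have "emeasure \<nu> (\<Union>(blocks k)) = 1"
  proof (rule emeasure_eq_1_AE)
    show "\<Union>(blocks k) \<in> sets \<nu>"
      unfolding s using finite_blocks block_borel by (intro sets.finite_Union) auto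
    show "AE x in \<nu>. x \<in> \<Union>(blocks k)"
      using AE by eventually_elim (use cball_in_blocks centre_in_block in blast)
  qed
  thus ?thesis using emeasure_UN_blocks[OF s, of "blocks k" k] by simp
qed

lemma emeasure_block_uniform:
  assumes \<nu>: "\<nu> \<in> borel_probs_on E"
    and unif: "\<And>x y. x \<in> E \<Longrightarrow> y \<in> E \<Longrightarrow> emeasure \<nu> (cball x (r k)) = emeasure \<nu> (cball y (r k))"
    and x: "x \<in> E"
  shows "emeasure \<nu> (cball x (r k)) = 1 / of_nat (card (blocks k))"
proof -
  have "1 = (\<Sum>B\<in>blocks k. emeasure \<nu> B)" by (rule sum_blocks_emeasure[OF \<nu>, symmetric])
  also have "\<dots> = (\<Sum>B\<in>blocks k. emeasure \<nu> (cball x (r k)))"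
    by (intro sum.cong refl) (use unif[OF _ x] in \<open>auto simp only: blocks_def\<close>)
  finally have eq: "emeasure \<nu> (cball x (r k)) * of_nat (card (blocks k)) = 1"
    by (simp add: mult.commute)
  hence "card (blocks k) \<noteq> 0" by (intro notI) simp
  hence "emeasure \<nu> (cball x (r k)) * of_nat (card (blocks k)) / of_nat (card (blocks k))
      = emeasure \<nu> (cball x (r k))"
    by (intro mult_divide_eq_ennreal) auto
  thus ?thesis unfolding eq by simp
qed

text \<open>The form in which invariance is used: a transitive action by isometries makes all balls
  of one radius equally heavy, and total mass 1 then leaves no freedom.\<close>

lemma uniform_measure_unique:
  assumes "\<mu> \<in> borel_probs_on E" "\<nu> \<in> borel_probs_on E"
    and "\<And>k x y. x \<in> E \<Longrightarrow> y \<in> E \<Longrightarrow> emeasure \<mu> (cball x (r k)) = emeasure \<mu> (cball y (r k))"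
    and "\<And>k x y. x \<in> E \<Longrightarrow> y \<in> E \<Longrightarrow> emeasure \<nu> (cball x (r k)) = emeasure \<nu> (cball y (r k))"
  shows "\<mu> = \<nu>"
proof (rule measure_eqI_blocks[OF assms(1,2)])
  show "emeasure \<mu> (cball x (r k)) = emeasure \<nu> (cball x (r k))" if "x \<in> E" for k x
    using emeasure_block_uniform[OF assms(1,3) that, of k]
      emeasure_block_uniform[OF assms(2,4) that, of k] by simp
qed

text \<open>Integrating the potential of \<mu> against \<nu> gives their mutual energy, level by
  level. As a function of the centre, the mass of a ball agrees on \<open>E\<close> with the simple
  function \<open>g k\<close>, which supplies measurability.\<close>

lemma nn_integral_suminf_emeasure_cball:
  assumes \<nu>: "\<nu> \<in> borel_probs_on E"
  shows "(\<integral>\<^sup>+ x. c * (\<Sum>k. emeasure \<mu> (cball x (r k))) \<partial>\<nu>)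
    = c * (\<Sum>k. \<Sum>B\<in>blocks k. emeasure \<mu> B * emeasure \<nu> B)"
proof -
  have s: "sets \<nu> = sets borel" and AE: "AE x in \<nu>. x \<in> E"
    using \<nu> by (auto simp: borel_probs_on_def)
  define g where "g k x = (\<Sum>B\<in>blocks k. emeasure \<mu> B * indicator B x)" for k x
  have g [measurable]: "g k \<in> borel_measurable \<nu>" for k
    unfolding g_def using s block_borel by (auto intro!: borel_measurable_sum)
  have "AE x in \<nu>. \<forall>k. g k x = emeasure \<mu> (cball x (r k))"
    using AE by eventually_elim (simp add: sum_blocks_indicator g_def)
  hence "(\<integral>\<^sup>+ x. c * (\<Sum>k. emeasure \<mu> (cball x (r k))) \<partial>\<nu>) = (\<integral>\<^sup>+ x. c * (\<Sum>k. g k x) \<partial>\<nu>)"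
    by (intro nn_integral_cong_AE) (auto elim!: eventually_mono)
  also have "\<dots> = c * (\<integral>\<^sup>+ x. (\<Sum>k. g k x) \<partial>\<nu>)"
    by (rule nn_integral_cmult) measurable
  also have "(\<integral>\<^sup>+ x. (\<Sum>k. g k x) \<partial>\<nu>) = (\<Sum>k. \<integral>\<^sup>+ x. g k x \<partial>\<nu>)"
    by (rule nn_integral_suminf) (rule g)
  also have "\<dots> = (\<Sum>k. \<Sum>B\<in>blocks k. emeasure \<mu> B * emeasure \<nu> B)"
  proof (rule suminf_cong)
    fix k
    have "(\<integral>\<^sup>+ x. g k x \<partial>\<nu>) = (\<Sum>B\<in>blocks k. \<integral>\<^sup>+ x. emeasure \<mu> B * indicator B x \<partial>\<nu>)"
      unfolding g_def by (rule nn_integral_sum) (use s block_borel in auto)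
    thus "(\<integral>\<^sup>+ x. g k x \<partial>\<nu>) = (\<Sum>B\<in>blocks k. emeasure \<mu> B * emeasure \<nu> B)"
      using s block_borel by (simp add: nn_integral_cmult_indicator)
  qed
  finally show ?thesis .
qed

text \<open>The energy of a measure for the kernel counting the levels at which two points lie in a common block.\<close>

definition block_energy :: "'a measure \<Rightarrow> ennreal" where
  "block_energy \<nu> = (\<Sum>k. \<Sum>B\<in>blocks k. emeasure \<nu> B * emeasure \<nu> B)"

text \<open>The energy of the signed measure \<nu> - \<mu>. Differences are taken between real
  measures because subtraction in \<open>ennreal\<close> is truncated.\<close>

definition block_discrepancy :: "'a measure \<Rightarrow> 'a measure \<Rightarrow> ennreal" where
  "block_discrepancy \<mu> \<nu> = (\<Sum>k. \<Sum>B\<in>blocks k. ennreal ((measure \<nu> B - measure \<mu> B)\<^sup>2))"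

text \<open>The binomial formula with its negative term moved across, so that it can be summed over
  infinitely many levels even when the totals are infinite.\<close>

lemma ennreal_sq_expand:
  fixes a b :: real
  assumes "a \<ge> 0" "b \<ge> 0"
  shows "ennreal b * ennreal b + ennreal a * ennreal a
     = 2 * (ennreal a * ennreal b) + ennreal ((b - a)\<^sup>2)"
proof -
  have "ennreal b * ennreal b + ennreal a * ennreal a = ennreal (b * b + a * a)"
    using assms by (simp add: ennreal_mult)
  also have "b * b + a * a = 2 * (a * b) + (b - a)\<^sup>2" by (simp add: power2_eq_square algebra_simps)
  also have "ennreal \<dots> = 2 * (ennreal a * ennreal b) + ennreal ((b - a)\<^sup>2)"
    using assms by (simp add: ennreal_mult)
  finally show ?thesis .
qed

text \<open>Integrating the constant potential shows that the mutual energy of \<mu> with every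
  probability on \<open>E\<close> is \<open>W\<close>, in particular that of \<mu> with itself.
  Adding the energies of \<nu> and \<mu> turns the expansion of squares into \<open>block_energy
  \<nu> + W = 2 * W + block_discrepancy \<mu> \<nu>\<close>.\<close>

lemma block_energy_eq:
  assumes \<mu>: "\<mu> \<in> borel_probs_on E" and \<nu>: "\<nu> \<in> borel_probs_on E" and W: "W < \<infinity>"
    and pot: "\<And>x. x \<in> E \<Longrightarrow> (\<Sum>k. emeasure \<mu> (cball x (r k))) = W"
  shows "block_energy \<nu> = W + block_discrepancy \<mu> \<nu>"
proof -
  have mixed: "(\<Sum>k. \<Sum>B\<in>blocks k. emeasure \<mu> B * emeasure \<rho> B) = W"
    if \<rho>: "\<rho> \<in> borel_probs_on E" for \<rho>
  proof -
    interpret \<rho>: prob_space \<rho> using \<rho> by (simp add: borel_probs_on_def)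
    have AE: "AE x in \<rho>. x \<in> E" using \<rho> by (auto simp: borel_probs_on_def)
    have "(\<Sum>k. \<Sum>B\<in>blocks k. emeasure \<mu> B * emeasure \<rho> B)
        = (\<integral>\<^sup>+ x. 1 * (\<Sum>k. emeasure \<mu> (cball x (r k))) \<partial>\<rho>)"
      by (subst nn_integral_suminf_emeasure_cball[OF \<rho>]) simp
    also have "\<dots> = (\<integral>\<^sup>+ x. W \<partial>\<rho>)"
      by (rule nn_integral_cong_AE) (use AE in eventually_elim, simp add: pot)
    also have "\<dots> = W" by (simp add: \<rho>.emeasure_space_1)
    finally show ?thesis .
  qed
  interpret \<mu>: prob_space \<mu> using \<mu> by (simp add: borel_probs_on_def)
  interpret \<nu>: prob_space \<nu> using \<nu> by (simp add: borel_probs_on_def)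
  have "block_energy \<nu> + W = (\<Sum>k. \<Sum>B\<in>blocks k. emeasure \<nu> B * emeasure \<nu> B + emeasure \<mu> B * emeasure \<mu> B)"
    unfolding block_energy_def mixed[OF \<mu>, symmetric]
    by (subst suminf_add) (auto simp: sum.distrib)
  also have "\<dots> = (\<Sum>k. \<Sum>B\<in>blocks k. 2 * (emeasure \<mu> B * emeasure \<nu> B)
      + ennreal ((measure \<nu> B - measure \<mu> B)\<^sup>2))"
    by (intro suminf_cong sum.cong refl)
       (simp add: \<mu>.emeasure_eq_measure \<nu>.emeasure_eq_measure ennreal_sq_expand)
  also have "\<dots> = (\<Sum>k. 2 * (\<Sum>B\<in>blocks k. emeasure \<mu> B * emeasure \<nu> B))
      + block_discrepancy \<mu> \<nu>"
    unfolding block_discrepancy_def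
    by (subst suminf_add) (auto simp: sum.distrib sum_distrib_left)
  also have "(\<Sum>k. 2 * (\<Sum>B\<in>blocks k. emeasure \<mu> B * emeasure \<nu> B)) = 2 * W"
    by (simp add: mixed[OF \<nu>])
  finally have "W + block_energy \<nu> = W + (W + block_discrepancy \<mu> \<nu>)"
    by (simp add: mult_2 add_ac)
  \<comment> \<open>Only \<open>W\<close> is cancelled; the other two terms may be infinite.\<close>
  thus ?thesis using W by (metis ennreal_add_left_cancel infinity_ennreal_def less_irrefl)
qed

lemma block_discrepancy_self: "block_discrepancy \<mu> \<mu> = 0"
  by (simp add: block_discrepancy_def)

lemma block_discrepancy_eq_0:
  assumes \<mu>: "\<mu> \<in> borel_probs_on E" and \<nu>: "\<nu> \<in> borel_probs_on E"
    and 0: "block_discrepancy \<mu> \<nu> = 0"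
  shows "\<nu> = \<mu>"
proof (rule measure_eqI_blocks[OF \<nu> \<mu>])
  fix k x assume "x \<in> E"
  interpret \<mu>: prob_space \<mu> using \<mu> by (simp add: borel_probs_on_def)
  interpret \<nu>: prob_space \<nu> using \<nu> by (simp add: borel_probs_on_def)
  have "(\<Sum>B\<in>blocks k. ennreal ((measure \<nu> B - measure \<mu> B)\<^sup>2)) = 0"
    using 0 unfolding block_discrepancy_def by (subst (asm) suminf_eq_zero_iff) auto
  hence "ennreal ((measure \<nu> (cball x (r k)) - measure \<mu> (cball x (r k)))\<^sup>2) = 0"
    using cball_in_blocks[OF \<open>x \<in> E\<close>] finite_blocks by (simp del: sum_ennreal)
  hence "measure \<nu> (cball x (r k)) = measure \<mu> (cball x (r k))"
    by (simp add: ennreal_eq_0_iff)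
  thus "emeasure \<nu> (cball x (r k)) = emeasure \<mu> (cball x (r k))"
    by (simp add: \<mu>.emeasure_eq_measure \<nu>.emeasure_eq_measure)
qed

end

section \<open>Rational approximation of \<open>p\<close>-adic numbers\<close>

lemma card_gt_1: "real CARD('p :: prime_card) > 1"
  using prime_gt_1_nat[OF prime_card] by simp

lemma powi_le_iff:
  fixes b :: real
  assumes "b > 1"
  shows "b powi i \<le> b powi j \<longleftrightarrow> i \<le> j"
  using power_int_increasing[of i j b] power_int_strict_increasing[of j i b] assms by force

lemma powi_less_iff:
  fixes b :: real
  assumes "b > 1"
  shows "b powi i < b powi j \<longleftrightarrow> i < j"
  using powi_le_iff[OF assms, of j i] by linarith

lemma padic_abs_1 [simp]: "padic_abs 1 = 1"
  using padic_abs_mult[of 1 "1 :: 'a padic"] padic_abs_eq_0[of "1 :: 'a padic"] by simp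

lemma padic_abs_0 [simp]: "padic_abs 0 = 0"
  by simp

lemma padic_abs_power: "padic_abs (x ^ k) = padic_abs x ^ k"
  by (induction k) (simp_all add: padic_abs_mult)

lemma padic_abs_inverse: "padic_abs (inverse x) = inverse (padic_abs x)"
proof (cases "x = 0")
  case False
  hence "padic_abs x * padic_abs (inverse x) = 1" by (simp flip: padic_abs_mult)
  thus ?thesis by (metis inverse_unique)
qed simp

lemma padic_abs_divide: "padic_abs (x / y) = padic_abs x / padic_abs y"
  by (simp add: divide_inverse padic_abs_mult padic_abs_inverse)

lemma padic_abs_power_int: "padic_abs (x powi k) = padic_abs x powi k"
  by (auto simp: power_int_def padic_abs_power padic_abs_inverse)

lemma padic_abs_diff: "padic_abs (x - y) \<le> max (padic_abs x) (padic_abs y)"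
  using padic_abs_add[of x "- y"] by simp

lemma padic_abs_diff_triangle: "padic_abs (x - z) \<le> max (padic_abs (x - y)) (padic_abs (y - z))"
  using padic_abs_add[of "x - y" "y - z"] by simp

lemma padic_abs_eq_of_close:
  assumes "padic_abs (x - y) < padic_abs x"
  shows "padic_abs y = padic_abs x"
  using assms padic_abs_diff[of x "x - y"] padic_abs_add[of "x - y" y] by auto

lift_definition const_seq :: "rat \<Rightarrow> 'p :: prime_card padic_seq" is "\<lambda>c _. c"
  by (rule padic_cauchy_const)

text \<open>Absolute values of integers in the field are computed through this embedding, under
  which \<open>padic_abs\<close> becomes \<open>padic_abs_rat\<close> and its bounds become
  divisibility statements.\<close>

definition padic_of_rat :: "rat \<Rightarrow> 'p :: prime_card padic" where
  "padic_of_rat c = abs_padic (const_seq c)"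

lemma padic_of_rat_add: "padic_of_rat (a + b) = padic_of_rat a + padic_of_rat b"
proof -
  have "const_seq (a + b) = (const_seq a + const_seq b :: 'a padic_seq)" by transfer simp
  thus ?thesis by (simp add: padic_of_rat_def plus_padic.abs_eq)
qed

lemma padic_of_rat_mult: "padic_of_rat (a * b) = padic_of_rat a * padic_of_rat b"
proof -
  have "const_seq (a * b) = (const_seq a * const_seq b :: 'a padic_seq)" by transfer simp
  thus ?thesis by (simp add: padic_of_rat_def times_padic.abs_eq)
qed

lemma padic_of_rat_0: "padic_of_rat 0 = 0"
  using padic_of_rat_add[of 0 0] by (metis add.right_neutral add_left_cancel)

lemma padic_of_rat_1: "padic_of_rat 1 = 1"
proof -
  have "const_seq 1 = (1 :: 'a padic_seq)" by transfer simp
  thus ?thesis by (simp add: padic_of_rat_def one_padic.abs_eq)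
qed

lemma padic_of_rat_minus: "padic_of_rat (- a) = - padic_of_rat a"
  using padic_of_rat_add[of a "- a"] by (simp add: padic_of_rat_0 eq_neg_iff_add_eq_0 add.commute)

lemma padic_of_rat_diff: "padic_of_rat (a - b) = padic_of_rat a - padic_of_rat b"
  using padic_of_rat_add[of a "- b"] by (simp add: padic_of_rat_minus)

lemma padic_of_rat_of_nat: "padic_of_rat (of_nat n) = of_nat n"
  by (induction n) (simp_all add: padic_of_rat_0 padic_of_rat_1 padic_of_rat_add)

lemma padic_of_rat_of_int: "padic_of_rat (of_int n) = of_int n"
  by (cases n) (simp_all add: padic_of_rat_of_nat padic_of_rat_minus padic_of_rat_diff padic_of_rat_1)

lemma padic_abs_of_rat: "padic_abs (padic_of_rat c :: 'p padic) = padic_abs_rat CARD('p :: prime_card) c"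
  unfolding padic_of_rat_def padic_abs.abs_eq
  by (rule seq_abs_unique) (simp add: const_seq.rep_eq)

lemma padic_rat_dense:
  fixes x :: "'p :: prime_card padic"
  assumes "e > 0"
  obtains c where "padic_abs (x - padic_of_rat c) < e"
proof -
  obtain X where X: "x = abs_padic X" using Quotient3_abs_rep[OF Quotient3_padic] by metis
  have "padic_cauchy CARD('p) (seq_of X)" using seq_of[of X] by simp
  \<comment> \<open>Half of \<open>e\<close>, because the limit weakens the strict bound.\<close>
  moreover have "e / 2 > 0" using assms by simp
  ultimately obtain N where N:
    "\<And>m n. m \<ge> N \<Longrightarrow> n \<ge> N \<Longrightarrow> padic_abs_rat CARD('p) (seq_of X m - seq_of X n) < e / 2"
    unfolding padic_cauchy_def by blast
  have "seq_abs (X - const_seq (seq_of X N)) \<le> e / 2"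
  proof (rule LIMSEQ_le_const2[OF seq_abs_LIMSEQ])
    show "\<exists>M. \<forall>n\<ge>M. padic_abs_rat CARD('p) (seq_of (X - const_seq (seq_of X N)) n) \<le> e / 2"
      using N[of _ N] by (intro exI[of _ N]) (auto simp: minus_padic_seq.rep_eq const_seq.rep_eq less_imp_le)
  qed
  hence "padic_abs (x - padic_of_rat (seq_of X N)) < e"
    using assms by (simp add: X padic_of_rat_def minus_padic.abs_eq padic_abs.abs_eq)
  thus ?thesis using that by blast
qed

text \<open>A rational closer to \<open>x\<close> than |x| has the same absolute value, and for
  nonzero rationals that is a power of p by definition. Completion does not enlarge the value
  group.\<close>

lemma padic_abs_eq_powi:
  fixes x :: "'p :: prime_card padic"
  assumes "x \<noteq> 0"
  obtains k where "padic_abs x = real CARD('p) powi k"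
proof -
  obtain c where c: "padic_abs (x - padic_of_rat c) < padic_abs x"
    using padic_rat_dense[of "padic_abs x" x] assms by auto
  have eq: "padic_abs x = padic_abs_rat CARD('p) c"
    using padic_abs_eq_of_close[OF c] by (simp add: padic_abs_of_rat)
  hence "c \<noteq> 0" using assms by auto
  thus ?thesis using eq that by (auto simp: padic_abs_rat_def split: prod.splits)
qed

lemma padic_abs_rat_of_int_le_iff:
  "padic_abs_rat CARD('p :: prime_card) (of_int a) \<le> real CARD('p) powi (- int k) \<longleftrightarrow> int CARD('p) ^ k dvd a"
proof (cases "a = 0")
  case False
  have p: "prime CARD('p)" by (rule prime_card)
  have p1: "real CARD('p) > 1" by (rule card_gt_1)
  have "padic_abs_rat CARD('p) (of_int a) = real CARD('p) powi (- int (multiplicity (int CARD('p)) a))"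
    using padic_abs_rat_divide[OF p False, of 1] by simp
  also have "\<dots> \<le> real CARD('p) powi (- int k) \<longleftrightarrow> k \<le> multiplicity (int CARD('p)) a"
    using p1 by (simp add: powi_le_iff)
  also have "\<dots> \<longleftrightarrow> int CARD('p) ^ k dvd a"
    using False p p1 by (intro power_dvd_iff_le_multiplicity[symmetric]) (auto simp: not_prime_unit)
  finally show ?thesis .
qed auto

lemma padic_abs_of_int_le_iff:
  "padic_abs (of_int a :: 'p :: prime_card padic) \<le> real CARD('p) powi (- int k) \<longleftrightarrow> int CARD('p) ^ k dvd a"
  by (simp flip: padic_of_rat_of_int add: padic_abs_of_rat padic_abs_rat_of_int_le_iff)

text \<open>A rational \<open>u / v\<close> in lowest terms close to \<open>x\<close> has absolute
  value at most 1, so p does not divide \<open>v\<close>. Then \<open>v\<close> has an inverse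
  \<open>w\<close> modulo \<open>p ^ k\<close>, and the residue of \<open>u * w\<close> approximates
  \<open>u / v\<close>, hence \<open>x\<close>.\<close>

lemma padic_int_approx:
  fixes x :: "'p :: prime_card padic"
  assumes "padic_abs x \<le> 1"
  obtains a where "a < CARD('p) ^ k" "padic_abs (x - of_nat a) \<le> real CARD('p) powi (- int k)"
proof -
  let ?p = "CARD('p)"
  have p: "prime ?p" by (rule prime_card)
  have p1: "real ?p > 1" by (rule card_gt_1)
  define e where "e = real ?p powi (- int k)"
  have e: "0 < e" "e \<le> 1"
    using p1 unfolding e_def by (auto simp: power_int_minus field_simps)
  obtain c where c: "padic_abs (x - padic_of_rat c) < e" using padic_rat_dense[OF e(1)] .
  have "padic_abs (padic_of_rat c :: 'p padic) \<le> 1"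
    using padic_abs_diff[of x "x - padic_of_rat c"] c e assms by simp
  obtain u v where uv: "quotient_of c = (u, v)" by (cases "quotient_of c")
  have v: "v > 0" and cop: "coprime u v" and cuv: "c = of_int u / of_int v"
    using quotient_of_denom_pos[OF uv] quotient_of_coprime[OF uv] quotient_of_div[OF uv] by auto
  have nv: "\<not> int ?p dvd v"
  proof
    assume dv: "int ?p dvd v"
    hence "\<not> int ?p dvd u" using cop p
      by (meson coprime_common_divisor not_prime_unit prime_nat_int_transfer)
    hence u: "multiplicity (int ?p) u = 0" "u \<noteq> 0" by (auto simp: not_dvd_imp_multiplicity_0)
    have "multiplicity (int ?p) v \<noteq> 0" using dv v p
      by (metis less_irrefl multiplicity_eq_zero_iff not_prime_unit prime_nat_int_transfer)
    hence "padic_abs (padic_of_rat c :: 'p padic) > 1"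
      using u v p1 padic_abs_rat_divide[OF p, of u v]
      by (simp add: padic_abs_of_rat cuv one_less_power)
    thus False using \<open>padic_abs (padic_of_rat c :: 'p padic) \<le> 1\<close> by simp
  qed
  have abs_v: "padic_abs (of_int v :: 'p padic) = 1"
    using padic_abs_rat_divide[OF p, of v 1] nv v
    by (simp flip: padic_of_rat_of_int add: padic_abs_of_rat not_dvd_imp_multiplicity_0)
  have "coprime v (int ?p ^ k)"
    using nv p by (metis coprime_commute coprime_power_right_iff prime_imp_coprime prime_nat_int_transfer)
  then obtain w where w: "[v * w = 1] (mod (int ?p ^ k))"
    using cong_solve_coprime_int by blast
  define a where "a = nat ((u * w) mod (int ?p ^ k))"
  have pk: "int ?p ^ k > 0" using p1 by simp
  have a: "int a = (u * w) mod (int ?p ^ k)" unfolding a_def using pk by simp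
  hence "int a < int ?p ^ k" using pk by simp
  hence "a < ?p ^ k" by (metis of_nat_less_iff of_nat_power)
  moreover have "padic_abs (x - of_nat a) \<le> e"
  proof -
    have "[v * int a = v * (u * w)] (mod (int ?p ^ k))"
      unfolding a by (simp add: cong_def mod_mult_right_eq)
    also have "v * (u * w) = u * (v * w)" by simp
    also have "[u * (v * w) = u * 1] (mod (int ?p ^ k))" using w by (rule cong_scalar_left)
    finally have "int ?p ^ k dvd (v * int a - u)" by (simp add: cong_iff_dvd_diff)
    hence "padic_abs (of_int (v * int a - u) :: 'p padic) \<le> e"
      unfolding e_def padic_abs_of_int_le_iff .
    moreover have "of_int v * (padic_of_rat c - of_nat a :: 'p padic) = - of_int (v * int a - u)"
    proof -
      have "of_int v * padic_of_rat c = (of_int u :: 'p padic)"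
        using v by (simp flip: padic_of_rat_of_int padic_of_rat_mult add: cuv)
      thus ?thesis by (simp add: algebra_simps)
    qed
    hence "padic_abs (of_int v :: 'p padic) * padic_abs (padic_of_rat c - of_nat a :: 'p padic)
        = padic_abs (of_int (v * int a - u) :: 'p padic)"
      by (metis padic_abs_minus padic_abs_mult)
    ultimately have "padic_abs (padic_of_rat c - of_nat a :: 'p padic) \<le> e" using abs_v by simp
    thus ?thesis using padic_abs_diff_triangle[of x "of_nat a" "padic_of_rat c"] c by simp
  qed
  ultimately show ?thesis using that unfolding e_def by blast
qed

section \<open>Digit expansions\<close>

text \<open>Indexed by valuation: larger indices mean smaller balls, and multiplication by a power
  of p shifts the index by its exponent.\<close>

definition pball :: "int \<Rightarrow> 'p :: prime_card padic \<Rightarrow> 'p padic set" where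
  "pball k x = cball x (real CARD('p) powi (- k))"

lemma mem_pball:
  "y \<in> pball k (x :: 'p :: prime_card padic) \<longleftrightarrow> padic_abs (x - y) \<le> real CARD('p) powi (- k)"
  by (simp add: pball_def dist_padic_def)

lemma padic_dist_ultra: "dist x z \<le> max (dist x y) (dist y (z :: 'p :: prime_card padic))"
  unfolding dist_padic_def by (rule padic_abs_diff_triangle)

lemma self_mem_pball: "x \<in> pball k x"
  using card_gt_1 by (simp add: mem_pball)

lemma pball_eqI: "y \<in> pball k x \<Longrightarrow> pball k y = pball k x"
proof -
  assume y: "y \<in> pball k x"
  have "z \<in> pball k y \<longleftrightarrow> z \<in> pball k x" for z
    using y padic_abs_diff_triangle[of x z y] padic_abs_diff_triangle[of y z x]
    by (auto simp: mem_pball padic_abs_diff_commute)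
  thus ?thesis by blast
qed

lemma mem_pball_cong: "y \<in> pball k z \<Longrightarrow> y \<in> pball k x \<longleftrightarrow> z \<in> pball k x"
  using pball_eqI[of y k z] pball_eqI[of y k x] pball_eqI[of z k x] self_mem_pball by blast

lemma pball_borel [measurable, simp]: "pball k x \<in> sets borel"
  by (simp add: pball_def)

lemma pball_mono: "j \<le> k \<Longrightarrow> pball k x \<subseteq> pball j (x :: 'p :: prime_card padic)"
proof
  fix y assume "j \<le> k" "y \<in> pball k x"
  moreover from this have "real CARD('p) powi (- k) \<le> real CARD('p) powi (- j)"
    using powi_le_iff[OF card_gt_1[where 'p = 'p]] by simp
  ultimately show "y \<in> pball j x" by (simp add: mem_pball)
qed

definition digit_sum :: "nat \<Rightarrow> (nat \<Rightarrow> nat) \<Rightarrow> nat \<Rightarrow> nat" where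
  "digit_sum p d k = (\<Sum>i<k. d i * p ^ i)"

lemma digit_sum_mod:
  assumes "k \<le> m"
  shows "digit_sum p d m mod p ^ k = digit_sum p d k mod p ^ k"
  using assms
proof (induction m rule: dec_induct)
  case (step m)
  have "p ^ k dvd d m * p ^ m" using step by (simp add: le_imp_power_dvd)
  hence "(digit_sum p d m + d m * p ^ m) mod p ^ k = digit_sum p d m mod p ^ k"
    by (metis add.right_neutral dvd_imp_mod_0 mod_add_right_eq)
  thus ?case using step by (simp add: digit_sum_def)
qed simp

lemma digit_sum_less:
  assumes "\<And>i. i < k \<Longrightarrow> d i < p"
  shows "digit_sum p d k < p ^ k"
  using assms
proof (induction k)
  case (Suc k)
  have "digit_sum p d (Suc k) < p ^ k + d k * p ^ k" using Suc by (simp add: digit_sum_def)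
  also have "\<dots> = Suc (d k) * p ^ k" by simp
  also have "\<dots> \<le> p * p ^ k" using Suc.prems[of k] by (intro mult_right_mono) auto
  finally show ?case by simp
qed (simp add: digit_sum_def)

text \<open>Reduction modulo \<open>p ^ k\<close> strips the top digit, so an equality passes to the
  shorter strings.\<close>

lemma digit_sum_eq_iff:
  assumes "\<And>i. i < k \<Longrightarrow> d i < p" "\<And>i. i < k \<Longrightarrow> e i < p"
  shows "digit_sum p d k = digit_sum p e k \<longleftrightarrow> (\<forall>i<k. d i = e i)"
  using assms
proof (induction k)
  case (Suc k)
  have less: "digit_sum p d k < p ^ k" "digit_sum p e k < p ^ k"
    using Suc.prems by (auto intro!: digit_sum_less)
  show ?case
  proof
    assume eq: "digit_sum p d (Suc k) = digit_sum p e (Suc k)"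
    hence "digit_sum p d (Suc k) mod p ^ k = digit_sum p e (Suc k) mod p ^ k" by simp
    hence eqk: "digit_sum p d k = digit_sum p e k"
      using less by (simp add: digit_sum_mod)
    moreover have "p > 0" using Suc.prems(1)[of k] by simp
    ultimately have "d k = e k" using eq by (simp add: digit_sum_def)
    thus "\<forall>i<Suc k. d i = e i" using eqk Suc by (auto simp: less_Suc_eq)
  qed (simp add: digit_sum_def)
qed (simp add: digit_sum_def)

lemma digit_sum_digits: "digit_sum p (\<lambda>i. a div p ^ i mod p) k = a mod p ^ k"
proof (induction k)
  case (Suc k)
  have "a mod (p ^ k * p) = p ^ k * (a div p ^ k mod p) + a mod p ^ k" by (rule mod_mult2_eq)
  with Suc show ?case by (simp add: digit_sum_def mult.commute)
qed (simp add: digit_sum_def)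

lemma padic_abs_rat_digit_sum_diff:
  assumes "k \<le> m"
  shows "padic_abs_rat CARD('p :: prime_card)
      (of_nat (digit_sum CARD('p) d m) - of_nat (digit_sum CARD('p) d k)) \<le> real CARD('p) powi (- int k)"
proof -
  let ?a = "int (digit_sum CARD('p) d m) - int (digit_sum CARD('p) d k)"
  have "int (digit_sum CARD('p) d m) mod int CARD('p) ^ k = int (digit_sum CARD('p) d k) mod int CARD('p) ^ k"
    using digit_sum_mod[OF assms, of "CARD('p)" d] by (simp flip: of_nat_power of_nat_mod)
  hence "int CARD('p) ^ k dvd ?a" by (simp add: mod_eq_dvd_iff)
  hence "padic_abs_rat CARD('p) (of_int ?a) \<le> real CARD('p) powi (- int k)"
    by (simp only: padic_abs_rat_of_int_le_iff)
  thus ?thesis by simp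
qed

lemma powi_uminus_tendsto_0:
  fixes b :: real
  assumes "b > 1"
  shows "(\<lambda>k. b powi (- (m + int k))) \<longlonglongrightarrow> 0"
proof -
  have "(\<lambda>k. b powi (- m) * (inverse b) ^ k) \<longlonglongrightarrow> b powi (- m) * 0"
    using assms by (intro tendsto_mult tendsto_const LIMSEQ_power_zero) (auto simp: field_simps)
  moreover have "b powi (- (m + int k)) = b powi (- m) * (inverse b) ^ k" for k
    using assms by (simp add: power_int_diff power_int_minus field_simps flip: power_inverse)
  ultimately show ?thesis by simp
qed

lift_definition digit_seq :: "(nat \<Rightarrow> nat) \<Rightarrow> 'p :: prime_card padic_seq"
  is "\<lambda>d k. of_nat (digit_sum CARD('p) d k)"
proof -
  fix d
  let ?p = "CARD('p)" and ?s = "\<lambda>k. of_nat (digit_sum CARD('p) d k) :: rat"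
  show "padic_cauchy ?p ?s"
    unfolding padic_cauchy_def
  proof (intro allI impI)
    fix e :: real assume "e > 0"
    then obtain N where N: "real ?p powi (- (0 + int N)) < e"
      using order_tendstoD(2)[OF powi_uminus_tendsto_0[OF card_gt_1[where 'p = 'p]], of e 0]
      by (auto simp: eventually_sequentially)
    have "padic_abs_rat ?p (?s m - ?s n) < e" if "m \<ge> N" "n \<ge> N" for m n
    proof -
      have "padic_abs_rat ?p (?s m - ?s n) = padic_abs_rat ?p ((?s m - ?s N) - (?s n - ?s N))"
        by simp
      also have "\<dots> \<le> max (padic_abs_rat ?p (?s m - ?s N)) (padic_abs_rat ?p (?s n - ?s N))"
        by (rule padic_abs_rat_diff[OF prime_card])
      also have "\<dots> \<le> real ?p powi (- int N)"
        using that by (intro max.boundedI padic_abs_rat_digit_sum_diff)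
      finally have "padic_abs_rat ?p (?s m - ?s n) \<le> real ?p powi (- int N)" .
      thus ?thesis using N by simp
    qed
    thus "\<exists>N. \<forall>m\<ge>N. \<forall>n\<ge>N. padic_abs_rat ?p (?s m - ?s n) < e" by blast
  qed
qed

definition digit_lim :: "(nat \<Rightarrow> nat) \<Rightarrow> 'p :: prime_card padic" where
  "digit_lim d = abs_padic (digit_seq d)"

text \<open>All later partial sums agree with the k-th one modulo p^k, and this weak bound survives
  the limit.\<close>

lemma digit_lim_approx:
  "digit_lim d \<in> pball (int k) (of_nat (digit_sum CARD('p) d k) :: 'p :: prime_card padic)"
proof -
  let ?s = "digit_sum CARD('p) d"
  have "seq_abs (digit_seq d - const_seq (of_nat (?s k)) :: 'p padic_seq) \<le> real CARD('p) powi (- int k)"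
  proof (rule LIMSEQ_le_const2[OF seq_abs_LIMSEQ])
    show "\<exists>M. \<forall>n\<ge>M. padic_abs_rat CARD('p) (seq_of (digit_seq d - const_seq (of_nat (?s k)) :: 'p padic_seq) n)
        \<le> real CARD('p) powi (- int k)"
      using padic_abs_rat_digit_sum_diff[where 'p = 'p, of k _ d]
      by (intro exI[of _ k]) (auto simp: minus_padic_seq.rep_eq const_seq.rep_eq digit_seq.rep_eq)
  qed
  hence "padic_abs (digit_lim d - padic_of_rat (of_nat (?s k)) :: 'p padic) \<le> real CARD('p) powi (- int k)"
    by (simp add: digit_lim_def padic_of_rat_def minus_padic.abs_eq padic_abs.abs_eq)
  thus ?thesis by (simp add: mem_pball padic_abs_diff_commute padic_of_rat_of_nat)
qed

lemma of_nat_mem_pball_iff: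
  "(of_nat b :: 'p :: prime_card padic) \<in> pball (int k) (of_nat a) \<longleftrightarrow> a mod CARD('p) ^ k = b mod CARD('p) ^ k"
proof -
  have "(of_nat a - of_nat b :: 'p padic) = of_int (int a - int b)" by simp
  hence "(of_nat b :: 'p padic) \<in> pball (int k) (of_nat a) \<longleftrightarrow> int CARD('p) ^ k dvd int a - int b"
    unfolding mem_pball by (simp only: padic_abs_of_int_le_iff)
  also have "\<dots> \<longleftrightarrow> int a mod int CARD('p) ^ k = int b mod int CARD('p) ^ k"
    by (simp add: mod_eq_dvd_iff)
  also have "\<dots> \<longleftrightarrow> a mod CARD('p) ^ k = b mod CARD('p) ^ k"
    by (simp flip: of_nat_power of_nat_mod)
  finally show ?thesis .
qed

section \<open>Independent uniform digits and the random digit series\<close>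

definition digit_space :: "nat \<Rightarrow> (nat \<Rightarrow> nat) measure" where
  "digit_space p = Pi\<^sub>M UNIV (\<lambda>_. uniform_count_measure {..<p})"

lemma prob_space_digit_space: "p > 0 \<Longrightarrow> prob_space (digit_space p)"
  unfolding digit_space_def by (intro prob_space_PiM prob_space_uniform_count_measure) auto

lemma space_digit_space: "d \<in> space (digit_space p) \<longleftrightarrow> (\<forall>i. d i < p)"
  by (auto simp: digit_space_def space_PiM space_uniform_count_measure PiE_def extensional_def)

lemma digit_cylinder:
  assumes "p > 0" "\<And>i. i < k \<Longrightarrow> e i < p"
  shows "{d \<in> space (digit_space p). \<forall>i<k. d i = e i} \<in> sets (digit_space p)"
    and "emeasure (digit_space p) {d \<in> space (digit_space p). \<forall>i<k. d i = e i} = ennreal (inverse (real p ^ k))"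
proof -
  interpret product_prob_space "\<lambda>_ :: nat. uniform_count_measure {..<p}" UNIV
    using assms by (intro product_prob_spaceI prob_space_uniform_count_measure) auto
  have eq: "{d \<in> space (digit_space p). \<forall>i<k. d i = e i}
      = {d \<in> space (Pi\<^sub>M UNIV (\<lambda>_. uniform_count_measure {..<p})). \<forall>i\<in>{..<k}. d i \<in> {e i}}"
    by (auto simp: digit_space_def)
  also have "\<dots> = prod_emb UNIV (\<lambda>_. uniform_count_measure {..<p}) {..<k} (\<Pi>\<^sub>E i\<in>{..<k}. {e i})"
    using assms by (auto simp: prod_emb_def space_PiM space_uniform_count_measure PiE_iff)
  also have "\<dots> \<in> sets (digit_space p)"
    unfolding digit_space_def using assms
    by (intro sets_PiM_I) (auto simp: sets_uniform_count_measure)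
  finally show "{d \<in> space (digit_space p). \<forall>i<k. d i = e i} \<in> sets (digit_space p)" .
  have "emeasure (digit_space p) {d \<in> space (digit_space p). \<forall>i<k. d i = e i}
      = (\<Prod>i<k. emeasure (uniform_count_measure {..<p}) {e i})"
    unfolding eq unfolding digit_space_def
    by (rule emeasure_PiM_Collect) (use assms in \<open>auto simp: sets_uniform_count_measure\<close>)
  also have "\<dots> = (\<Prod>i<k. ennreal (inverse (real p)))"
  proof (intro prod.cong refl)
    fix i assume "i \<in> {..<k}"
    thus "emeasure (uniform_count_measure {..<p}) {e i} = ennreal (inverse (real p))"
      using assms by (subst emeasure_uniform_count_measure) (auto simp: field_simps)
  qed
  also have "\<dots> = ennreal (inverse (real p ^ k))"
    by (simp add: ennreal_power power_inverse)
  finally show "emeasure (digit_space p) {d \<in> space (digit_space p). \<forall>i<k. d i = e i}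
      = ennreal (inverse (real p ^ k))" .
qed

text \<open>Exactly one string of \<open>k\<close> digits represents \<open>a\<close>, its expansion
  in base \<open>p\<close>, so every residue has probability p^(-k). This is why independent uniform
  digits produce Haar measure.\<close>

lemma digit_sum_event:
  assumes "p > 0" "a < p ^ k"
  shows "{d \<in> space (digit_space p). digit_sum p d k = a} \<in> sets (digit_space p)"
    and "emeasure (digit_space p) {d \<in> space (digit_space p). digit_sum p d k = a} = ennreal (inverse (real p ^ k))"
proof -
  define e where "e i = a div p ^ i mod p" for i
  have e: "e i < p" for i using assms by (simp add: e_def)
  have "digit_sum p e k = a" unfolding e_def digit_sum_digits using assms by simp
  have eq: "{d \<in> space (digit_space p). digit_sum p d k = a} = {d \<in> space (digit_space p). \<forall>i<k. d i = e i}"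
    using e by (intro Collect_cong conj_cong refl)
      (simp add: space_digit_space digit_sum_eq_iff flip: \<open>digit_sum p e k = a\<close>)
  show "{d \<in> space (digit_space p). digit_sum p d k = a} \<in> sets (digit_space p)"
    and "emeasure (digit_space p) {d \<in> space (digit_space p). digit_sum p d k = a} = ennreal (inverse (real p ^ k))"
    unfolding eq by (rule digit_cylinder[OF assms(1) e])+
qed

text \<open>Membership of the limit in a ball of index \<open>k\<close> can be tested on the k-th
  partial sum, which lies in the same ball; and two naturals below p^k in a common ball of this
  index are equal.\<close>

lemma vimage_digit_lim:
  assumes "a < CARD('p) ^ k"
  shows "digit_lim -` pball (int k) (of_nat a :: 'p :: prime_card padic) \<inter> space (digit_space CARD('p))
     = {d \<in> space (digit_space CARD('p)). digit_sum CARD('p) d k = a}"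
proof -
  have "digit_lim d \<in> pball (int k) (of_nat a :: 'p padic) \<longleftrightarrow> digit_sum CARD('p) d k = a"
    if "d \<in> space (digit_space CARD('p))" for d
  proof -
    have less: "digit_sum CARD('p) d k < CARD('p) ^ k"
      using that by (intro digit_sum_less) (auto simp: space_digit_space)
    have "digit_lim d \<in> pball (int k) (of_nat a :: 'p padic) \<longleftrightarrow>
        (of_nat (digit_sum CARD('p) d k) :: 'p padic) \<in> pball (int k) (of_nat a)"
      by (rule mem_pball_cong[OF digit_lim_approx])
    thus ?thesis using less assms by (auto simp: of_nat_mem_pball_iff)
  qed
  thus ?thesis by auto
qed

text \<open>Inside the p-adic integers an open set is a countable union of balls about naturals, and
  the preimages of these are events about finitely many digits.\<close>

lemma digit_lim_measurable [measurable]: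
  "(digit_lim :: _ \<Rightarrow> 'p :: prime_card padic) \<in> borel_measurable (digit_space CARD('p))"
proof (rule borel_measurableI)
  fix U :: "'p padic set" assume U: "open U"
  define I where "I = {(k, a). a < CARD('p) ^ k \<and> pball (int k) (of_nat a :: 'p padic) \<subseteq> U}"
  let ?M = "digit_space CARD('p)"
  have "digit_lim -` U \<inter> space ?M = (\<Union>(k, a)\<in>I. digit_lim -` pball (int k) (of_nat a :: 'p padic) \<inter> space ?M)"
  proof (intro equalityI subsetI)
    fix d assume d: "d \<in> digit_lim -` U \<inter> space ?M"
    then obtain e where e: "e > 0" "cball (digit_lim d) e \<subseteq> U" using U open_contains_cball by blast
    then obtain k where k: "real CARD('p) powi (- (0 + int k)) < e"
      using order_tendstoD(2)[OF powi_uminus_tendsto_0[OF card_gt_1[where 'p = 'p]], of e 0]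
      by (auto simp: eventually_sequentially)
    let ?a = "digit_sum CARD('p) d k"
    have "pball (int k) (of_nat ?a :: 'p padic) = pball (int k) (digit_lim d)"
      by (rule pball_eqI[OF digit_lim_approx, symmetric])
    also have "\<dots> \<subseteq> cball (digit_lim d) e" using k by (auto simp: pball_def)
    finally have "(k, ?a) \<in> I"
      using d e digit_sum_less[of k d "CARD('p)"] by (auto simp: I_def space_digit_space)
    thus "d \<in> (\<Union>(k, a)\<in>I. digit_lim -` pball (int k) (of_nat a :: 'p padic) \<inter> space ?M)"
      using d digit_lim_approx[of d k, where 'p = 'p] by blast
  qed (auto simp: I_def)
  also have "\<dots> \<in> sets ?M"
  proof (rule sets.countable_UN'')
    fix i assume "i \<in> I"
    thus "(case i of (k, a) \<Rightarrow> digit_lim -` pball (int k) (of_nat a :: 'p padic) \<inter> space ?M) \<in> sets ?M"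
      by (auto simp: I_def vimage_digit_lim intro!: digit_sum_event)
  qed auto
  finally show "digit_lim -` U \<inter> space ?M \<in> sets ?M" .
qed

section \<open>Haar measures\<close>

definition zball :: "int \<Rightarrow> 'p :: prime_card padic set" where
  "zball n = pball n 0"

lemma mem_zball: "(x :: 'p :: prime_card padic) \<in> zball n \<longleftrightarrow> padic_abs x \<le> real CARD('p) powi (- n)"
  by (simp add: zball_def mem_pball)

lemma zball_add: "x \<in> zball n \<Longrightarrow> y \<in> zball n \<Longrightarrow> x + y \<in> zball n"
  using padic_abs_add[of x y] by (auto simp: mem_zball)

lemma zball_diff: "x \<in> zball n \<Longrightarrow> y \<in> zball n \<Longrightarrow> x - y \<in> zball n"
  using padic_abs_diff[of x y] by (auto simp: mem_zball)

lemma zball_mono: "j \<le> k \<Longrightarrow> zball k \<subseteq> (zball j :: 'p :: prime_card padic set)"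
  unfolding zball_def by (rule pball_mono)

lemma pball_subset_zball: "x \<in> zball n \<Longrightarrow> n \<le> k \<Longrightarrow> pball k x \<subseteq> zball n"
  using pball_mono[of n k x] pball_eqI[of x n 0] by (simp add: zball_def)

lemma zball_borel [measurable, simp]: "zball n \<in> sets borel"
  by (simp add: zball_def)

lemma continuous_on_padic_mult: "continuous_on UNIV (\<lambda>x. c * x :: 'p :: prime_card padic)"
proof (cases "c = 0")
  case False
  have "dist (c * x) (c * y) = padic_abs c * dist x y" for x y
    by (simp add: dist_padic_def flip: padic_abs_mult right_diff_distrib)
  thus ?thesis using False
    by (auto simp: continuous_on_iff intro!: exI[of _ "_ / padic_abs c"] simp: field_simps)
qed simp

lemma continuous_on_padic_add: "continuous_on UNIV (\<lambda>x. a + x :: 'p :: prime_card padic)"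
  by (auto simp: continuous_on_iff dist_padic_def)

lemma padic_mult_borel [measurable]: "(\<lambda>x. c * x :: 'p :: prime_card padic) \<in> borel_measurable borel"
  by (rule borel_measurable_continuous_onI[OF continuous_on_padic_mult])

lemma padic_add_borel [measurable]: "(\<lambda>x. a + x :: 'p :: prime_card padic) \<in> borel_measurable borel"
  by (rule borel_measurable_continuous_onI[OF continuous_on_padic_add])

abbreviation padic_p :: "'p :: prime_card padic" where
  "padic_p \<equiv> of_nat CARD('p)"

lemma padic_abs_p: "padic_abs (padic_p :: 'p :: prime_card padic) = inverse (real CARD('p))"
proof -
  have p: "prime CARD('p)" by (rule prime_card)
  have "padic_abs (padic_p :: 'p padic) = padic_abs_rat CARD('p) (of_int (int CARD('p)) / of_int 1)"
    by (simp flip: padic_of_rat_of_nat add: padic_abs_of_rat)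
  also have "\<dots> = inverse (real CARD('p))"
    by (subst padic_abs_rat_divide[OF p]) (use p in \<open>auto simp: power_int_minus\<close>)
  finally show ?thesis .
qed

lemma padic_abs_p_powi: "padic_abs ((padic_p :: 'p :: prime_card padic) powi k) = real CARD('p) powi (- k)"
  by (simp add: padic_abs_power_int padic_abs_p power_int_inverse power_int_minus)

lemma padic_p_nonzero [simp]: "(padic_p :: 'p :: prime_card padic) \<noteq> 0"
proof -
  have "padic_abs (padic_p :: 'p padic) > 0"
    using card_gt_1[where 'p = 'p] by (simp only: padic_abs_p) simp
  thus ?thesis using padic_abs_pos by blast
qed

lemma padic_p_powi_mult: "(padic_p :: 'p :: prime_card padic) powi k * padic_p powi (- k) = 1"
  by (simp add: power_int_minus)

lemma mult_mem_pball_iff: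
  assumes "padic_abs c = real CARD('p) powi (- j)"
  shows "c * y \<in> pball (j + k) (c * x) \<longleftrightarrow> y \<in> pball k (x :: 'p :: prime_card padic)"
proof -
  have pos: "real CARD('p) powi (- j) > 0" using card_gt_1[where 'p = 'p] by simp
  have "real CARD('p) powi (- (j + k)) = real CARD('p) powi (- j) * real CARD('p) powi (- k)"
    using card_gt_1[where 'p = 'p] by (subst power_int_add[symmetric]) auto
  moreover have "padic_abs (c * x - c * y) = real CARD('p) powi (- j) * padic_abs (x - y)"
    by (simp only: padic_abs_mult assms flip: right_diff_distrib)
  ultimately show ?thesis using pos by (simp add: mem_pball del: minus_add_distrib)
qed

lemma scale_padic_int:
  fixes x :: "'p :: prime_card padic"
  assumes "x \<in> zball n"
  obtains z where "z \<in> zball 0" "x = padic_p powi n * z"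
proof
  show eq: "x = padic_p powi n * (padic_p powi (- n) * x)"
    by (simp only: padic_p_powi_mult mult_1_left flip: mult.assoc)
  show "padic_p powi (- n) * x \<in> zball 0"
    using assms mult_mem_pball_iff[OF padic_abs_p_powi, where j = n and k = 0 and x = 0 and y = "padic_p powi (- n) * x"] eq
    by (simp add: zball_def)
qed

section \<open>Haar measure on the balls about 0\<close>

definition haar_int :: "'p :: prime_card padic measure" where
  "haar_int = distr (digit_space CARD('p)) borel digit_lim"

definition haar :: "int \<Rightarrow> 'p :: prime_card padic measure" where
  "haar n = distr haar_int borel (\<lambda>x. padic_p powi n * x)"

lemma sets_haar [measurable_cong, simp]: "sets (haar n) = sets borel"
  by (simp add: haar_def)

lemma space_haar [simp]: "space (haar n) = UNIV"
  by (simp add: haar_def)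

lemma digit_lim_zball: "digit_lim d \<in> (zball 0 :: 'p :: prime_card padic set)"
  using digit_lim_approx[where 'p = 'p, of d 0] by (simp add: zball_def digit_sum_def)

lemma haar_int_probs: "(haar_int :: 'p :: prime_card padic measure) \<in> borel_probs_on (zball 0)"
proof -
  interpret prob_space "digit_space CARD('p)"
    using prime_gt_0_nat[OF prime_card] by (rule prob_space_digit_space)
  have "prob_space (haar_int :: 'p padic measure)" unfolding haar_int_def by (rule prob_space_distr) simp
  moreover have "AE x in (haar_int :: 'p padic measure). x \<in> zball 0"
    unfolding haar_int_def by (subst AE_distr_iff) (auto simp: digit_lim_zball zball_borel)
  moreover have "sets (haar_int :: 'p padic measure) = sets borel" by (simp add: haar_int_def)
  ultimately show ?thesis by (simp add: borel_probs_on_def)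
qed

lemma haar_int_pball:
  fixes x :: "'p :: prime_card padic"
  assumes "x \<in> zball 0"
  shows "emeasure haar_int (pball (int k) x) = ennreal (real CARD('p) powi (- int k))"
proof -
  have "padic_abs x \<le> 1" using assms by (simp add: mem_zball)
  then obtain a where a: "a < CARD('p) ^ k" "padic_abs (x - of_nat a) \<le> real CARD('p) powi (- int k)"
    by (rule padic_int_approx[of x k])
  hence "pball (int k) x = pball (int k) (of_nat a)"
    using pball_eqI[of "of_nat a" "int k" x] by (simp add: mem_pball)
  hence "emeasure haar_int (pball (int k) x) =
      emeasure (digit_space CARD('p)) {d \<in> space (digit_space CARD('p)). digit_sum CARD('p) d k = a}"
    by (simp add: haar_int_def emeasure_distr vimage_digit_lim[OF a(1)])
  also have "\<dots> = ennreal (inverse (real CARD('p) ^ k))"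
    by (rule digit_sum_event(2)[OF prime_gt_0_nat[OF prime_card] a(1)])
  also have "inverse (real CARD('p) ^ k) = real CARD('p) powi (- int k)"
    by (simp add: power_int_minus)
  finally show ?thesis .
qed

lemma haar_probs: "(haar n :: 'p :: prime_card padic measure) \<in> borel_probs_on (zball n)"
proof -
  have s: "sets (haar_int :: 'p padic measure) = sets borel"
    and AE: "AE x in (haar_int :: 'p padic measure). x \<in> zball 0"
    and prob: "prob_space (haar_int :: 'p padic measure)"
    using haar_int_probs[where 'p = 'p] by (auto simp: borel_probs_on_def)
  have m: "(\<lambda>x :: 'p padic. padic_p powi n * x) \<in> measurable haar_int borel"
    using padic_mult_borel by (subst measurable_cong_sets[OF s refl])
  have "prob_space (haar n :: 'p padic measure)"
    unfolding haar_def using prob m by (rule prob_space.prob_space_distr)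
  moreover have "AE x in haar n. x \<in> (zball n :: 'p padic set)"
    unfolding haar_def
  proof (subst AE_distr_iff[OF m])
    show "AE x :: 'p padic in haar_int. padic_p powi n * x \<in> zball n"
      using AE
    proof eventually_elim
      case (elim x)
      thus ?case
        using mult_mem_pball_iff[OF padic_abs_p_powi, where j = n and k = 0 and x = 0 and y = x]
        by (simp add: zball_def)
    qed
  qed simp
  ultimately show ?thesis by (simp add: borel_probs_on_def)
qed

lemma haar_pball:
  fixes x :: "'p :: prime_card padic"
  assumes "x \<in> zball n" "n \<le> k"
  shows "emeasure (haar n) (pball k x) = ennreal (real CARD('p) powi (n - k))"
proof -
  obtain z where z: "z \<in> zball 0" "x = padic_p powi n * z" using scale_padic_int[OF assms(1)] .
  have s: "sets (haar_int :: 'p padic measure) = sets borel"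
    by (simp add: haar_int_def)
  have m: "(\<lambda>x :: 'p padic. padic_p powi n * x) \<in> measurable haar_int borel"
    using padic_mult_borel by (subst measurable_cong_sets[OF s refl])
  have "(\<lambda>y. padic_p powi n * y) -` pball k x = pball (k - n) z"
    using mult_mem_pball_iff[OF padic_abs_p_powi, where j = n and k = "k - n" and x = z] by (auto simp: z)
  hence "emeasure (haar n) (pball k x) = emeasure haar_int (pball (k - n) z)"
    unfolding haar_def using sets_eq_imp_space_eq[OF s] by (simp add: emeasure_distr[OF m])
  also have "k - n = int (nat (k - n))" using assms by simp
  also have "emeasure haar_int (pball \<dots> z) = ennreal (real CARD('p) powi (- \<dots>))"
    by (rule haar_int_pball[OF z(1)])
  finally show ?thesis using assms by simp
qed

text \<open>The first level \<open>m\<close> is left free: for a ball it can be the index of the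
  ball itself, while for a sphere it must lie beyond that of the radius, so that the blocks stay
  inside the sphere. Finiteness holds because every block is centred at some p^n a with
  \<open>a\<close> below a power of p.\<close>

lemma padic_blocks:
  fixes S :: "'p :: prime_card padic set"
  assumes "S \<subseteq> zball n" "n \<le> m"
  shows "ultrametric_blocks S (\<lambda>k. real CARD('p) powi (- (m + int k)))"
proof
  fix k
  let ?k = "m + int k" and ?N = "nat (m + int k - n)"
  have "(\<lambda>x. cball x (real CARD('p) powi (- ?k))) ` S
      \<subseteq> (\<lambda>a. pball ?k (padic_p powi n * of_nat a)) ` {..<CARD('p) ^ ?N}"
  proof
    fix B assume "B \<in> (\<lambda>x. cball x (real CARD('p) powi (- ?k))) ` S"
    then obtain x where x: "x \<in> zball n" "B = pball ?k x" using assms by (auto simp: pball_def)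
    obtain z where z: "z \<in> zball 0" "x = padic_p powi n * z" using scale_padic_int[OF x(1)] .
    have "padic_abs z \<le> 1" using z by (simp add: mem_zball)
    then obtain a where a: "a < CARD('p) ^ ?N" "padic_abs (z - of_nat a) \<le> real CARD('p) powi (- int ?N)"
      by (rule padic_int_approx[of z ?N])
    have N: "n + int ?N = ?k" using assms by simp
    have "of_nat a \<in> pball (int ?N) z" using a by (simp add: mem_pball)
    hence "padic_p powi n * of_nat a \<in> pball (n + int ?N) (padic_p powi n * z)"
      by (subst mult_mem_pball_iff[OF padic_abs_p_powi])
    hence "padic_p powi n * of_nat a \<in> pball ?k x" by (simp only: N z(2))
    hence "B = pball ?k (padic_p powi n * of_nat a)" unfolding x(2) by (rule pball_eqI[symmetric])
    thus "B \<in> (\<lambda>a. pball ?k (padic_p powi n * of_nat a)) ` {..<CARD('p) ^ ?N}"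
      using a by blast
  qed
  thus "finite ((\<lambda>x. cball x (real CARD('p) powi (- ?k))) ` S)"
    by (rule finite_subset) simp
next
  show "(\<lambda>k. real CARD('p) powi (- (m + int k))) \<longlonglongrightarrow> 0"
    by (rule powi_uminus_tendsto_0[OF card_gt_1])
  show "decseq (\<lambda>k. real CARD('p) powi (- (m + int k)))"
    using powi_le_iff[OF card_gt_1[where 'p = 'p]] by (simp add: decseq_def del: minus_add_distrib)
  show "0 \<le> real CARD('p) powi (- (m + int k))" for k by simp
  show "dist x z \<le> max (dist x y) (dist y z)" for x y z :: "'p padic" by (rule padic_dist_ultra)
qed

lemma padic_uniform_unique:
  fixes S :: "'p :: prime_card padic set"
  assumes "S \<subseteq> zball n" "n \<le> m" "\<mu> \<in> borel_probs_on S" "\<nu> \<in> borel_probs_on S"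
    and "\<And>k x y. m \<le> k \<Longrightarrow> x \<in> S \<Longrightarrow> y \<in> S \<Longrightarrow> emeasure \<mu> (pball k x) = emeasure \<mu> (pball k y)"
    and "\<And>k x y. m \<le> k \<Longrightarrow> x \<in> S \<Longrightarrow> y \<in> S \<Longrightarrow> emeasure \<nu> (pball k x) = emeasure \<nu> (pball k y)"
  shows "\<mu> = \<nu>"
proof -
  interpret ultrametric_blocks S "\<lambda>k. real CARD('p) powi (- (m + int k))"
    by (rule padic_blocks[OF assms(1,2)])
  show ?thesis
    by (rule uniform_measure_unique[OF assms(3,4)]; fold pball_def; rule assms(5,6)) auto
qed

section \<open>Spheres, units, and the identification of both kinds of Haar measure\<close>

definition psphere :: "int \<Rightarrow> 'p :: prime_card padic set" where
  "psphere k = {x. padic_abs x = real CARD('p) powi (- k)}"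

text \<open>No absolute value lies strictly between consecutive powers of p, so an open ball is the
  closed ball of the next index. This makes a sphere the difference of two closed balls.\<close>

lemma padic_abs_le_iff_less:
  fixes x :: "'p :: prime_card padic"
  shows "padic_abs x \<le> real CARD('p) powi (- (k + 1)) \<longleftrightarrow> padic_abs x < real CARD('p) powi (- k)"
proof (cases "x = 0")
  case True
  thus ?thesis using card_gt_1[where 'p = 'p] by simp
next
  case False
  then obtain j where j: "padic_abs x = real CARD('p) powi j" by (rule padic_abs_eq_powi)
  show ?thesis
    unfolding j powi_le_iff[OF card_gt_1] powi_less_iff[OF card_gt_1] by linarith
qed

lemma psphere_eq: "psphere k = zball k - (zball (k + 1) :: 'p :: prime_card padic set)"
  unfolding psphere_def set_eq_iff Diff_iff mem_zball padic_abs_le_iff_less mem_Collect_eq by auto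

lemma psphere_borel [measurable, simp]: "psphere k \<in> sets borel"
  by (simp add: psphere_eq)

lemma psphere_subset: "psphere k \<subseteq> zball k"
  by (auto simp: psphere_eq)

lemma pball_subset_psphere:
  assumes "x \<in> psphere k" "k < m"
  shows "pball m x \<subseteq> (psphere k :: 'p :: prime_card padic set)"
proof
  fix y assume "y \<in> pball m x"
  moreover have "real CARD('p) powi (- m) < real CARD('p) powi (- k)"
    unfolding powi_less_iff[OF card_gt_1] using assms by simp
  ultimately have "padic_abs (x - y) < padic_abs x"
    using assms by (simp add: mem_pball psphere_def)
  hence "padic_abs y = padic_abs x" by (rule padic_abs_eq_of_close)
  thus "y \<in> psphere k" using assms by (simp add: psphere_def)
qed

lemma padic_ints_eq: "padic_ints = zball 0"
  by (auto simp: padic_ints_def mem_zball)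

lemma padic_units_eq: "padic_units = psphere 0"
proof (intro equalityI subsetI)
  fix u :: "'a padic" assume "u \<in> padic_units"
  then obtain v where uv: "padic_abs u \<le> 1" "padic_abs v \<le> 1" "u * v = 1"
    by (auto simp: padic_units_def padic_ints_def)
  have "padic_abs u * padic_abs v = 1" using uv(3) by (simp flip: padic_abs_mult)
  moreover have "padic_abs u * padic_abs v \<le> padic_abs u * 1" using uv(2) by (intro mult_left_mono) auto
  ultimately show "u \<in> psphere 0" using uv(1) by (simp add: psphere_def)
next
  fix u :: "'a padic" assume u: "u \<in> psphere 0"
  hence "u \<noteq> 0" by (auto simp: psphere_def)
  hence "u * inverse u = 1" by simp
  moreover have "padic_abs u = 1" "padic_abs (inverse u) = 1"
    using u by (simp_all add: psphere_def padic_abs_inverse)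
  ultimately show "u \<in> padic_units"
    by (auto simp: padic_units_def padic_ints_def simp del: right_inverse intro!: exI[of _ "inverse u"])
qed

lemma prime_scale_zball: "padic_prime_scale n padic_ints = (zball n :: 'p :: prime_card padic set)"
proof (intro equalityI subsetI)
  fix x :: "'p padic" assume "x \<in> padic_prime_scale n padic_ints"
  then obtain z where z: "z \<in> zball 0" "x = padic_p powi n * z"
    by (auto simp: padic_prime_scale_def padic_ints_eq)
  have "padic_p powi n * z \<in> pball (n + 0) (padic_p powi n * 0)"
    using z(1) mult_mem_pball_iff[OF padic_abs_p_powi, of n z 0 0] unfolding zball_def by blast
  thus "x \<in> zball n" by (simp add: zball_def z(2))
next
  fix x :: "'p padic" assume "x \<in> zball n"
  then obtain z where "z \<in> zball 0" "x = padic_p powi n * z" by (rule scale_padic_int)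
  thus "x \<in> padic_prime_scale n padic_ints" by (auto simp: padic_prime_scale_def padic_ints_eq)
qed

lemma prime_scale_psphere: "padic_prime_scale k padic_units = (psphere k :: 'p :: prime_card padic set)"
proof (intro equalityI subsetI)
  fix x :: "'p padic" assume "x \<in> padic_prime_scale k padic_units"
  thus "x \<in> psphere k"
    by (auto simp: padic_prime_scale_def padic_units_eq psphere_def padic_abs_mult padic_abs_p_powi)
next
  fix x :: "'p padic" assume x: "x \<in> psphere k"
  have eq: "x = padic_p powi k * (padic_p powi (- k) * x)"
    by (simp only: padic_p_powi_mult mult_1_left flip: mult.assoc)
  have "padic_abs (padic_p powi (- k) * x) = real CARD('p) powi k * real CARD('p) powi (- k)"
    using x by (simp only: padic_abs_mult padic_abs_p_powi psphere_def) simp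
  also have "\<dots> = 1" using card_gt_1[where 'p = 'p] by (simp add: power_int_minus)
  finally have "padic_p powi (- k) * x \<in> padic_units" by (simp add: padic_units_eq psphere_def)
  thus "x \<in> padic_prime_scale k padic_units" unfolding padic_prime_scale_def using eq by blast
qed

lemma borel_probs_on_distr:
  fixes f :: "'p :: prime_card padic \<Rightarrow> 'p padic"
  assumes \<nu>: "\<nu> \<in> borel_probs_on S" and f: "f \<in> borel_measurable borel"
    and S: "S \<in> sets borel" and fS: "\<And>x. x \<in> S \<Longrightarrow> f x \<in> S"
  shows "distr \<nu> borel f \<in> borel_probs_on S"
proof -
  have s: "sets \<nu> = sets borel" and AE: "AE x in \<nu>. x \<in> S" and prob: "prob_space \<nu>"
    using \<nu> by (auto simp: borel_probs_on_def)
  have m: "f \<in> measurable \<nu> borel" using f by (subst measurable_cong_sets[OF s refl])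
  have "AE x in distr \<nu> borel f. x \<in> S"
    using S AE fS by (subst AE_distr_iff[OF m]) (auto elim!: eventually_mono)
  thus ?thesis using prob_space.prob_space_distr[OF prob m] by (simp add: borel_probs_on_def)
qed

lemma emeasure_distr_add:
  assumes "sets \<nu> = sets borel"
  shows "emeasure (distr \<nu> borel (\<lambda>x. a + x)) (pball k x) = emeasure \<nu> (pball k (x - a :: 'p :: prime_card padic))"
proof -
  have m: "(\<lambda>x. a + x) \<in> measurable \<nu> borel"
    using padic_add_borel by (subst measurable_cong_sets[OF assms refl])
  have "(\<lambda>x. a + x) -` pball k x = pball k (x - a)"
    by (auto simp: mem_pball diff_diff_add)
  thus ?thesis using sets_eq_imp_space_eq[OF assms] by (simp add: emeasure_distr[OF m])
qed

lemma emeasure_distr_mult: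
  assumes "sets \<nu> = sets borel" "u \<in> padic_units"
  shows "emeasure (distr \<nu> borel (\<lambda>x. u * x)) (pball k x) = emeasure \<nu> (pball k (x / u :: 'p :: prime_card padic))"
proof -
  have m: "(\<lambda>x. u * x) \<in> measurable \<nu> borel"
    using padic_mult_borel by (subst measurable_cong_sets[OF assms(1) refl])
  have u: "padic_abs u = real CARD('p) powi (- 0)" using assms(2) by (simp add: padic_units_eq psphere_def)
  hence "u \<noteq> 0" by auto
  have "(\<lambda>x. u * x) -` pball k x = pball k (x / u)"
    using mult_mem_pball_iff[OF u, of _ k "x / u"] \<open>u \<noteq> 0\<close> by auto
  thus ?thesis using sets_eq_imp_space_eq[OF assms(1)] by (simp add: emeasure_distr[OF m])
qed

text \<open>Translation by \<open>x - y\<close> carries the ball at \<open>y\<close> to the ball at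
  \<open>x\<close>, so an invariant measure charges balls of one radius equally and must be
  \<open>haar n\<close>. The same uniqueness, applied to a translate of \<open>haar n\<close>,
  proves that \<open>haar n\<close> is invariant.\<close>

lemma haar_additive_zball: "haar_additive (zball n) = (haar n :: 'p :: prime_card padic measure)"
  unfolding haar_additive_def
proof (rule the_equality)
  have haar_unif: "emeasure (haar n) (pball k x) = emeasure (haar n) (pball k y)"
    if "n \<le> k" "x \<in> zball n" "y \<in> zball n" for k and x y :: "'p padic"
    by (simp only: haar_pball[OF that(2,1)] haar_pball[OF that(3,1)])
  show "haar n \<in> borel_probs_on (zball n) \<and> (\<forall>a\<in>zball n. distr (haar n) borel (\<lambda>x :: 'p padic. a + x) = haar n)"
  proof (intro conjI ballI haar_probs)
    fix a :: "'p padic" assume a: "a \<in> zball n"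
    show "distr (haar n) borel (\<lambda>x. a + x) = haar n"
    proof (rule padic_uniform_unique[OF subset_refl order_refl _ haar_probs _ haar_unif])
      show "distr (haar n) borel (\<lambda>x. a + x) \<in> borel_probs_on (zball n)"
        using a zball_add by (intro borel_probs_on_distr haar_probs) auto
      show "emeasure (distr (haar n) borel (\<lambda>x. a + x)) (pball k x) = emeasure (distr (haar n) borel (\<lambda>x. a + x)) (pball k y)"
        if "n \<le> k" "x \<in> zball n" "y \<in> zball n" for k and x y :: "'p padic"
        unfolding emeasure_distr_add[OF sets_haar]
        using that a zball_diff by (intro haar_unif) auto
    qed
  qed
  fix \<nu> :: "'p padic measure"
  assume \<nu>: "\<nu> \<in> borel_probs_on (zball n) \<and> (\<forall>a\<in>zball n. distr \<nu> borel (\<lambda>x. a + x) = \<nu>)"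
  hence s: "sets \<nu> = sets borel" by (simp add: borel_probs_on_def)
  show "\<nu> = haar n"
  proof (rule padic_uniform_unique[OF subset_refl order_refl _ haar_probs _ haar_unif])
    fix k and x y :: "'p padic" assume xy: "x \<in> zball n" "y \<in> zball n"
    have "emeasure \<nu> (pball k x) = emeasure (distr \<nu> borel (\<lambda>z. (x - y) + z)) (pball k x)"
      using \<nu> zball_diff[OF xy] by simp
    also have "\<dots> = emeasure \<nu> (pball k y)" by (simp add: emeasure_distr_add[OF s])
    finally show "emeasure \<nu> (pball k x) = emeasure \<nu> (pball k y)" .
  qed (use \<nu> in auto)
qed

lemma emeasure_haar_zball:
  "n \<le> k \<Longrightarrow> emeasure (haar n) (zball k :: 'p :: prime_card padic set) = ennreal (real CARD('p) powi (n - k))"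
  unfolding zball_def by (rule haar_pball) (simp add: mem_zball)

lemma emeasure_haar_psphere:
  assumes "n \<le> k"
  shows "emeasure (haar n) (psphere k :: 'p :: prime_card padic set)
    = ennreal (real CARD('p) powi (n - k) * (1 - 1 / real CARD('p)))"
proof -
  have sub: "zball (k + 1) \<subseteq> (zball k :: 'p padic set)" by (rule zball_mono) simp
  have "emeasure (haar n) (psphere k :: 'p padic set)
      = emeasure (haar n) (zball k :: 'p padic set) - emeasure (haar n) (zball (k + 1) :: 'p padic set)"
    unfolding psphere_eq using assms by (intro emeasure_Diff sub) (simp_all add: emeasure_haar_zball)
  also have "\<dots> = ennreal (real CARD('p) powi (n - k) - real CARD('p) powi (n - (k + 1)))"
    using assms by (simp add: emeasure_haar_zball ennreal_minus)
  also have "real CARD('p) powi (n - (k + 1)) = real CARD('p) powi (n - k) / real CARD('p)"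
    using card_gt_1[where 'p = 'p] by (simp add: power_int_diff power_int_add)
  finally show ?thesis by (simp add: algebra_simps)
qed

lemma uniform_measure_probs:
  assumes "S \<in> sets borel" "emeasure (haar n) S \<noteq> 0"
  shows "uniform_measure (haar n) S \<in> borel_probs_on (S :: 'p :: prime_card padic set)"
proof -
  interpret prob_space "haar n :: 'p padic measure"
    using haar_probs[where 'p = 'p, of n] by (simp add: borel_probs_on_def)
  have "prob_space (uniform_measure (haar n) S)"
    using assms by (intro prob_space_uniform_measure) auto
  moreover have "AE x in uniform_measure (haar n) S. x \<in> S"
    using assms by (intro AE_uniform_measureI) auto
  ultimately show ?thesis by (simp add: borel_probs_on_def)
qed

lemma uniform_measure_pball:
  assumes "S \<in> sets borel" "S \<subseteq> zball n" "x \<in> S" "pball k x \<subseteq> S" "n \<le> k"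
  shows "emeasure (uniform_measure (haar n) S) (pball k x)
    = ennreal (real CARD('p) powi (n - k)) / emeasure (haar n) (S :: 'p :: prime_card padic set)"
proof -
  have "S \<inter> pball k x = pball k x" using assms by auto
  thus ?thesis using assms haar_pball[of x n k] by (subst emeasure_uniform_measure) auto
qed

text \<open>Conditioning on a smaller ball about 0 keeps its balls of one radius equally heavy. Thus
  all components of the later mixture are conditionings of the single measure
  \<open>haar n\<close>.\<close>

lemma haar_eq_uniform_measure:
  assumes "n \<le> j"
  shows "haar j = uniform_measure (haar n) (zball j :: 'p :: prime_card padic set)"
proof (rule padic_uniform_unique[OF zball_mono[OF assms] assms haar_probs])
  have "emeasure (haar n) (zball j :: 'p padic set) \<noteq> 0"
    using assms card_gt_1[where 'p = 'p] by (simp add: emeasure_haar_zball)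
  thus "uniform_measure (haar n) (zball j :: 'p padic set) \<in> borel_probs_on (zball j)"
    by (intro uniform_measure_probs) auto
next
  fix k and x y :: "'p padic" assume "j \<le> k" "x \<in> zball j" "y \<in> zball j"
  thus "emeasure (haar j) (pball k x) = emeasure (haar j) (pball k y)"
    by (simp only: haar_pball)
next
  fix k and x y :: "'p padic" assume "j \<le> k" "x \<in> zball j" "y \<in> zball j"
  thus "emeasure (uniform_measure (haar n) (zball j)) (pball k x) = emeasure (uniform_measure (haar n) (zball j)) (pball k y)"
    using assms zball_mono[OF assms, where 'p = 'p] pball_subset_zball[of x j k] pball_subset_zball[of y j k]
    by (subst (1 2) uniform_measure_pball) auto
qed

text \<open>Multiplication by a unit preserves the radii of balls inside a sphere, and units act
  transitively on the sphere through \<open>x / y\<close>. Multiplicative invariance therefore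
  amounts to the same uniformity over balls that additive Haar measure has. Only balls of index
  beyond \<open>j\<close>, which stay inside the sphere, are compared.\<close>

lemma haar_multiplicative_psphere:
  assumes "n \<le> j"
  shows "haar_multiplicative (psphere j) = uniform_measure (haar n) (psphere j :: 'p :: prime_card padic set)"
  unfolding haar_multiplicative_def
proof (rule the_equality)
  let ?S = "psphere j :: 'p padic set" and ?\<mu> = "uniform_measure (haar n) (psphere j :: 'p padic set)"
  have sub: "?S \<subseteq> zball n" using psphere_subset zball_mono[OF assms] by blast
  have m: "n \<le> j + 1" using assms by simp
  have "real CARD('p) powi (n - j) * (1 - 1 / real CARD('p)) > 0"
    using card_gt_1[where 'p = 'p] by (intro mult_pos_pos) auto
  hence "emeasure (haar n) ?S \<noteq> 0"
    unfolding emeasure_haar_psphere[OF assms] by (simp only: ennreal_eq_0_iff not_le)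
  hence probs: "?\<mu> \<in> borel_probs_on ?S" by (intro uniform_measure_probs) auto
  have s: "sets ?\<mu> = sets borel" by simp
  have unif: "emeasure ?\<mu> (pball k x) = emeasure ?\<mu> (pball k y)"
    if "j + 1 \<le> k" "x \<in> ?S" "y \<in> ?S" for k x y
    using uniform_measure_pball[OF psphere_borel sub that(2) pball_subset_psphere[OF that(2)], of k]
      uniform_measure_pball[OF psphere_borel sub that(3) pball_subset_psphere[OF that(3)], of k] that assms
    by simp
  have unit: "u * x \<in> ?S" "x / u \<in> ?S" if "u \<in> padic_units" "x \<in> ?S" for u x
    using that by (simp_all add: padic_units_eq psphere_def padic_abs_mult padic_abs_divide)
  show "?\<mu> \<in> borel_probs_on ?S \<and> (\<forall>u\<in>padic_units. distr ?\<mu> borel (\<lambda>x. u * x) = ?\<mu>)"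
  proof (intro conjI ballI probs)
    fix u :: "'p padic" assume u: "u \<in> padic_units"
    show "distr ?\<mu> borel (\<lambda>x. u * x) = ?\<mu>"
    proof (rule padic_uniform_unique[OF sub m _ probs _ unif])
      show "distr ?\<mu> borel (\<lambda>x. u * x) \<in> borel_probs_on ?S"
        using u unit by (intro borel_probs_on_distr probs) auto
      show "emeasure (distr ?\<mu> borel (\<lambda>x. u * x)) (pball k x) = emeasure (distr ?\<mu> borel (\<lambda>x. u * x)) (pball k y)"
        if "j + 1 \<le> k" "x \<in> ?S" "y \<in> ?S" for k x y
        unfolding emeasure_distr_mult[OF s u] using that u unit by (intro unif) auto
    qed
  qed
  fix \<nu> :: "'p padic measure"
  assume \<nu>: "\<nu> \<in> borel_probs_on ?S \<and> (\<forall>u\<in>padic_units. distr \<nu> borel (\<lambda>x. u * x) = \<nu>)"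
  hence s': "sets \<nu> = sets borel" by (simp add: borel_probs_on_def)
  show "\<nu> = ?\<mu>"
  proof (rule padic_uniform_unique[OF sub m _ probs _ unif])
    fix k and x y :: "'p padic" assume xy: "x \<in> ?S" "y \<in> ?S"
    have nz: "x \<noteq> 0" "y \<noteq> 0" using xy card_gt_1[where 'p = 'p] by (auto simp: psphere_def)
    have u: "x / y \<in> padic_units"
      using xy nz by (simp add: padic_units_eq psphere_def padic_abs_divide)
    have "emeasure \<nu> (pball k x) = emeasure (distr \<nu> borel (\<lambda>z. (x / y) * z)) (pball k x)"
      using \<nu> u by (simp only:)
    also have "\<dots> = emeasure \<nu> (pball k y)" using nz by (simp only: emeasure_distr_mult[OF s' u]) simp
    finally show "emeasure \<nu> (pball k x) = emeasure \<nu> (pball k y)" .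
  qed (use \<nu> in auto)
qed

text \<open>The mixture is realised as a density, so that countable additivity comes for free;
  division by the mass of \<open>T i\<close> makes each piece a conditional measure.\<close>

lemma emeasure_density_mixture:
  assumes "finite I" "\<And>i. i \<in> I \<Longrightarrow> T i \<in> sets M" "A \<in> sets M"
  shows "emeasure (density M (\<lambda>x. \<Sum>i\<in>I. w i / emeasure M (T i) * indicator (T i) x)) A
    = (\<Sum>i\<in>I. w i * emeasure (uniform_measure M (T i)) A)"
proof -
  have "emeasure (density M (\<lambda>x. \<Sum>i\<in>I. w i / emeasure M (T i) * indicator (T i) x)) A
      = (\<integral>\<^sup>+ x. (\<Sum>i\<in>I. w i / emeasure M (T i) * indicator (T i \<inter> A) x) \<partial>M)"
  proof (subst emeasure_density)
    show "(\<lambda>x. \<Sum>i\<in>I. w i / emeasure M (T i) * indicator (T i) x) \<in> borel_measurable M"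
      using assms by (intro borel_measurable_sum borel_measurable_times borel_measurable_const) simp
    show "(\<integral>\<^sup>+ x. (\<Sum>i\<in>I. w i / emeasure M (T i) * indicator (T i) x) * indicator A x \<partial>M)
      = (\<integral>\<^sup>+ x. (\<Sum>i\<in>I. w i / emeasure M (T i) * indicator (T i \<inter> A) x) \<partial>M)"
      by (simp add: sum_distrib_right indicator_inter_arith mult.assoc)
  qed (rule assms)
  also have "\<dots> = (\<Sum>i\<in>I. \<integral>\<^sup>+ x. w i / emeasure M (T i) * indicator (T i \<inter> A) x \<partial>M)"
    using assms by (intro nn_integral_sum) auto
  also have "\<dots> = (\<Sum>i\<in>I. w i * emeasure (uniform_measure M (T i)) A)"
  proof (intro sum.cong refl)
    fix i assume "i \<in> I"
    hence "T i \<in> sets M" "T i \<inter> A \<in> sets M" using assms by auto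
    hence "(\<integral>\<^sup>+ x. w i / emeasure M (T i) * indicator (T i \<inter> A) x \<partial>M)
        = w i / emeasure M (T i) * emeasure M (T i \<inter> A)"
      by (intro nn_integral_cmult_indicator)
    thus "(\<integral>\<^sup>+ x. w i / emeasure M (T i) * indicator (T i \<inter> A) x \<partial>M)
        = w i * emeasure (uniform_measure M (T i)) A"
      using \<open>T i \<in> sets M\<close> assms(3)
      by (simp add: emeasure_uniform_measure ennreal_times_divide ennreal_divide_times)
  qed
  finally show ?thesis .
qed

section \<open>The spherical metric\<close>

text \<open>Rests on the three-term relation between the 2x2 minors of \<open>x\<close>,
  \<open>y\<close>, \<open>z\<close>, in which one minor is multiplied by a coordinate
  \<open>w\<close> of \<open>y\<close>. Choosing the coordinate of larger absolute value turns
  \<open>padic_abs w\<close> into the normalising factor \<open>b\<close>.\<close>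

lemma homog_dist_ultra:
  assumes "x \<noteq> (0, 0)" "y \<noteq> (0, 0)" "z \<noteq> (0, 0)"
  shows "homog_dist x z \<le> max (homog_dist x y) (homog_dist y z)"
proof -
  obtain x0 x1 where x: "x = (x0, x1)" by (cases x)
  obtain y0 y1 where y: "y = (y0, y1)" by (cases y)
  obtain z0 z1 where z: "z = (z0, z1)" by (cases z)
  define a where "a = max (padic_abs x0) (padic_abs x1)"
  define b where "b = max (padic_abs y0) (padic_abs y1)"
  define c where "c = max (padic_abs z0) (padic_abs z1)"
  have pos: "a > 0" "b > 0" "c > 0"
    unfolding a_def b_def c_def by (rule padic_max_pos, use assms x y z in simp)+
  define P where "P = padic_abs (x0 * z1 - z0 * x1)"
  define Q where "Q = padic_abs (x0 * y1 - y0 * x1)"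
  define R where "R = padic_abs (y0 * z1 - z0 * y1)"
  have ge: "P \<ge> 0" "Q \<ge> 0" "R \<ge> 0" by (simp_all add: P_def Q_def R_def)
  have ultra: "padic_abs w * P \<le> max (Q * c) (R * a)"
    if "w * (x0 * z1 - z0 * x1) = (x0 * y1 - y0 * x1) * v + (y0 * z1 - z0 * y1) * u"
      "padic_abs v \<le> c" "padic_abs u \<le> a" for u v w
  proof -
    have "padic_abs w * P = padic_abs (w * (x0 * z1 - z0 * x1))"
      by (simp only: P_def padic_abs_mult)
    also have "\<dots> \<le> max (padic_abs ((x0 * y1 - y0 * x1) * v)) (padic_abs ((y0 * z1 - z0 * y1) * u))"
      unfolding that(1) by (rule padic_abs_add)
    also have "\<dots> = max (Q * padic_abs v) (R * padic_abs u)"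
      by (simp only: padic_abs_mult Q_def R_def)
    also have "\<dots> \<le> max (Q * c) (R * a)"
      using that(2,3) ge by (intro max.mono mult_left_mono)
    finally show ?thesis .
  qed
  have "padic_abs y1 * P \<le> max (Q * c) (R * a)"
    by (rule ultra[of _ z1 x1]) (simp_all add: algebra_simps a_def c_def)
  moreover have "padic_abs y0 * P \<le> max (Q * c) (R * a)"
    by (rule ultra[of _ z0 x0]) (simp_all add: algebra_simps a_def c_def)
  moreover have "b = padic_abs y0 \<or> b = padic_abs y1" unfolding b_def by linarith
  ultimately have "b * P \<le> max (Q * c) (R * a)" by (elim disjE) simp_all
  hence "b * P / (a * b * c) \<le> max (Q * c) (R * a) / (a * b * c)"
    using pos by (intro divide_right_mono) auto
  also have "\<dots> = max (Q * c / (a * b * c)) (R * a / (a * b * c))"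
    using pos by (simp add: max_divide_distrib_right)
  finally have "P / (a * c) \<le> max (Q / (a * b)) (R / (b * c))"
    using pos by simp
  thus ?thesis
    unfolding homog_dist_def x y z fst_conv snd_conv P_def Q_def R_def a_def b_def c_def .
qed

lemma P1_dist_ultra: "dist x z \<le> max (dist x y) (dist y (z :: 'p :: prime_card padic_P1))"
  unfolding dist_padic_P1_def by transfer (simp add: proj_rel_self_iff homog_dist_ultra)

lemma dist_of_padic:
  "dist (of_padic x) (of_padic y) = padic_abs (x - y) / (max 1 (padic_abs x) * max 1 (padic_abs y))"
  by (simp add: dist_padic_P1_def spherical_dist_of_padic)

lemma dist_of_padic_le: "dist (of_padic x) (of_padic y) \<le> dist x (y :: 'p :: prime_card padic)"
proof -
  have "1 * 1 \<le> max 1 (padic_abs x) * max 1 (padic_abs y)" by (intro mult_mono) auto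
  hence "padic_abs (x - y) / (max 1 (padic_abs x) * max 1 (padic_abs y)) \<le> padic_abs (x - y) / 1"
    by (intro divide_left_mono) auto
  thus ?thesis by (simp add: dist_of_padic dist_padic_def)
qed

lemma of_padic_borel [measurable]: "of_padic \<in> borel_measurable borel"
proof (rule borel_measurable_continuous_onI)
  show "continuous_on UNIV (of_padic :: 'a padic \<Rightarrow> _)"
    unfolding continuous_on_iff by (meson dist_of_padic_le le_less_trans)
qed

section \<open>The point at infinity, and why embedded balls are Borel sets\<close>

lift_definition P1_inf :: "'p :: prime_card padic_P1" is "(1, 0)"
  by (simp add: proj_rel_self_iff)

lemma P1_cases:
  obtains "z = P1_inf" | y where "z = of_padic y"
proof -
  have "z = P1_inf \<or> (\<exists>y. z = of_padic y)"
  proof transfer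
    fix z :: "'a padic \<times> 'a padic" assume "proj_rel z z"
    hence nz: "z \<noteq> (0, 0)" by (simp add: proj_rel_self_iff)
    obtain z0 z1 where z: "z = (z0, z1)" by (cases z)
    show "proj_rel z (1, 0) \<or> (\<exists>y. proj_rel z (y, 1))"
    proof (cases "z1 = 0")
      case True
      hence "proj_rel z (1, 0)" using nz z by (auto simp: proj_rel_def intro!: exI[of _ "inverse z0"])
      thus ?thesis by simp
    next
      case False
      hence "proj_rel z (z0 / z1, 1)" using nz z
        by (auto simp: proj_rel_def field_simps intro!: exI[of _ "inverse z1"])
      thus ?thesis by blast
    qed
  qed
  thus ?thesis using that by blast
qed

lemma dist_inf_of_padic: "dist P1_inf (of_padic y) = 1 / max 1 (padic_abs y)"
  by (simp add: dist_padic_P1_def spherical_dist.abs_eq P1_inf.abs_eq of_padic.abs_eq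
      proj_rel_self_iff homog_dist_def max.commute)

lemma of_padic_zball_borel: "of_padic ` zball n \<in> sets (borel :: 'p :: prime_card padic_P1 measure)"
proof -
  \<comment> \<open>A ball of radius at least 1 about 0 is the complement of an open ball about
    infinity, and a smaller one is a spherical ball about 0. In both cases the image is
    closed.\<close>
  define C :: "'p padic_P1 set" where
    "C = (if n \<le> 0 then {z. real CARD('p) powi n \<le> dist P1_inf z}
          else {z. dist (of_padic 0) z \<le> real CARD('p) powi (- n)})"
  have pos: "real CARD('p) powi k > 0" for k using card_gt_1[where 'p = 'p] by simp
  have less1: "real CARD('p) powi k \<le> 1 \<longleftrightarrow> k \<le> 0" for k
    using powi_le_iff[OF card_gt_1[where 'p = 'p], of k 0] by simp
  have "of_padic y \<in> C \<longleftrightarrow> y \<in> zball n" for y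
  proof (cases "n \<le> 0")
    case True
    have "real CARD('p) powi n \<le> 1 / M \<longleftrightarrow> M \<le> real CARD('p) powi (- n)" if "M > 0" for M
      using that pos[of n] by (simp add: power_int_minus field_simps)
    from this[of "max 1 (padic_abs y)"]
    have "of_padic y \<in> C \<longleftrightarrow> max 1 (padic_abs y) \<le> real CARD('p) powi (- n)"
      using True by (simp add: C_def dist_inf_of_padic)
    moreover have "1 \<le> real CARD('p) powi (- n)"
      using True powi_le_iff[OF card_gt_1[where 'p = 'p], of 0 "- n"] by simp
    ultimately show ?thesis by (simp add: mem_zball)
  next
    case False
    hence lt: "real CARD('p) powi (- n) < 1" using less1[of n] pos[of n] by (simp add: power_int_minus field_simps)
    have "of_padic y \<in> C \<longleftrightarrow> padic_abs y / max 1 (padic_abs y) \<le> real CARD('p) powi (- n)"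
      using False by (simp add: C_def dist_of_padic)
    thus ?thesis using lt by (cases "padic_abs y \<le> 1") (auto simp: mem_zball)
  qed
  moreover have "P1_inf \<notin> C"
  proof (cases "n \<le> 0")
    case True
    have "\<not> real CARD('p) powi n \<le> 0" using pos[of n] by linarith
    thus ?thesis using True by (simp only: C_def) simp
  next
    case False
    have "dist (of_padic 0) (P1_inf :: 'p padic_P1) = 1"
      using dist_inf_of_padic[of "0 :: 'p padic"] by (simp add: dist_commute)
    thus ?thesis using False less1[of "- n"] less1[of n] pos[of n]
      by (simp add: C_def power_int_minus field_simps)
  qed
  ultimately have "of_padic ` zball n = C"
    by (intro equalityI subsetI) (metis P1_cases image_eqI imageE)+
  moreover have "closed C"
    unfolding C_def by (auto intro!: closed_Collect_le continuous_intros)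
  ultimately show ?thesis by simp
qed

text \<open>Levels begin at radius 1/p: a level of radius 1 would contain every pair of points,
  whereas the kernel vanishes at distance 1.\<close>

lemma P1_blocks:
  "ultrametric_blocks (of_padic ` (zball n :: 'p :: prime_card padic set)) (\<lambda>k. real CARD('p) powi (- (1 + int k)))"
proof
  fix k
  let ?r = "real CARD('p) powi (- (1 + int k))"
  \<comment> \<open>The embedding does not increase distances, so a p-adic ball of index at least
    \<open>1 + int k\<close> stays in one spherical block. The maximum with \<open>n\<close> reaches
    the range in which finiteness of the p-adic balls is available.\<close>
  define m where "m = max n (1 + int k)"
  define F :: "'p padic set set" where "F = (\<lambda>x. pball m x) ` zball n"
  have fin: "finite F"
  proof -
    have "n \<le> m" by (simp add: m_def)
    then interpret ultrametric_blocks "zball n :: 'p padic set" "\<lambda>k. real CARD('p) powi (- (m + int k))"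
      by (intro padic_blocks[OF subset_refl])
    show ?thesis using finite_blocks'[of 0] by (simp add: F_def pball_def)
  qed
  have "(\<lambda>x. cball x ?r) ` of_padic ` (zball n :: 'p padic set) \<subseteq> (\<lambda>B. cball (of_padic (SOME x. x \<in> B)) ?r) ` F"
  proof
    fix B assume "B \<in> (\<lambda>x. cball x ?r) ` of_padic ` (zball n :: 'p padic set)"
    then obtain x :: "'p padic" where x: "x \<in> zball n" "B = cball (of_padic x) ?r" by auto
    define y where "y = (SOME y. y \<in> pball m x)"
    have "y \<in> pball m x" unfolding y_def by (rule someI) (rule self_mem_pball)
    moreover have "real CARD('p) powi (- m) \<le> ?r"
      unfolding powi_le_iff[OF card_gt_1] by (simp add: m_def)
    ultimately have xy: "dist (of_padic x) (of_padic y) \<le> ?r"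
      using dist_of_padic_le[of x y] by (simp add: pball_def)
    have "B = cball (of_padic y) ?r"
      unfolding x(2)
    proof (intro Set.set_eqI)
      fix z
      show "z \<in> cball (of_padic x) ?r \<longleftrightarrow> z \<in> cball (of_padic y) ?r"
        using xy P1_dist_ultra[of "of_padic x" z "of_padic y"] P1_dist_ultra[of "of_padic y" z "of_padic x"]
        by (auto simp: dist_commute)
    qed
    thus "B \<in> (\<lambda>B. cball (of_padic (SOME x. x \<in> B)) ?r) ` F"
      using x(1) unfolding y_def F_def by blast
  qed
  thus "finite ((\<lambda>x. cball x ?r) ` of_padic ` (zball n :: 'p padic set))"
    by (rule finite_subset) (use fin in simp)
next
  show "(\<lambda>k. real CARD('p) powi (- (1 + int k))) \<longlonglongrightarrow> 0"
    by (rule powi_uminus_tendsto_0[OF card_gt_1])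
  show "decseq (\<lambda>k. real CARD('p) powi (- (1 + int k)))"
    using powi_le_iff[OF card_gt_1[where 'p = 'p]] by (simp add: decseq_def del: minus_add_distrib)
  show "0 \<le> real CARD('p) powi (- (1 + int k))" for k by simp
  show "dist x z \<le> max (dist x y) (dist y z)" for x y z :: "'p padic_P1" by (rule P1_dist_ultra)
qed

section \<open>The logarithmic kernel as a count of levels\<close>

lemma suminf_const_ennreal:
  fixes c :: ennreal
  assumes "c \<noteq> 0"
  shows "(\<Sum>k. c) = \<infinity>"
proof -
  have "(\<Sum>k. c) = (\<integral>\<^sup>+ (k :: nat). c \<partial>count_space UNIV)" by (rule nn_integral_count_space_nat[symmetric])
  also have "\<dots> = c * \<infinity>" by (subst nn_integral_const) simp
  finally show ?thesis using assms by (simp add: ennreal_mult_top)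
qed

lemma neg_log_dist_of_padic:
  fixes x y :: "'p :: prime_card padic"
  shows "neg_log_dist (of_padic x) (of_padic y) = (\<Sum>k. ennreal (ln (real CARD('p)))
      * indicator (cball (of_padic x) (real CARD('p) powi (- (1 + int k)))) (of_padic y))"
proof -
  let ?p = "real CARD('p)"
  let ?d = "dist (of_padic x) (of_padic y)"
  have lnp: "ln ?p > 0" using card_gt_1[where 'p = 'p] by simp
  show ?thesis
  proof (cases "?d = 0")
    case True
    \<comment> \<open>On the diagonal every level counts, which matches the value \<infinity> of the
      kernel there.\<close>
    thus ?thesis using lnp
      by (simp add: neg_log_dist_def dist_padic_P1_def suminf_const_ennreal ennreal_eq_0_iff del: ennreal_eq_0_iff)
  next
    case False
    hence "x \<noteq> y" by auto
    then obtain i where i: "padic_abs (x - y) = ?p powi i" using padic_abs_eq_powi[of "x - y"] by auto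
    \<comment> \<open>The normalising factors are powers of p as well, so \<delta> is an integral
      power of p; its exponent is \<open>- int m\<close> with \<open>m\<close> natural because
      \<delta> is at most 1.\<close>
    have max1: "\<exists>j. max 1 (padic_abs z) = ?p powi j" for z :: "'p padic"
    proof (cases "z = 0")
      case False
      then obtain j where "padic_abs z = ?p powi j" by (rule padic_abs_eq_powi)
      thus ?thesis by (cases "padic_abs z \<le> 1") (auto intro: exI[of _ 0] exI[of _ j] simp: max_def)
    qed (auto intro: exI[of _ 0])
    obtain j1 j2 where "max 1 (padic_abs x) = ?p powi j1" "max 1 (padic_abs y) = ?p powi j2"
      using max1 by metis
    hence d: "?d = ?p powi (i - (j1 + j2))"
      using card_gt_1[where 'p = 'p] by (simp add: dist_of_padic i power_int_diff power_int_add)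
    moreover have "?d \<le> 1" unfolding dist_padic_P1_def by (rule spherical_dist_le_1)
    ultimately have "i - (j1 + j2) \<le> 0" using powi_le_iff[OF card_gt_1[where 'p = 'p], of "i - (j1 + j2)" 0] by simp
    then obtain m :: nat where m: "i - (j1 + j2) = - int m" by (metis neg_le_0_iff_le nonneg_int_cases minus_minus)
    have d': "?d = ?p powi (- int m)" using d m by simp
    have ind: "indicator (cball (of_padic x) (?p powi (- (1 + int k)))) (of_padic y) = (if k < m then 1 else 0 :: ennreal)" for k
      unfolding indicator_def mem_cball d' powi_le_iff[OF card_gt_1] by auto
    have "(\<Sum>k. ennreal (ln ?p) * indicator (cball (of_padic x) (?p powi (- (1 + int k)))) (of_padic y))
        = (\<Sum>k<m. ennreal (ln ?p))"
      unfolding ind by (subst suminf_finite[of "{..<m}"]) auto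
    also have "\<dots> = ennreal (real m * ln ?p)" using lnp by (simp add: ennreal_mult ennreal_of_nat_eq_real_of_nat)
    also have "real m * ln ?p = - ln ?d"
      using card_gt_1[where 'p = 'p] unfolding d' by (simp add: power_int_minus ln_inverse ln_realpow)
    also have "ennreal \<dots> = neg_log_dist (of_padic x) (of_padic y)"
      using False by (simp add: neg_log_dist_def dist_padic_P1_def)
    finally show ?thesis by simp
  qed
qed

text \<open>The level formula for the kernel needs both points in the field, hence the carrier
  condition. The inner integral is the potential of \<nu>, and the outer one gives its mutual energy
  with itself.\<close>

lemma energy_eq:
  fixes \<nu> :: "'p :: prime_card padic_P1 measure"
  assumes \<nu>: "\<nu> \<in> borel_probs_on (of_padic ` zball n)"
  shows "energy \<nu> = ennreal (ln (real CARD('p))) *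
    ultrametric_blocks.block_energy (of_padic ` zball n) (\<lambda>k. real CARD('p) powi (- (1 + int k))) \<nu>"
proof -
  let ?c = "ennreal (ln (real CARD('p)))" and ?r = "\<lambda>k. real CARD('p) powi (- (1 + int k))"
  interpret ultrametric_blocks "of_padic ` (zball n :: 'p padic set)" ?r by (rule P1_blocks)
  have s: "sets \<nu> = sets borel" and AE: "AE x in \<nu>. x \<in> of_padic ` zball n"
    using \<nu> by (auto simp: borel_probs_on_def)
  have inner: "(\<integral>\<^sup>+ y. neg_log_dist x y \<partial>\<nu>) = ?c * (\<Sum>k. emeasure \<nu> (cball x (?r k)))"
    if x: "x \<in> of_padic ` zball n" for x
  proof -
    have "(\<integral>\<^sup>+ y. neg_log_dist x y \<partial>\<nu>) = (\<integral>\<^sup>+ y. (\<Sum>k. ?c * indicator (cball x (?r k)) y) \<partial>\<nu>)"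
      by (rule nn_integral_cong_AE) (use AE x in \<open>auto elim!: eventually_mono simp: neg_log_dist_of_padic\<close>)
    also have "\<dots> = (\<Sum>k. \<integral>\<^sup>+ y. ?c * indicator (cball x (?r k)) y \<partial>\<nu>)"
    proof (rule nn_integral_suminf)
      show "(\<lambda>y. ?c * indicator (cball x (?r k)) y) \<in> borel_measurable \<nu>" for k
      proof -
        have [measurable]: "cball x (?r k) \<in> sets borel" by simp
        show ?thesis using s[measurable_cong] by measurable
      qed
    qed
    also have "\<dots> = (\<Sum>k. ?c * emeasure \<nu> (cball x (?r k)))"
      by (intro suminf_cong nn_integral_cmult_indicator) (use s in auto)
    finally show ?thesis by simp
  qed
  have "energy \<nu> = (\<integral>\<^sup>+ x. ?c * (\<Sum>k. emeasure \<nu> (cball x (?r k))) \<partial>\<nu>)"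
    unfolding energy_def by (rule nn_integral_cong_AE) (use AE inner in \<open>auto elim!: eventually_mono\<close>)
  also have "\<dots> = ?c * block_energy \<nu>"
    unfolding block_energy_def by (rule nn_integral_suminf_emeasure_cball[OF \<nu>])
  finally show ?thesis .
qed

text \<open>Minimality of \<mu> and the uniqueness demanded by the definite description are both
  read off from the nonnegative discrepancy, scaled by \<open>ln p\<close>.\<close>

lemma equilibrium_of_constant_potential:
  fixes \<mu> :: "'p :: prime_card padic_P1 measure" and W :: real
  assumes \<mu>: "\<mu> \<in> borel_probs_on (of_padic ` zball n)" and W: "W \<ge> 0"
    and pot: "\<And>x. x \<in> zball n \<Longrightarrow> (\<Sum>k. emeasure \<mu> (cball (of_padic x) (real CARD('p) powi (- (1 + int k))))) = ennreal W"
  shows "robin_constant (of_padic ` zball n :: 'p padic_P1 set) = ennreal (W * ln (real CARD('p)))"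
    and "equilibrium_measure (of_padic ` zball n :: 'p padic_P1 set) = \<mu>"
proof -
  let ?E = "of_padic ` zball n :: 'p padic_P1 set" and ?c = "ennreal (ln (real CARD('p)))"
  interpret ultrametric_blocks ?E "\<lambda>k. real CARD('p) powi (- (1 + int k))" by (rule P1_blocks)
  have c: "?c \<noteq> 0" "?c \<noteq> \<infinity>" using card_gt_1[where 'p = 'p] by (simp_all add: ennreal_eq_0_iff)
  have en: "energy \<nu> = ?c * (ennreal W + block_discrepancy \<mu> \<nu>)" if \<nu>: "\<nu> \<in> borel_probs_on ?E" for \<nu>
    unfolding energy_eq[OF \<nu>] using pot by (subst block_energy_eq[OF \<mu> \<nu>, of "ennreal W"]) auto
  have robin: "robin_constant ?E = ?c * ennreal W"
    unfolding robin_constant_def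
  proof (rule antisym)
    show "(INF \<nu>\<in>borel_probs_on ?E. energy \<nu>) \<le> ?c * ennreal W"
      using INF_lower[OF \<mu>, of energy] by (simp only: en[OF \<mu>] block_discrepancy_self add_0_right)
    show "?c * ennreal W \<le> (INF \<nu>\<in>borel_probs_on ?E. energy \<nu>)"
    proof (rule INF_greatest)
      fix \<nu> assume "\<nu> \<in> borel_probs_on ?E"
      thus "?c * ennreal W \<le> energy \<nu>" by (simp only: en) (intro mult_left_mono, auto)
    qed
  qed
  thus "robin_constant ?E = ennreal (W * ln (real CARD('p)))"
    using W card_gt_1[where 'p = 'p] by (simp add: ennreal_mult mult.commute)
  show "equilibrium_measure ?E = \<mu>"
    unfolding equilibrium_measure_def
  proof (rule the_equality)
    show "\<mu> \<in> borel_probs_on ?E \<and> energy \<mu> = robin_constant ?E"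
      using \<mu> by (simp only: robin en block_discrepancy_self add_0_right simp_thms)
    fix \<nu> assume \<nu>: "\<nu> \<in> borel_probs_on ?E \<and> energy \<nu> = robin_constant ?E"
    hence "?c * (ennreal W + block_discrepancy \<mu> \<nu>) = ?c * (ennreal W + 0)"
      using en[of \<nu>] by (simp only: robin add_0_right)
    hence "ennreal W + block_discrepancy \<mu> \<nu> = ennreal W + 0"
      using c by (simp only: ennreal_mult_cancel_left) auto
    hence "block_discrepancy \<mu> \<nu> = 0" by (simp add: ennreal_add_left_cancel)
    thus "\<nu> = \<mu>" using block_discrepancy_eq_0[OF \<mu>] \<nu> by blast
  qed
qed

section \<open>Potentials\<close>

lemma on_P1_probs:
  assumes \<mu>: "\<mu> \<in> borel_probs_on (zball n :: 'p :: prime_card padic set)"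
  shows "on_P1 \<mu> \<in> borel_probs_on (of_padic ` zball n)"
proof -
  have s: "sets \<mu> = sets borel" and AE: "AE x in \<mu>. x \<in> zball n" and prob: "prob_space \<mu>"
    using \<mu> by (auto simp: borel_probs_on_def)
  have m: "of_padic \<in> measurable \<mu> borel" using of_padic_borel by (subst measurable_cong_sets[OF s refl])
  have "AE x in on_P1 \<mu>. x \<in> of_padic ` zball n"
    unfolding on_P1_def
    by (subst AE_distr_iff[OF m]) (use AE of_padic_zball_borel in \<open>auto elim!: eventually_mono\<close>)
  moreover have "prob_space (on_P1 \<mu>)" unfolding on_P1_def by (rule prob_space.prob_space_distr[OF prob m])
  moreover have "sets (on_P1 \<mu>) = sets borel" by (simp add: on_P1_def)
  ultimately show ?thesis by (simp add: borel_probs_on_def)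
qed

lemma emeasure_on_P1:
  assumes "sets \<mu> = sets (borel :: 'p :: prime_card padic measure)" "A \<in> sets borel"
  shows "emeasure (on_P1 \<mu>) A = emeasure \<mu> (of_padic -` A)"
proof -
  have m: "of_padic \<in> measurable \<mu> borel"
    using of_padic_borel by (subst measurable_cong_sets[OF assms(1) refl])
  show ?thesis
    unfolding on_P1_def using assms(2) sets_eq_imp_space_eq[OF assms(1)] by (simp add: emeasure_distr[OF m])
qed

lemma vimage_of_padic_borel: "A \<in> sets borel \<Longrightarrow> of_padic -` A \<in> sets (borel :: 'p :: prime_card padic measure)"
  using measurable_sets[OF of_padic_borel] by simp

lemma emeasure_probs_on_cong:
  assumes "\<mu> \<in> borel_probs_on S" "D \<in> sets borel" "D' \<in> sets borel" "D \<inter> S = D' \<inter> S"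
  shows "emeasure \<mu> D = emeasure \<mu> D'"
  by (rule emeasure_eq_AE) (use assms in \<open>auto simp: borel_probs_on_def elim!: eventually_mono\<close>)

lemma emeasure_probs_on_eq_1:
  assumes "\<mu> \<in> borel_probs_on S" "D \<in> sets borel" "S \<subseteq> D"
  shows "emeasure \<mu> D = 1"
proof -
  have "emeasure \<mu> D = emeasure \<mu> UNIV"
    by (rule emeasure_probs_on_cong[OF assms(1)]) (use assms in auto)
  moreover have "space \<mu> = UNIV" using assms(1) sets_eq_imp_space_eq by (force simp: borel_probs_on_def)
  moreover have "prob_space \<mu>" using assms(1) by (simp add: borel_probs_on_def)
  ultimately show ?thesis using prob_space.emeasure_space_1 by metis
qed

lemma emeasure_probs_on_eq_0:
  assumes "\<mu> \<in> borel_probs_on S" "D \<in> sets borel" "S \<inter> D = {}"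
  shows "emeasure \<mu> D = 0"
  using emeasure_probs_on_cong[OF assms(1,2), of "{}"] assms(3) by (simp add: Int_commute)

text \<open>The shape of potentials: finitely many coarse levels, followed by levels at which the
  mass of the ball shrinks by a constant factor.\<close>

lemma sums_head_geometric:
  fixes q :: real
  assumes "0 \<le> q" "q < 1"
  shows "(\<lambda>k. if k < j then a k else b * q ^ (k - j)) sums ((\<Sum>k<j. a k) + b / (1 - q))"
proof -
  have "(\<lambda>k. b * q ^ k) sums (b * (1 / (1 - q)))"
    using assms by (intro sums_mult geometric_sums) auto
  hence "(\<lambda>k. (if k + j < j then a (k + j) else b * q ^ (k + j - j))) sums (b / (1 - q))" by simp
  hence "(\<lambda>k. if k < j then a k else b * q ^ (k - j)) sums
      (b / (1 - q) + (\<Sum>k<j. if k < j then a k else b * q ^ (k - j)))"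
    by (subst (asm) sums_iff_shift)
  thus ?thesis by (simp add: add.commute)
qed

text \<open>Spherical balls pulled back to the field, so that their masses can be found from p-adic
  balls and spheres.\<close>

definition level :: "int \<Rightarrow> 'p :: prime_card padic \<Rightarrow> 'p padic set" where
  "level m x = of_padic -` cball (of_padic x) (real CARD('p) powi (- m))"

lemma mem_level: "y \<in> level m (x :: 'p :: prime_card padic) \<longleftrightarrow> dist (of_padic x) (of_padic y) \<le> real CARD('p) powi (- m)"
  by (simp add: level_def)

lemma level_borel [simp]: "level m x \<in> sets borel"
  unfolding level_def by (rule vimage_of_padic_borel) simp

lemma dist_of_padic_ints:
  "padic_abs x \<le> 1 \<Longrightarrow> padic_abs y \<le> 1 \<Longrightarrow> dist (of_padic x) (of_padic y) = padic_abs (x - y)"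
  by (simp add: dist_of_padic max_def)

lemma level_Int_zball_0:
  assumes "x \<in> zball 0"
  shows "level m x \<inter> zball 0 = pball m x \<inter> zball 0"
  using assms by (auto simp: mem_level mem_zball mem_pball dist_of_padic_ints)

lemma dist_of_padic_less:
  assumes "padic_abs x < padic_abs y" "1 \<le> padic_abs y"
  shows "dist (of_padic x) (of_padic y) = 1 / max 1 (padic_abs x)"
proof -
  have "padic_abs (y - x) = padic_abs y" by (rule padic_abs_eq_of_close) (use assms in simp)
  hence "padic_abs (x - y) = padic_abs y" by (simp add: padic_abs_diff_commute)
  moreover have "y \<noteq> 0" using assms by auto
  ultimately show ?thesis using assms by (simp add: dist_of_padic max_def)
qed

lemma dist_of_padic_same:
  assumes "padic_abs x = padic_abs y" "1 \<le> padic_abs y"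
  shows "dist (of_padic x) (of_padic y) = padic_abs (x - y) / (padic_abs x * padic_abs x)"
  using assms by (simp add: dist_of_padic max_def)

lemma haar_level:
  fixes x :: "'p :: prime_card padic"
  assumes "0 \<le> n" "x \<in> zball n"
  shows "emeasure (haar n) (level m x) = ennreal (if m \<le> n then 1 else real CARD('p) powi (n - m))"
proof -
  have sub: "zball n \<subseteq> (zball 0 :: 'p padic set)" using assms(1) by (rule zball_mono)
  hence "level m x \<inter> zball n = pball m x \<inter> zball n" using level_Int_zball_0[of x m] assms by blast
  hence eq: "emeasure (haar n) (level m x) = emeasure (haar n) (pball m x)"
    by (intro emeasure_probs_on_cong[OF haar_probs]) auto
  show ?thesis
  proof (cases "m \<le> n")
    case True
    have "zball n = pball n x" using assms(2) pball_eqI[of x n 0] by (simp add: zball_def)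
    hence "zball n \<subseteq> pball m x" using pball_mono[OF True, of x] by simp
    thus ?thesis using True eq emeasure_probs_on_eq_1[OF haar_probs, of "pball m x" n] by simp
  next
    case False
    thus ?thesis using eq haar_pball[OF assms(2), of m] by simp
  qed
qed

lemma powi_level_geometric:
  fixes b :: real
  assumes "b > 0" "j \<le> k"
  shows "b powi (int j - (1 + int k)) = inverse b * inverse b ^ (k - j)"
proof -
  have "int j - (1 + int k) = - int (Suc (k - j))" using assms by simp
  hence "b powi (int j - (1 + int k)) = b powi (- int (Suc (k - j)))" by (simp only:)
  also have "\<dots> = inverse b ^ Suc (k - j)" by (simp only: power_int_minus power_int_of_nat power_inverse)
  finally show ?thesis by simp
qed

text \<open>The levels 1, ..., n contain the whole group and contribute 1 each; level n + i
  contributes p^(-i), and these sum to 1/(p-1).\<close>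

lemma haar_potential:
  fixes x :: "'p :: prime_card padic"
  assumes "0 \<le> n" "x \<in> zball n"
  shows "(\<Sum>k. emeasure (haar n) (level (1 + int k) x)) = ennreal (of_int n + 1 / (real CARD('p) - 1))"
proof (unfold haar_level[OF assms], rule suminf_ennreal_eq)
  let ?p = "real CARD('p)"
  have p: "?p > 1" by (rule card_gt_1)
  obtain N where N: "n = int N" using assms(1) nonneg_int_cases by blast
  have "(\<lambda>k. if k < N then 1 else inverse ?p * inverse ?p ^ (k - N)) sums ((\<Sum>k<N. 1) + inverse ?p / (1 - inverse ?p))"
    using p by (intro sums_head_geometric) (auto simp: field_simps)
  moreover have "(if 1 + int k \<le> n then 1 else ?p powi (n - (1 + int k)))
      = (if k < N then 1 else inverse ?p * inverse ?p ^ (k - N))" for k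
    using powi_level_geometric[of ?p N k] p unfolding N by auto
  moreover have "(\<Sum>k<N. 1) + inverse ?p / (1 - inverse ?p) = of_int n + 1 / (?p - 1)"
    using p by (simp add: N field_simps)
  ultimately show "(\<lambda>k. if 1 + int k \<le> n then 1 else ?p powi (n - (1 + int k))) sums (of_int n + 1 / (?p - 1))"
    by simp
qed simp

text \<open>All p-adic integers form one shell: on them the spherical metric is the p-adic one, and
  every point of larger absolute value is at distance 1 from each of them. The other shells have
  negative index and radius p^(-i).\<close>

definition shell :: "int \<Rightarrow> 'p :: prime_card padic set" where
  "shell i = (if i = 0 then zball 0 else psphere i)"

lemma shell_borel [simp]: "shell i \<in> sets borel"
  by (simp add: shell_def)

lemma max_1_shell:
  assumes "(y :: 'p :: prime_card padic) \<in> shell i" "i \<le> 0"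
  shows "max 1 (padic_abs y) = real CARD('p) powi (- i)"
proof (cases "i = 0")
  case False
  have "1 \<le> real CARD('p) powi (- i)" using powi_le_iff[OF card_gt_1[where 'p = 'p], of 0 "- i"] assms by simp
  thus ?thesis using assms False by (simp add: shell_def psphere_def)
qed (use assms in \<open>simp add: shell_def mem_zball\<close>)

text \<open>Here |x - y| = |x| cancels against the normalisation of the outer point
  \<open>x\<close>, so only the inner radius enters: from any point, every other shell is seen at a
  constant distance.\<close>

lemma dist_shells:
  fixes x y :: "'p :: prime_card padic"
  assumes "x \<in> shell j" "y \<in> shell i" "j < i" "i \<le> 0"
  shows "dist (of_padic x) (of_padic y) = real CARD('p) powi i"
proof -
  have x: "padic_abs x = real CARD('p) powi (- j)" using assms by (simp add: shell_def psphere_def)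
  have y: "max 1 (padic_abs y) = real CARD('p) powi (- i)" using assms by (intro max_1_shell)
  have "real CARD('p) powi (- i) < padic_abs x" unfolding x powi_less_iff[OF card_gt_1] using assms by simp
  hence "padic_abs y < padic_abs x" "1 \<le> padic_abs x" using y by linarith+
  hence "dist (of_padic y) (of_padic x) = 1 / real CARD('p) powi (- i)" using dist_of_padic_less[of y x] y by simp
  thus ?thesis by (simp add: dist_commute power_int_minus field_simps)
qed

lemma shell_probs:
  assumes "n \<le> i" "i \<le> 0"
  shows "uniform_measure (haar n) (shell i) \<in> borel_probs_on (shell i :: 'p :: prime_card padic set)"
proof (rule uniform_measure_probs)
  show "emeasure (haar n) (shell i :: 'p padic set) \<noteq> 0"
  proof (cases "i = 0")
    case False
    have "real CARD('p) powi (n - i) * (1 - 1 / real CARD('p)) > 0"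
      using card_gt_1[where 'p = 'p] by (intro mult_pos_pos) auto
    thus ?thesis unfolding shell_def emeasure_haar_psphere[OF assms(1)]
      using False by (simp add: emeasure_haar_psphere[OF assms(1)] ennreal_eq_0_iff not_le)
  next
    case True
    thus ?thesis using assms card_gt_1[where 'p = 'p]
      by (simp add: shell_def emeasure_haar_zball ennreal_eq_0_iff not_le)
  qed
qed simp

text \<open>The spheres outside the integers are at distance 1 from \<open>x\<close>, out of reach
  of every level \<open>m \<ge> 1\<close>.\<close>

lemma shell_level_zball:
  fixes x :: "'p :: prime_card padic"
  assumes "x \<in> zball 0" "1 \<le> m" "n \<le> i" "i \<le> 0"
  shows "emeasure (uniform_measure (haar n) (shell i)) (level m x) = (if i = 0 then ennreal (real CARD('p) powi (- m)) else 0)"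
proof (cases "i = 0")
  case True
  have "uniform_measure (haar n) (shell i) = (haar 0 :: 'p padic measure)"
    using True assms haar_eq_uniform_measure[of n 0, where 'p = 'p] by (simp add: shell_def)
  thus ?thesis using True haar_level[of 0 x m] assms by simp
next
  case False
  have "shell i \<inter> level m x = {}"
  proof -
    have "y \<notin> level m x" if y: "y \<in> shell i" for y
    proof -
      have "dist (of_padic x) (of_padic y) = 1"
        using dist_shells[of y i x 0] y assms False by (simp add: shell_def dist_commute)
      moreover have "real CARD('p) powi (- m) < 1"
        using powi_less_iff[OF card_gt_1[where 'p = 'p], of "- m" 0] assms by simp
      ultimately show ?thesis by (simp add: mem_level)
    qed
    thus ?thesis by blast
  qed
  thus ?thesis using False emeasure_probs_on_eq_0[OF shell_probs[OF assms(3,4)], of "level m x"] by simp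
qed

text \<open>On the sphere of radius p^(-j) the spherical metric is the p-adic one divided by
  p^(-2j), so level \<open>m\<close> meets it in the p-adic ball of index \<open>m + 2 * j\<close>.
  Up to \<open>m = - j\<close> the level swallows this sphere together with all shells of radius at
  least p^m; beyond that it meets no other shell.\<close>

lemma shell_level_psphere:
  fixes x :: "'p :: prime_card padic"
  assumes "x \<in> psphere j" "n \<le> j" "j < 0" "1 \<le> m" "n \<le> i" "i \<le> 0"
  shows "emeasure (uniform_measure (haar n) (shell i)) (level m x) = ennreal
    (if m \<le> - j then (if i \<le> - m then 1 else 0)
     else if i = j then real CARD('p) powi (- m - j) / (1 - 1 / real CARD('p)) else 0)"
proof -
  let ?p = "real CARD('p)" and ?U = "uniform_measure (haar n) (shell i :: 'p padic set)"
  note probs = shell_probs[OF assms(5,6), where 'p = 'p]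
  have x: "x \<in> shell j" using assms by (simp add: shell_def)
  show ?thesis
  proof (cases "i = j")
    case False
    have mem: "y \<in> level m x \<longleftrightarrow> max i j \<le> - m" if "y \<in> shell i" for y
    proof (cases "i < j")
      case True
      hence "dist (of_padic x) (of_padic y) = ?p powi j" using dist_shells[of y i x j] that x assms by (simp add: dist_commute)
      thus ?thesis using True unfolding mem_level by (simp only: powi_le_iff[OF card_gt_1]) linarith
    next
      case f: False
      hence "dist (of_padic x) (of_padic y) = ?p powi i" using dist_shells[of x j y i] that x assms False by simp
      thus ?thesis using f unfolding mem_level by (simp only: powi_le_iff[OF card_gt_1]) linarith
    qed
    show ?thesis
    proof (cases "max i j \<le> - m")
      case True
      hence "shell i \<subseteq> level m x" using mem by blast
      thus ?thesis using True False emeasure_probs_on_eq_1[OF probs, of "level m x"] by auto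
    next
      case f: False
      hence "shell i \<inter> level m x = {}" using mem by blast
      thus ?thesis using f False emeasure_probs_on_eq_0[OF probs, of "level m x"] by auto
    qed
  next
    case True
    have S: "shell i = psphere j" using True assms by (simp add: shell_def)
    have mem: "y \<in> level m x \<longleftrightarrow> y \<in> pball (m + 2 * j) x" if "y \<in> psphere j" for y
    proof -
      have xy: "padic_abs x = ?p powi (- j)" "padic_abs y = ?p powi (- j)"
        using assms that by (simp_all add: psphere_def)
      have "1 \<le> ?p powi (- j)" using powi_le_iff[OF card_gt_1[where 'p = 'p], of 0 "- j"] assms by simp
      hence "dist (of_padic x) (of_padic y) = padic_abs (x - y) / (?p powi (- j) * ?p powi (- j))"
        using xy dist_of_padic_same[of x y] by simp
      moreover have "?p powi (- (m + 2 * j)) = ?p powi (- m) * (?p powi (- j) * ?p powi (- j))"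
        using card_gt_1[where 'p = 'p] by (simp flip: power_int_add)
      moreover have "?p powi (- j) * ?p powi (- j) > 0" using card_gt_1[where 'p = 'p] by simp
      ultimately show ?thesis by (simp only: mem_level mem_pball pos_divide_le_eq)
    qed
    show ?thesis
    proof (cases "m \<le> - j")
      case m: True
      have "psphere j \<subseteq> pball (m + 2 * j) x"
      proof
        fix y :: "'p padic" assume "y \<in> psphere j"
        hence "padic_abs (x - y) \<le> ?p powi (- j)"
          using padic_abs_diff[of x y] assms by (simp add: psphere_def)
        also have "\<dots> \<le> ?p powi (- (m + 2 * j))" unfolding powi_le_iff[OF card_gt_1] using m by simp
        finally show "y \<in> pball (m + 2 * j) x" by (simp only: mem_pball)
      qed
      hence "shell i \<subseteq> level m x" using mem S by blast
      thus ?thesis using True m assms emeasure_probs_on_eq_1[OF probs, of "level m x"] by auto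
    next
      case m: False
      have sub: "psphere j \<subseteq> (zball n :: 'p padic set)"
        using psphere_subset[of j] zball_mono[OF assms(2)] by blast
      have "emeasure ?U (level m x) = emeasure ?U (pball (m + 2 * j) x)"
        by (rule emeasure_probs_on_cong[OF probs]) (use mem S in auto)
      also have "\<dots> = ennreal (?p powi (n - (m + 2 * j))) / emeasure (haar n) (psphere j :: 'p padic set)"
        unfolding S using assms m sub by (intro uniform_measure_pball pball_subset_psphere) auto
      also have "\<dots> = ennreal (?p powi (n - (m + 2 * j)) / (?p powi (n - j) * (1 - 1 / ?p)))"
        unfolding emeasure_haar_psphere[OF assms(2)]
        using card_gt_1[where 'p = 'p] by (intro divide_ennreal) (auto intro!: mult_pos_pos)
      also have "?p powi (n - (m + 2 * j)) = ?p powi (n - j) * ?p powi (- m - j)"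
        using card_gt_1[where 'p = 'p] by (simp flip: power_int_add add: diff_diff_eq add.commute)
      also have "?p powi (n - j) * ?p powi (- m - j) / (?p powi (n - j) * (1 - 1 / ?p)) = ?p powi (- m - j) / (1 - 1 / ?p)"
        using card_gt_1[where 'p = 'p] by simp
      finally show ?thesis using True m by simp
    qed
  qed
qed

text \<open>
  The solution of the recurrence, with \<open>i = - j\<close>, normalised to total mass 1.
\<close>

definition shell_weight :: "real \<Rightarrow> int \<Rightarrow> int \<Rightarrow> real" where
  "shell_weight b n i = (if i = 0 then (b + b powi (2 * n)) / (b + 1)
     else (b - 1) / (b * (b + 1)) * (b powi (2 * n - i) + b powi (1 + i)))"

lemma shell_weight_nonneg: "b > 1 \<Longrightarrow> shell_weight b n i \<ge> 0"
  by (simp add: shell_weight_def)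

text \<open>For \<open>h = - m\<close> this is the mass of the spheres of radius at least p^m. At
  \<open>h = n - 1\<close> both exponents equal \<open>n\<close> and the value is 0, which is the
  outer boundary condition; each weight is a difference of consecutive values.\<close>

lemma sum_shell_weight:
  assumes b: "b > 1" and "n - 1 \<le> h" "h \<le> - 1"
  shows "(\<Sum>i = n..h. shell_weight b n i) = (b powi (1 + h) - b powi (2 * n - 1 - h)) / (b + 1)"
  using assms(2,3)
proof (induction h rule: int_ge_induct)
  case (step h)
  define X Y where "X = b powi h" and "Y = b powi (2 * n - h)"
  have X: "b powi (1 + h) = b * X" "b powi (2 + h) = b\<^sup>2 * X"
    using b by (simp_all add: X_def power_int_add)
  have "b powi (2 * n - h - 1) = Y / b" "b powi (2 * n - h - 2) = Y / b\<^sup>2"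
    using b by (simp_all add: Y_def power_int_diff power2_eq_square)
  hence Y: "b powi (2 * n - 1 - h) = Y / b" "b powi (2 * n - 2 - h) = Y / b\<^sup>2"
    by (simp_all add: algebra_simps)
  have "{n..h + 1} = insert (h + 1) {n..h}" using step.hyps by auto
  hence "(\<Sum>i = n..h + 1. shell_weight b n i) = shell_weight b n (h + 1) + (b * X - Y / b) / (b + 1)"
    using step X Y by simp
  also have "shell_weight b n (h + 1) = (b - 1) / (b * (b + 1)) * (Y / b + b\<^sup>2 * X)"
    using step.prems X Y by (simp add: shell_weight_def algebra_simps)
  also have "(b - 1) / (b * (b + 1)) * (Y / b + b\<^sup>2 * X) + (b * X - Y / b) / (b + 1) = (b\<^sup>2 * X - Y / b\<^sup>2) / (b + 1)"
    using b by (simp add: divide_simps) (simp add: algebra_simps power2_eq_square)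
  also have "\<dots> = (b powi (1 + (h + 1)) - b powi (2 * n - 1 - (h + 1))) / (b + 1)"
    using X Y by (simp add: algebra_simps)
  finally show ?case .
qed simp

text \<open>The summand is the mass of the spheres swallowed at level \<open>1 + k\<close>, so this
  is the contribution of the first \<open>J\<close> levels to the potential at a point of radius
  p^J: two geometric progressions combined over the denominator
  \<open>b\<^sup>2 - 1\<close>.\<close>

lemma sum_level_weight:
  assumes b: "b > (1 :: real)"
  shows "(\<Sum>k<J. (b powi (- int k) - b powi (int k + 2 * n)) / (b + 1))
    = (b - b powi (1 - int J) - b powi (2 * n + int J) + b powi (2 * n)) / (b\<^sup>2 - 1)"
proof (induction J)
  case (Suc J)
  define X Y where "X = b powi (- int J)" and "Y = b powi (2 * n + int J)"
  have "b powi (1 - int J) = b * X" "b powi (1 - int (Suc J)) = X" "b powi (int J + 2 * n) = Y"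
    "b powi (2 * n + int (Suc J)) = b * Y"
    using b by (simp_all add: X_def Y_def power_int_add power_int_diff power_int_minus field_simps)
  moreover have "b\<^sup>2 - 1 = (b - 1) * (b + 1)" by (simp add: power2_eq_square algebra_simps)
  ultimately show ?case using b Suc
    by (simp add: X_def[symmetric]) (simp add: divide_simps, simp add: algebra_simps)
qed simp

section \<open>The equilibrium measure for negative exponent\<close>

definition shell_mixture :: "int \<Rightarrow> 'p :: prime_card padic measure" where
  "shell_mixture n = density (haar n) (\<lambda>x. \<Sum>i\<in>{n..0}. ennreal (shell_weight (real CARD('p)) n i)
     / emeasure (haar n) (shell i :: 'p padic set) * indicator (shell i) x)"

lemma emeasure_shell_mixture:
  fixes A :: "'p :: prime_card padic set"
  assumes "A \<in> sets borel"
  shows "emeasure (shell_mixture n) A = (\<Sum>i\<in>{n..0}. ennreal (shell_weight (real CARD('p)) n i)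
      * emeasure (uniform_measure (haar n) (shell i)) A)"
  unfolding shell_mixture_def using assms by (intro emeasure_density_mixture) auto

lemma sets_shell_mixture [simp]: "sets (shell_mixture n) = sets borel"
  by (simp add: shell_mixture_def)

lemma shell_mixture_probs:
  assumes "n < 0"
  shows "shell_mixture n \<in> borel_probs_on (zball n :: 'p :: prime_card padic set)"
proof -
  let ?p = "real CARD('p)" and ?w = "shell_weight (real CARD('p)) n"
  have p: "?p > 1" by (rule card_gt_1)
  have "emeasure (shell_mixture n) (UNIV :: 'p padic set)
      = (\<Sum>i\<in>{n..0}. ennreal (?w i) * emeasure (uniform_measure (haar n) (shell i)) (UNIV :: 'p padic set))"
    by (rule emeasure_shell_mixture) simp
  also have "\<dots> = (\<Sum>i\<in>{n..0}. ennreal (?w i))"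
    by (intro sum.cong refl) (simp add: emeasure_probs_on_eq_1[OF shell_probs] del: emeasure_uniform_measure)
  also have "\<dots> = ennreal (\<Sum>i\<in>{n..0}. ?w i)"
    using shell_weight_nonneg[OF p] by (intro sum_ennreal)
  \<comment> \<open>The integers are split off because their weight does not follow the formula for
    spheres: the spheres carry (1 - p^(2n))/(p+1), and the integers get the remaining mass.\<close>
  also have "{n..0} = insert 0 {n..-1}" using assms by auto
  also have "(\<Sum>i\<in>insert 0 {n..-1}. ?w i) = ?w 0 + (\<Sum>i = n..-1. ?w i)" by simp
  also have "(\<Sum>i = n..-1. ?w i) = (1 - ?p powi (2 * n)) / (?p + 1)"
    using sum_shell_weight[OF p, of n "-1"] assms by simp
  also have "?w 0 + \<dots> = 1" using p by (simp add: shell_weight_def field_simps)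
  finally have "prob_space (shell_mixture n :: 'p padic measure)"
    by (intro prob_spaceI) (simp add: shell_mixture_def)
  moreover have "AE x in shell_mixture n. x \<in> (zball n :: 'p padic set)"
  proof -
    have "(\<lambda>x. \<Sum>i\<in>{n..0}. ennreal (?w i) / emeasure (haar n) (shell i :: 'p padic set) * indicator (shell i) x)
        \<in> borel_measurable (haar n)"
      by (intro borel_measurable_sum borel_measurable_times_ennreal borel_measurable_const borel_measurable_indicator) simp
    moreover have "AE x in haar n. x \<in> (zball n :: 'p padic set)"
      using haar_probs[of n, where 'p = 'p] by (simp add: borel_probs_on_def)
    ultimately show ?thesis unfolding shell_mixture_def by (subst AE_density) auto
  qed
  ultimately show ?thesis by (simp add: borel_probs_on_def)
qed

lemma shell_mixture_potential:
  fixes x :: "'p :: prime_card padic"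
  assumes n: "n < 0" and x: "x \<in> zball n"
  shows "(\<Sum>k. emeasure (shell_mixture n) (level (1 + int k) x))
    = ennreal ((real CARD('p) + real CARD('p) powi (2 * n)) / ((real CARD('p))\<^sup>2 - 1))"
proof -
  let ?p = "real CARD('p)" and ?w = "shell_weight (real CARD('p)) n"
  define W where "W = (?p + ?p powi (2 * n)) / (?p\<^sup>2 - 1)"
  have p: "?p > 1" by (rule card_gt_1)
  have w: "?w i \<ge> 0" for i by (rule shell_weight_nonneg[OF p])
  have sq: "?p\<^sup>2 - 1 = (?p - 1) * (?p + 1)" by (simp add: power2_eq_square algebra_simps)
  have q: "0 \<le> inverse ?p" "inverse ?p < 1" using p by (auto simp: field_simps)
  show ?thesis
  proof (cases "x \<in> zball 0")
    case True
    \<comment> \<open>From a p-adic integer only the Haar component on the integers is seen, and its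
      geometric series gives \<open>?w 0 / (p - 1) = W\<close>. Normalising the total mass thus
      fixes the Robin constant.\<close>
    have mass: "emeasure (shell_mixture n) (level (1 + int k) x) = ennreal (?w 0 * ?p powi (- (1 + int k)))" for k
    proof -
      have "emeasure (shell_mixture n) (level (1 + int k) x)
          = (\<Sum>i\<in>{n..0}. if i = 0 then ennreal (?w 0) * ennreal (?p powi (- (1 + int k))) else 0)"
        unfolding emeasure_shell_mixture[OF level_borel]
        by (intro sum.cong refl) (simp add: shell_level_zball[OF True] del: emeasure_uniform_measure minus_add_distrib)
      also have "\<dots> = ennreal (?w 0) * ennreal (?p powi (- (1 + int k)))" using n by simp
      also have "\<dots> = ennreal (?w 0 * ?p powi (- (1 + int k)))"
        by (rule ennreal_mult[symmetric]) (use w in auto)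
      finally show ?thesis .
    qed
    have eq: "?w 0 * ?p powi (- (1 + int k)) = ?w 0 * inverse ?p * inverse ?p ^ k" for k
      using powi_level_geometric[of ?p 0 k] p by simp
    have "(\<lambda>k. ?w 0 * inverse ?p * inverse ?p ^ k) sums (?w 0 * inverse ?p * (1 / (1 - inverse ?p)))"
      using q by (intro sums_mult geometric_sums) auto
    moreover have "?w 0 * inverse ?p * (1 / (1 - inverse ?p)) = W"
    proof -
      have "inverse ?p * (1 / (1 - inverse ?p)) = 1 / (?p - 1)" using p by (simp add: field_simps)
      hence "?w 0 * (inverse ?p * (1 / (1 - inverse ?p))) = ?w 0 * (1 / (?p - 1))" by (rule arg_cong)
      thus ?thesis using p by (simp add: W_def sq shell_weight_def mult.commute)
    qed
    ultimately have sums: "(\<lambda>k. ?w 0 * ?p powi (- (1 + int k))) sums W"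
      unfolding eq by (rule subst[rotated])
    have nonneg: "0 \<le> ?w 0 * ?p powi (- (1 + int k))" for k
      by (rule mult_nonneg_nonneg[OF w]) simp
    show ?thesis unfolding mass W_def[symmetric] by (rule suminf_ennreal_eq[OF nonneg sums])
  next
    case False
    hence "x \<noteq> 0" by (auto simp: mem_zball)
    then obtain i where i: "padic_abs x = ?p powi i" by (rule padic_abs_eq_powi)
    define j where "j = - i"
    have xj: "x \<in> psphere j" using i by (simp add: psphere_def j_def)
    have "i \<le> - n" using x unfolding mem_zball i powi_le_iff[OF card_gt_1] .
    moreover have "\<not> i \<le> 0" using False unfolding mem_zball i powi_le_iff[OF card_gt_1] by simp
    ultimately have j: "n \<le> j" "j < 0" by (auto simp: j_def)
    define J where "J = nat (- j)"
    have J: "int J = - j" "j = - int J" using j by (simp_all add: J_def)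
    \<comment> \<open>The point has radius p^J. \<open>a k\<close> is the mass swallowed at level
      \<open>1 + k\<close> when \<open>k < J\<close>; \<open>b\<close> is the mass of the ball at
      level \<open>J + 1\<close>, the first that stays inside the sphere of
      \<open>x\<close>.\<close>
    define a where "a k = (?p powi (- int k) - ?p powi (int k + 2 * n)) / (?p + 1)" for k
    define b where "b = ?w j / (1 - 1 / ?p) * inverse ?p"
    have mass: "emeasure (shell_mixture n) (level (1 + int k) x) = ennreal (if k < J then a k else b * inverse ?p ^ (k - J))" for k
    proof -
      let ?m = "1 + int k"
      have eq: "emeasure (shell_mixture n) (level ?m x) = (\<Sum>i\<in>{n..0}. ennreal (?w i) * ennreal
          (if ?m \<le> - j then (if i \<le> - ?m then 1 else 0) else if i = j then ?p powi (- ?m - j) / (1 - 1 / ?p) else 0))"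
        unfolding emeasure_shell_mixture[OF level_borel]
        by (intro sum.cong refl, subst shell_level_psphere[OF xj j]) auto
      show ?thesis
      proof (cases "k < J")
        case True
        hence "?m \<le> - j" using J(1) by simp
        hence "emeasure (shell_mixture n) (level ?m x) = (\<Sum>i\<in>{n..0}. if i \<le> - ?m then ennreal (?w i) else 0)"
          unfolding eq by (intro sum.cong) auto
        also have "\<dots> = (\<Sum>i\<in>{n..- ?m}. ennreal (?w i))"
          by (rule sum.mono_neutral_cong_right) auto
        also have "\<dots> = ennreal (\<Sum>i\<in>{n..- ?m}. ?w i)" using w by (intro sum_ennreal)
        also have "(\<Sum>i\<in>{n..- ?m}. ?w i) = (?p powi (1 + - ?m) - ?p powi (2 * n - 1 - - ?m)) / (?p + 1)"
          by (rule sum_shell_weight[OF p]) (use True J(1) j in auto)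
        also have "\<dots> = a k" by (simp add: a_def add.commute)
        finally show ?thesis using True by simp
      next
        case f: False
        hence "\<not> ?m \<le> - j" using J(1) by simp
        hence "emeasure (shell_mixture n) (level ?m x)
            = (\<Sum>i\<in>{n..0}. if i = j then ennreal (?w j) * ennreal (?p powi (- ?m - j) / (1 - 1 / ?p)) else 0)"
          unfolding eq by (intro sum.cong) auto
        also have "\<dots> = ennreal (?w j) * ennreal (?p powi (- ?m - j) / (1 - 1 / ?p))" using j by simp
        also have "\<dots> = ennreal (?w j * (?p powi (- ?m - j) / (1 - 1 / ?p)))"
          using w p by (intro ennreal_mult[symmetric]) auto
        also have "- ?m - j = int J - (1 + int k)" using J(1) by simp
        also have "?p powi (int J - (1 + int k)) = inverse ?p * inverse ?p ^ (k - J)"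
          by (rule powi_level_geometric) (use f p in auto)
        finally show ?thesis using f by (simp add: b_def mult.assoc)
      qed
    qed
    have nonneg: "0 \<le> (if k < J then a k else b * inverse ?p ^ (k - J))" for k
    proof (cases "k < J")
      case True
      \<comment> \<open>Holds because \<open>x\<close> lies in \<open>zball n\<close>: from
        \<open>k < J\<close> and \<open>J \<le> - n\<close> follows
        \<open>2 * k \<le> - 2 * n\<close>.\<close>
      have "?p powi (int k + 2 * n) \<le> ?p powi (- int k)"
        unfolding powi_le_iff[OF p] using True J j by linarith
      thus ?thesis using True p by (simp add: a_def)
    next
      case False
      have "b \<ge> 0" using w p unfolding b_def by (intro mult_nonneg_nonneg divide_nonneg_nonneg) auto
      thus ?thesis using False p by simp
    qed
    have "(\<Sum>k<J. a k) + b / (1 - inverse ?p) = W"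
    proof -
      \<comment> \<open>\<open>X\<close> and \<open>Y\<close> carry the whole dependence on
        \<open>J\<close>. Their contributions cancel between the coarse and the fine levels, which
        is the constancy of the potential.\<close>
      define X Y where "X = ?p powi (- int J)" and "Y = ?p powi (2 * n + int J)"
      have "(\<Sum>k<J. a k) = (?p - ?p powi (1 - int J) - Y + ?p powi (2 * n)) / (?p\<^sup>2 - 1)"
        unfolding a_def Y_def by (rule sum_level_weight[OF p])
      also have "?p powi (1 - int J) = ?p * X"
        using p by (simp add: X_def power_int_diff power_int_minus field_simps)
      finally have 1: "(\<Sum>k<J. a k) = (?p - ?p * X - Y + ?p powi (2 * n)) / (?p\<^sup>2 - 1)" .
      have "?w j = (?p - 1) / (?p * (?p + 1)) * (Y + ?p * X)"
        using j p by (simp add: shell_weight_def J(2) X_def Y_def power_int_add power_int_diff power_int_minus field_simps)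
      \<comment> \<open>A factor 1/(p-1) comes from the first ball inside the sphere, relative to
        the mass of the sphere, and p/(p-1) from the geometric series over the finer levels.\<close>
      moreover have "b / (1 - inverse ?p) = ?w j * (?p / (?p - 1)\<^sup>2)"
        using p by (simp add: b_def divide_simps) (simp add: power2_eq_square algebra_simps)
      ultimately have "b / (1 - inverse ?p) = (?p - 1) / (?p * (?p + 1)) * (Y + ?p * X) * (?p / (?p - 1)\<^sup>2)"
        by (simp only:)
      also have "\<dots> = (Y + ?p * X) / (?p\<^sup>2 - 1)"
        unfolding sq using p by (simp add: divide_simps) (simp add: power2_eq_square algebra_simps)
      finally show ?thesis unfolding 1 W_def by (simp add: add_divide_distrib[symmetric])
    qed
    hence "(\<lambda>k. if k < J then a k else b * inverse ?p ^ (k - J)) sums W"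
      using sums_head_geometric[OF q, of J a b] by simp
    thus ?thesis unfolding mass W_def[symmetric] using nonneg by (intro suminf_ennreal_eq)
  qed
qed

theorem theorem3:
  fixes n :: int and E :: "'p :: prime_card padic_P1 set" and p :: real
  defines "p \<equiv> real CARD('p)"
  defines "E \<equiv> of_padic ` padic_prime_scale n padic_ints"
  shows "(n \<ge> 0 \<longrightarrow>
            equilibrium_measure E = on_P1 (haar_additive (padic_prime_scale n padic_ints))) \<and>
         (n < 0 \<longrightarrow>
            (\<exists>c0 :: real. \<exists>c :: int \<Rightarrow> real. \<forall>A \<in> sets borel.
              measure (equilibrium_measure E) A =
                c0 * measure (on_P1 (haar_additive padic_ints)) A +
                (\<Sum>k = n..-1. c k *
                  measure (on_P1 (haar_multiplicative (padic_prime_scale k padic_units))) A))) \<and>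
         robin_constant E =
           ennreal (if n \<ge> 0 then of_int n * ln p + ln p / (p - 1)
                    else (p + p powi (2 * n)) / (p\<^sup>2 - 1) * ln p)"
proof -
  have p: "p > 1" unfolding p_def by (rule card_gt_1)
  have E: "E = of_padic ` zball n" by (simp add: E_def prime_scale_zball)
  have pot: "(\<Sum>k. emeasure (on_P1 \<mu>) (cball (of_padic x) (real CARD('p) powi (- (1 + int k)))))
      = (\<Sum>k. emeasure \<mu> (level (1 + int k) x))"
    if "sets \<mu> = sets borel" for \<mu> :: "'p padic measure" and x
    using that by (intro suminf_cong) (simp only: emeasure_on_P1[OF that] level_def borel_closed closed_cball)
  show ?thesis
  proof (cases "n \<ge> 0")
    case True
    have pot': "(\<Sum>k. emeasure (on_P1 (haar n)) (cball (of_padic x) (real CARD('p) powi (- (1 + int k)))))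
        = ennreal (of_int n + 1 / (p - 1))" if "x \<in> zball n" for x :: "'p padic"
      unfolding pot[OF sets_haar] p_def by (rule haar_potential[OF True that])
    have W: "0 \<le> of_int n + 1 / (p - 1)" using True p by simp
    note ecp = equilibrium_of_constant_potential[OF on_P1_probs[OF haar_probs] W[unfolded p_def]]
    have eq: "robin_constant E = ennreal ((of_int n + 1 / (p - 1)) * ln p)"
      "equilibrium_measure E = on_P1 (haar n)"
      unfolding E p_def by (rule ecp, erule pot'[unfolded p_def])+
    show ?thesis
      using True p eq by (simp add: prime_scale_zball haar_additive_zball algebra_simps add_divide_distrib)
  next
    case False
    hence n: "n < 0" by simp
    have pot': "(\<Sum>k. emeasure (on_P1 (shell_mixture n)) (cball (of_padic x) (real CARD('p) powi (- (1 + int k)))))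
        = ennreal ((p + p powi (2 * n)) / (p\<^sup>2 - 1))" if "x \<in> zball n" for x :: "'p padic"
      unfolding pot[OF sets_shell_mixture] p_def by (rule shell_mixture_potential[OF n that])
    have W: "0 \<le> (p + p powi (2 * n)) / (p\<^sup>2 - 1)" using p by simp
    note ecp = equilibrium_of_constant_potential[OF on_P1_probs[OF shell_mixture_probs[OF n]] W[unfolded p_def]]
    have eq: "robin_constant E = ennreal ((p + p powi (2 * n)) / (p\<^sup>2 - 1) * ln p)"
      "equilibrium_measure E = on_P1 (shell_mixture n)"
      unfolding E p_def by (rule ecp, erule pot'[unfolded p_def])+
    \<comment> \<open>The coefficient of each normalised Haar measure is the weight of its
      shell.\<close>
    let ?w = "shell_weight p n"
    have "measure (equilibrium_measure E) A = ?w 0 * measure (on_P1 (haar_additive padic_ints)) A +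
        (\<Sum>k = n..-1. ?w k * measure (on_P1 (haar_multiplicative (padic_prime_scale k padic_units))) A)"
      if A: "A \<in> sets borel" for A
    proof -
      let ?B = "of_padic -` A"
      have B: "?B \<in> sets (borel :: 'p padic measure)" using A by (rule vimage_of_padic_borel)
      have U: "uniform_measure (haar n) (shell 0 :: 'p padic set) = haar_additive padic_ints"
        "\<And>k. k \<in> {n..-1} \<Longrightarrow> uniform_measure (haar n) (shell k :: 'p padic set) = haar_multiplicative (padic_prime_scale k padic_units)"
        using n haar_eq_uniform_measure[of n 0, where 'p = 'p] haar_multiplicative_psphere[of n, where 'p = 'p]
        by (simp_all add: shell_def padic_ints_eq haar_additive_zball prime_scale_psphere)
      have om: "measure (on_P1 \<mu>) A = measure \<mu> ?B" if "sets \<mu> = sets borel" for \<mu> :: "'p padic measure"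
        unfolding measure_def emeasure_on_P1[OF that A] ..
      \<comment> \<open>Each component is a probability measure, hence finite, so the mixture
        formula descends from \<open>ennreal\<close> to real values.\<close>
      have em: "emeasure (uniform_measure (haar n) (shell i)) ?B = ennreal (measure (uniform_measure (haar n) (shell i :: 'p padic set)) ?B)"
        if "i \<in> {n..0}" for i
      proof -
        interpret prob_space "uniform_measure (haar n) (shell i :: 'p padic set)"
          using shell_probs[of n i, where 'p = 'p] that by (simp add: borel_probs_on_def)
        show ?thesis by (rule emeasure_eq_measure)
      qed
      have "emeasure (shell_mixture n) ?B
          = (\<Sum>i\<in>{n..0}. ennreal (?w i * measure (uniform_measure (haar n) (shell i :: 'p padic set)) ?B))"
        unfolding emeasure_shell_mixture[OF B] p_def
        by (intro sum.cong refl) (simp add: em ennreal_mult'' shell_weight_nonneg[OF card_gt_1])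
      also have "\<dots> = ennreal (\<Sum>i\<in>{n..0}. ?w i * measure (uniform_measure (haar n) (shell i :: 'p padic set)) ?B)"
        by (intro sum_ennreal mult_nonneg_nonneg shell_weight_nonneg[OF p]) simp
      finally have "measure (shell_mixture n) ?B
          = (\<Sum>i\<in>{n..0}. ?w i * measure (uniform_measure (haar n) (shell i :: 'p padic set)) ?B)"
        unfolding measure_def by (simp add: sum_nonneg shell_weight_nonneg[OF p])
      also have "{n..0} = insert 0 {n..-1}" using n by auto
      also have "(\<Sum>i\<in>insert 0 {n..-1}. ?w i * measure (uniform_measure (haar n) (shell i :: 'p padic set)) ?B)
          = ?w 0 * measure (uniform_measure (haar n) (shell 0 :: 'p padic set)) ?B
            + (\<Sum>i = n..-1. ?w i * measure (uniform_measure (haar n) (shell i :: 'p padic set)) ?B)"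
        by simp
      finally have "measure (on_P1 (shell_mixture n)) A
          = ?w 0 * measure (on_P1 (uniform_measure (haar n) (shell 0 :: 'p padic set))) A
            + (\<Sum>i = n..-1. ?w i * measure (on_P1 (uniform_measure (haar n) (shell i :: 'p padic set))) A)"
        by (simp add: om)
      thus ?thesis unfolding eq(2) U(1) by (simp add: U(2))
    qed
    hence "\<exists>c0 c. \<forall>A \<in> sets borel. measure (equilibrium_measure E) A = c0 * measure (on_P1 (haar_additive padic_ints)) A +
        (\<Sum>k = n..-1. c k * measure (on_P1 (haar_multiplicative (padic_prime_scale k padic_units))) A)"
      by blast
    thus ?thesis using n eq(1) by simp
  qed
qed

end
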